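(* Let $s>3/2$ and let $u\in C([0,\infty),H^s(\mathbb{S}))\cap C^1([0,\infty),H^{s-1}(\mathbb{S}))$ be a global solution of the periodic rod equation with parameter $\gamma\le\gamma_1^-$ or $\gamma\ge\gamma_1^+$. If $u$ vanishes at some point $(t_0,x_0)\in[0,\infty)\times\mathbb{S}$, then $u$ is the trivial solution: $u(t,x)=0$ for all $t\ge0$ and $x\in\mathbb{S}$.
   Context: $\mathbb{S}=\mathbb{R}/\mathbb{Z}$. The periodic rod equation with parameter $\gamma\in\mathbb{R}$ is $$u_t+\gamma uu_x=-\partial_x p*\Bigl(\tfrac{3-\gamma}{2}u^2+\tfrac{\gamma}{2}u_x^2\Bigr),\qquad x\in\mathbb{S},$$ where $*$ is convolution on $\mathbb{S}$ and $p(x)=\frac{\cosh(x-[x]-1/2)}{2\sinh(1/2)}$ is the (1-periodic) kernel of $(1-\partial_x^2)^{-1}$, with $[\cdot]$ the integer part. The constants $\gamma_1^-=-1.036\ldots$ and $\gamma_1^+=0.269\ldots$ are defined as follows. For $\alpha,\beta\in\mathbb{R}$ let $$I(\alpha,\beta)=\inf\Bigl\{\int_0^1(p+\beta p_x)(\alpha u^2+u_x^2)\,dx:\ u\in H^1(0,1),\ u(0)=u(1)=1\Bigr\}\in\mathbb{R}\cup\{-\infty\}.$$ Let $\alpha_1^-<0<\alpha_1^+$ be the numbers such that $\bigl(\frac{e+1}{e-1}\bigr)^2+I\bigl(\alpha,\frac{e+1}{e-1}\bigr)-\alpha\ge0\iff\alpha_1^-\le\alpha\le\alpha_1^+$. Then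 $\gamma_1^\pm=\frac{3}{1+\alpha_1^\pm}$. *)

theory Defs
  imports "HOL-Analysis.Analysis"
begin

(* Functions on the circle R/Z are represented by 1-periodic functions on the real line. *)

definition periodic1 :: "(real \<Rightarrow> real) \<Rightarrow> bool" where
  "periodic1 f \<longleftrightarrow> (\<forall>x. f (x + 1) = f x)"

definition circle_conv :: "(real \<Rightarrow> real) \<Rightarrow> (real \<Rightarrow> real) \<Rightarrow> real \<Rightarrow> real" where
  "circle_conv f g x = (LINT y:{0..1}|lebesgue. f (x - y) * g y)"

definition fourier_coeff :: "(real \<Rightarrow> real) \<Rightarrow> int \<Rightarrow> complex" where
  "fourier_coeff f k =
     (LINT x:{0..1}|lebesgue. complex_of_real (f x) * cis (- 2 * pi * of_int k * x))"

definition sobolev_term :: "real \<Rightarrow> (real \<Rightarrow> real) \<Rightarrow> int \<Rightarrow> real" where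
  "sobolev_term s f k = (1 + (2 * pi * of_int k)\<^sup>2) powr s * (cmod (fourier_coeff f k))\<^sup>2"

(* The Sobolev space of order s on the circle. For s < 0 the actual space contains distributions
   that are not functions; only s > 0 is used. Functions that agree almost everywhere are not
   identified. *)
definition sobolev :: "real \<Rightarrow> (real \<Rightarrow> real) set" where
  "sobolev s = {f. periodic1 f \<and> f \<in> borel_measurable lebesgue \<and>
     set_integrable lebesgue {0..1} (\<lambda>x. (f x)\<^sup>2) \<and> sobolev_term s f summable_on UNIV}"

(* Meaningful on sobolev s only: infsum is 0 for a divergent sum. *)
definition sobolev_norm :: "real \<Rightarrow> (real \<Rightarrow> real) \<Rightarrow> real" where
  "sobolev_norm s f = sqrt (infsum (sobolev_term s f) UNIV)"

definition sobolev_C0 :: "real \<Rightarrow> (real \<Rightarrow> real \<Rightarrow> real) \<Rightarrow> bool" where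
  "sobolev_C0 s u \<longleftrightarrow> (\<forall>t\<ge>0. u t \<in> sobolev s) \<and>
     (\<forall>t\<ge>0. ((\<lambda>\<tau>. sobolev_norm s (\<lambda>x. u \<tau> x - u t x)) \<longlongrightarrow> 0) (at t within {0..}))"

(* u is in C^1([0,\<infinity>), H^s), with time derivative v in C([0,\<infinity>), H^s);
   the derivative at t = 0 is one-sided. *)
definition sobolev_C1 ::
    "real \<Rightarrow> (real \<Rightarrow> real \<Rightarrow> real) \<Rightarrow> (real \<Rightarrow> real \<Rightarrow> real) \<Rightarrow> bool" where
  "sobolev_C1 s u v \<longleftrightarrow> (\<forall>t\<ge>0. u t \<in> sobolev s) \<and> sobolev_C0 s v \<and>
     (\<forall>t\<ge>0. ((\<lambda>\<tau>. sobolev_norm s (\<lambda>x. (u \<tau> x - u t x) / (\<tau> - t) - v t x)) \<longlongrightarrow> 0)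
        (at t within {0..}))"

(* The 1-periodic kernel of the inverse of 1 - d^2/dx^2. It is not differentiable at the integers,
   where deriv returns an arbitrary value; it is only ever used under an integral. *)
definition rod_kernel :: "real \<Rightarrow> real" where
  "rod_kernel x = cosh (x - of_int \<lfloor>x\<rfloor> - 1 / 2) / (2 * sinh (1 / 2))"

(* Continuity of u t selects the continuous representative of the H^s class, which exists and is
   of class C^1 because s > 3/2; so the spatial derivative is the classical one, and the pointwise
   values of u are well defined. All other terms of the equation are then continuous in x, so the
   equation between H^(s-1) classes is stated pointwise. *)
definition global_rod_solution :: "real \<Rightarrow> real \<Rightarrow> (real \<Rightarrow> real \<Rightarrow> real) \<Rightarrow> bool" where
  "global_rod_solution \<gamma> s u \<longleftrightarrow>
     (\<forall>t\<ge>0. continuous_on UNIV (u t)) \<and> sobolev_C0 s u \<and>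
     (\<exists>v. sobolev_C1 (s - 1) u v \<and>
        (\<forall>t\<ge>0. \<forall>x. v t x + \<gamma> * u t x * deriv (u t) x =
           - circle_conv (deriv rod_kernel)
               (\<lambda>y. (3 - \<gamma>) / 2 * (u t y)\<^sup>2 + \<gamma> / 2 * (deriv (u t) y)\<^sup>2) x))"

definition test_function_01 :: "(real \<Rightarrow> real) \<Rightarrow> bool" where
  "test_function_01 \<phi> \<longleftrightarrow> (\<forall>x. \<phi> differentiable at x) \<and> continuous_on UNIV (deriv \<phi>) \<and>
     (\<exists>a b. 0 < a \<and> b < 1 \<and> (\<forall>x. x \<notin> {a..b} \<longrightarrow> \<phi> x = 0))"

(* u is in H^1(0,1) with weak derivative g. Continuity on [0,1] selects the continuous
   representative, so that the boundary values u 0 and u 1 are the traces; square integrability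
   of u follows from it. *)
definition H1_with_deriv :: "(real \<Rightarrow> real) \<Rightarrow> (real \<Rightarrow> real) \<Rightarrow> bool" where
  "H1_with_deriv u g \<longleftrightarrow> continuous_on {0..1} u \<and>
     set_borel_measurable lebesgue {0<..<1} g \<and>
     set_integrable lebesgue {0<..<1} (\<lambda>x. (g x)\<^sup>2) \<and>
     (\<forall>\<phi>. test_function_01 \<phi> \<longrightarrow>
        (LINT x:{0<..<1}|lebesgue. u x * deriv \<phi> x) = - (LINT x:{0<..<1}|lebesgue. g x * \<phi> x))"

definition rod_I :: "real \<Rightarrow> real \<Rightarrow> ereal" where
  "rod_I \<alpha> \<beta> = (INF (u, g) \<in> {(u, g). H1_with_deriv u g \<and> u 0 = 1 \<and> u 1 = 1}.
     ereal (LINT x:{0<..<1}|lebesgue.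
       (rod_kernel x + \<beta> * deriv rod_kernel x) * (\<alpha> * (u x)\<^sup>2 + (g x)\<^sup>2)))"

definition rod_beta :: real where
  "rod_beta = (exp 1 + 1) / (exp 1 - 1)"

definition alpha1 :: "real \<times> real" where
  "alpha1 = (THE (am, ap). am < 0 \<and> 0 < ap \<and>
     (\<forall>\<alpha>. ereal (rod_beta\<^sup>2) + rod_I \<alpha> rod_beta - ereal \<alpha> \<ge> 0 \<longleftrightarrow> am \<le> \<alpha> \<and> \<alpha> \<le> ap))"

definition gamma1_minus :: real where
  "gamma1_minus = 3 / (1 + fst alpha1)"

definition gamma1_plus :: real where
  "gamma1_plus = 3 / (1 + snd alpha1)"

end

theory Submission
  imports Defs
begin

text \<open>Put \<open>\<alpha> = 3 / \<gamma> - 1\<close> and \<open>\<beta> = (e + 1) / (e - 1) = coth (1 / 2)\<close>.  On \<open>(0, 1)\<close> the weight \<open>p + \<beta> p\<^sub>x\<close>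
  equals \<open>sinh x / (2 sinh\<^sup>2 (1 / 2))\<close>, and \<open>p - \<beta> p\<^sub>x\<close> is its reflection.  The condition on \<open>\<gamma>\<close> says that
  \<open>\<beta>\<^sup>2 + I(\<alpha>, \<beta>) - \<alpha> \<ge> 0\<close>, whence \<open>(p \<plusminus> \<beta> p\<^sub>x) * (\<alpha> u\<^sup>2 + u\<^sub>x\<^sup>2) \<ge> (\<alpha> - \<beta>\<^sup>2) u\<^sup>2\<close>.  By symmetry let
  \<open>\<gamma> > 0\<close>.  Along a characteristic \<open>q' = \<gamma> u(t, q)\<close> the functions \<open>a = \<beta> u - u\<^sub>x\<close> and \<open>b = - \<beta> u - u\<^sub>x\<close>
  satisfy \<open>a' \<ge> \<gamma> a b / 2\<close> and \<open>b' \<ge> \<gamma> a b / 2\<close>; if both were positive at some time, \<open>1 / a + 1 / b\<close> would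
  reach zero in finite time.  So \<open>u\<^sub>x \<ge> - \<beta> \<bar>u\<bar>\<close> everywhere for a global solution, and a periodic function
  with this property that vanishes at one point vanishes identically.  Finally the mean of \<open>u\<close> is
  conserved: it is zero at time \<open>t\<^sub>0\<close>, hence at all times, so \<open>u t\<close> has a zero at every time \<open>t\<close>.\<close>

section \<open>Fourier series of continuous Sobolev functions\<close>

text \<open>The differential inequalities rest on an exact cancellation. With
  \<open>\<alpha> = 3 / \<gamma> - 1\<close> the function \<open>F\<close> under the convolution is
  \<open>\<gamma> / 2 * (\<alpha> u^2 + u_x^2)\<close>, the integrand of the variational problem.
  Along a characteristic, \<open>a'\<close> and \<open>b'\<close> are \<open>p * F\<close> minus or
  plus \<open>\<beta> (p_x * F)\<close>, plus \<open>\<gamma> / 2 * (u_x^2 - \<alpha> u^2)\<close>,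
  while \<open>a b = u_x^2 - \<beta>^2 u^2\<close>; the convolution bound supplies precisely the
  missing multiple of \<open>u^2\<close>. The value of \<beta> is the largest for which both
  \<open>p \<plusminus> \<beta> p_x\<close> are nonnegative. Two obstacles shape the rest. For
  \<open>s\<close> near 3/2 the slope \<open>u_x\<close> is merely continuous, so its equation along
  a characteristic is not obtained by differentiating the rod equation in space. And
  \<open>alpha1\<close> is a definite description that has to be shown to denote; what is extracted
  from it is that the parameters \<alpha> form a closed interval containing -5/4 and a positive
  number.\<close>

lemma periodic1_of_int:
  assumes "periodic1 f"
  shows "f (x + of_int n) = f x"
proof (induction n rule: int_induct[where k = 0])
  case (step1 i)
  then show ?case using assms by (simp add: periodic1_def add.assoc[symmetric])
next
  case (step2 i)
  have "f (x + of_int (i - 1) + 1) = f (x + of_int (i - 1))"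
    using assms by (simp only: periodic1_def)
  with step2 show ?case by (simp add: algebra_simps)
qed simp

lemma periodic1_derivative:
  assumes "periodic1 f" and d: "\<And>x. (f has_real_derivative f' x) (at x)"
  shows "periodic1 f'"
  unfolding periodic1_def
proof
  fix x
  have "((\<lambda>y. f (y + 1)) has_real_derivative f' (x + 1)) (at x)"
    using d[of "x + 1"] by (simp add: DERIV_shift)
  then have "(f has_real_derivative f' (x + 1)) (at x)"
    using assms(1) by (simp add: periodic1_def)
  then show "f' (x + 1) = f' x" using d by (rule DERIV_unique)
qed

section \<open>Uniqueness of Fourier coefficients for continuous functions on the circle\<close>

text \<open>\<open>Arg2pi\<close> jumps across the positive real axis, and \<open>h 0 = h 1\<close>
  closes the gap. A loop is homotopic to itself; passing from homotopic loops to homotopic circle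
  maps yields the continuity without any estimate at the jump.\<close>

lemma continuous_on_circle_descent:
  fixes h :: "real \<Rightarrow> 'a::real_normed_vector"
  assumes "continuous_on {0..1} h" "h 0 = h 1"
  shows "continuous_on (sphere 0 1) (h \<circ> (\<lambda>z. Arg2pi z / (2 * pi)))"
proof -
  have "homotopic_loops UNIV h h"
    using assms by (simp add: homotopic_loops_refl path_def pathstart_def pathfinish_def path_image_def)
  from homotopic_loops_imp_homotopic_circlemaps[OF this] show ?thesis
    by (blast dest: homotopic_with_imp_continuous)
qed

text \<open>Complex values are forced even when the function of interest is real: multiplication by
  an exponential shifts the index \<open>k\<close> and leaves the reals.\<close>

definition fourier_null :: "(real \<Rightarrow> complex) \<Rightarrow> bool" where
  "fourier_null h \<longleftrightarrow> continuous_on {0..1} h \<and>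
     (\<forall>k::int. integral {0..1} (\<lambda>x. h x * cis (2 * pi * of_int k * x)) = 0)"

lemma cis_int_1: "cis (2 * pi * of_int k) = 1"
  by (simp add: cis.ctr complex_eq_iff cos_int_2pin sin_int_2pin)

lemma fourier_null_mult_cis:
  assumes "fourier_null h"
  shows "fourier_null (\<lambda>x. h x * cis (2 * pi * of_int m * x))"
proof -
  have "(\<lambda>x. h x * cis (2 * pi * of_int m * x) * cis (2 * pi * of_int k * x))
      = (\<lambda>x. h x * cis (2 * pi * of_int (m + k) * x))" for k
    by (simp add: fun_eq_iff cis_mult algebra_simps)
  then show ?thesis
    using assms unfolding fourier_null_def
    by (auto intro!: continuous_intros simp del: of_int_add)
qed

lemma fourier_null_add:
  assumes "fourier_null f" "fourier_null g"
  shows "fourier_null (\<lambda>x. f x + g x)"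
proof -
  have "integral {0..1} (\<lambda>x. (f x + g x) * cis (2 * pi * of_int k * x)) = 0" for k
    using assms unfolding fourier_null_def
    by (simp add: distrib_right, subst integral_add)
       (auto intro!: integrable_continuous_interval continuous_intros)
  then show ?thesis using assms unfolding fourier_null_def
    by (auto intro!: continuous_intros)
qed

lemma fourier_null_cmult:
  assumes "fourier_null f"
  shows "fourier_null (\<lambda>x. f x * c)"
proof -
  have "integral {0..1} (\<lambda>x. f x * c * cis (2 * pi * of_int k * x)) = 0" for k
  proof -
    have "(\<lambda>x. f x * c * cis (2 * pi * of_int k * x)) = (\<lambda>x. f x * cis (2 * pi * of_int k * x) * c)"
      by (simp add: mult_ac)
    then show ?thesis using assms unfolding fourier_null_def by simp
  qed
  then show ?thesis using assms unfolding fourier_null_def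
    by (auto intro!: continuous_intros)
qed

text \<open>A real linear functional of \<open>cis t\<close> is a combination of
  \<open>cos t\<close> and \<open>sin t\<close>, hence of \<open>cis t\<close> and
  \<open>cis (- t)\<close>, so multiplication by it only shifts Fourier indices by one.\<close>

lemma fourier_null_mult_linear:
  fixes L :: "complex \<Rightarrow> real"
  assumes "bounded_linear L" "fourier_null f"
  shows "fourier_null (\<lambda>x. f x * of_real (L (cis (2 * pi * x))))"
proof -
  interpret L: bounded_linear L by fact
  let ?c = "complex_of_real (L 1)" and ?d = "complex_of_real (L \<i>)"
  have L: "complex_of_real (L (cis t)) = cis t * ((?c - \<i> * ?d) / 2) + cis (-t) * ((?c + \<i> * ?d) / 2)" for t
  proof -
    have "cis t = cos t *\<^sub>R 1 + sin t *\<^sub>R \<i>" by (simp add: complex_eq_iff)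
    then have "L (cis t) = cos t * L 1 + sin t * L \<i>"
      by (metis L.add L.scaleR real_scaleR_def)
    then show ?thesis by (simp add: complex_eq_iff field_simps)
  qed
  have eq: "f x * of_real (L (cis (2 * pi * x))) =
      f x * cis (2 * pi * of_int 1 * x) * ((?c - \<i> * ?d) / 2) +
      f x * cis (2 * pi * of_int (-1) * x) * ((?c + \<i> * ?d) / 2)" for x
    unfolding L by (simp add: algebra_simps add_divide_distrib diff_divide_distrib)
  show ?thesis unfolding eq
    by (intro fourier_null_add fourier_null_cmult fourier_null_mult_cis assms)
qed

text \<open>\<open>fourier_null\<close> is stable under multiplication by trigonometric polynomials; polynomials in the
  point \<open>cis (2 * pi * x)\<close> of the circle are of this kind, and are uniformly dense by Stone-Weierstrass.\<close>

lemma fourier_null_mult_polynomial: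
  assumes "real_polynomial_function p" "fourier_null f"
  shows "fourier_null (\<lambda>x. f x * of_real (p (cis (2 * pi * x))))"
  using assms
proof (induction arbitrary: f rule: real_polynomial_function.induct)
  case (linear L)
  then show ?case by (rule fourier_null_mult_linear)
next
  case (const c)
  then show ?case by (intro fourier_null_cmult)
next
  case (add p q)
  then show ?case by (simp add: distrib_left fourier_null_add)
next
  case (mult p q)
  from mult.IH(2)[OF mult.IH(1)[OF mult.prems]] show ?case by (simp add: mult.assoc)
qed

text \<open>Let \<open>p\<close> be a polynomial uniformly close to \<open>Re h\<close> on the
  circle. As \<open>p\<close> is real and orthogonal to \<open>h\<close>, it is orthogonal to
  \<open>Re h\<close>, so the integral of \<open>(Re h)^2\<close> equals that of
  \<open>Re h * (Re h - p)\<close>, which is small.\<close>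

lemma fourier_null_Re_eq_0:
  assumes "fourier_null h" "h 0 = h 1" "x \<in> {0..1}"
  shows "Re (h x) = 0"
proof -
  let ?r = "\<lambda>x. Re (h x)"
  have hc: "continuous_on {0..1} h" using assms unfolding fourier_null_def by blast
  then have rc: "continuous_on {0..1} ?r" by (intro continuous_intros)
  obtain B where B: "\<And>x. x \<in> {0..1} \<Longrightarrow> \<bar>?r x\<bar> \<le> B"
    using compact_imp_bounded[OF compact_continuous_image[OF rc compact_Icc]]
    unfolding bounded_iff by (metis imageI real_norm_def)
  have B0: "0 \<le> B" using B[of 0] by auto
  let ?R = "?r \<circ> (\<lambda>z. Arg2pi z / (2 * pi))"
  have Rc: "continuous_on (sphere 0 1) ?R"
    using rc assms(2) by (intro continuous_on_circle_descent) auto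
  have R: "?R (cis (2 * pi * x)) = ?r x" if "x \<in> {0..1}" for x
  proof (cases "x = 1")
    case True
    then show ?thesis using assms(2) by (simp add: Arg2pi_of_real[of 1, simplified])
  next
    case False
    then have "Arg2pi (cis (2 * pi * x)) = 2 * pi * x"
      using that by (intro Arg2pi_unique[of 1]) (auto simp: cis_conv_exp)
    then show ?thesis by simp
  qed
  have "integral {0..1} (\<lambda>x. (?r x)\<^sup>2) \<le> e" if e: "e > 0" for e
  proof -
    \<comment> \<open>The \<open>+ 1\<close> keeps the quotient meaningful when
      \<open>B = 0\<close>, and still \<open>B * d \<le> e\<close>.\<close>
    define d where "d = e / (B + 1)"
    have d: "d > 0" using e B0 by (simp add: d_def)
    obtain p where p: "real_polynomial_function p" "\<And>z. z \<in> sphere 0 1 \<Longrightarrow> \<bar>?R z - p z\<bar> < d"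
      using Stone_Weierstrass_real_polynomial_function[OF compact_sphere Rc d] by blast
    let ?p = "\<lambda>x. p (cis (2 * pi * x))"
    have pc: "continuous_on {0..1} ?p"
      by (rule continuous_on_compose2[OF continuous_on_polymonial_function[of p UNIV]])
         (use p in \<open>auto intro!: continuous_intros simp: real_polynomial_function_eq\<close>)
    have "fourier_null (\<lambda>x. h x * of_real (?p x))"
      by (intro fourier_null_mult_polynomial p assms)
    then have "integral {0..1} (\<lambda>x. h x * of_real (?p x) * cis (2 * pi * of_int 0 * x)) = 0"
      unfolding fourier_null_def by blast
    then have "Re (integral {0..1} (\<lambda>x. h x * of_real (?p x))) = 0" by simp
    moreover have hpi: "(\<lambda>x. h x * of_real (?p x)) integrable_on {0..1}"
      by (intro integrable_continuous_interval continuous_intros hc pc)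
    have "Re (integral {0..1} (\<lambda>x. h x * of_real (?p x))) = integral {0..1} (\<lambda>x. ?r x * ?p x)"
      using integral_linear[OF hpi bounded_linear_Re] by (simp add: o_def)
    ultimately have 0: "integral {0..1} (\<lambda>x. ?r x * ?p x) = 0" by simp
    have "integral {0..1} (\<lambda>x. (?r x)\<^sup>2) = integral {0..1} (\<lambda>x. (?r x)\<^sup>2) - integral {0..1} (\<lambda>x. ?r x * ?p x)"
      by (simp add: 0)
    also have "\<dots> = integral {0..1} (\<lambda>x. (?r x)\<^sup>2 - ?r x * ?p x)"
      by (rule integral_diff[symmetric]; intro integrable_continuous_interval continuous_intros rc pc)
    also have "\<dots> \<le> integral {0..1} (\<lambda>x::real. B * d)"
    proof (rule integral_le)
      fix x :: real assume x: "x \<in> {0..1}"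
      have "\<bar>?r x - ?p x\<bar> \<le> d" using p(2)[of "cis (2 * pi * x)"] R[OF x] by simp
      then have "\<bar>?r x * (?r x - ?p x)\<bar> \<le> B * d"
        unfolding abs_mult using B[OF x] d B0 by (intro mult_mono) auto
      then show "(?r x)\<^sup>2 - ?r x * ?p x \<le> B * d"
        by (simp add: power2_eq_square right_diff_distrib)
    qed (intro integrable_continuous_interval continuous_intros rc pc)+
    also have "\<dots> \<le> e" using e B0 by (simp add: d_def field_simps)
    finally show ?thesis .
  qed
  then have "integral {0..1} (\<lambda>x. (?r x)\<^sup>2) \<le> 0" by (rule field_le_epsilon) simp
  moreover have "0 \<le> integral {0..1} (\<lambda>x. (?r x)\<^sup>2)"
    by (intro integral_nonneg integrable_continuous_interval continuous_intros rc) auto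
  ultimately have "((\<lambda>x. (?r x)\<^sup>2) has_integral 0) (cbox 0 1)"
    using rc by (intro has_integral_integrable_integral[THEN iffD2])
       (auto intro!: integrable_continuous_interval continuous_intros)
  then have "(?r x)\<^sup>2 = 0"
    using assms(3) rc by (intro has_integral_0_cbox_imp_0[of 0 1 "\<lambda>x. (?r x)\<^sup>2"])
       (auto intro!: continuous_intros)
  then show ?thesis by simp
qed

lemma fourier_null_eq_0:
  assumes "fourier_null h" "h 0 = h 1" "x \<in> {0..1}"
  shows "h x = 0"
proof -
  have "Re (h x * (- \<i>)) = 0"
    using fourier_null_Re_eq_0[OF fourier_null_cmult[OF assms(1)], of "- \<i>" x] assms by simp
  with fourier_null_Re_eq_0[OF assms] show ?thesis by (simp add: complex_eq_iff)
qed

lemma integral_cis_int: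
  "integral {0..1} (\<lambda>x. cis (2 * pi * of_int k * x)) = (if k = 0 then 1 else 0)"
proof (cases "k = 0")
  case False
  define c where "c = \<i> * complex_of_real (2 * pi * of_int k)"
  have c: "c \<noteq> 0" using False by (simp add: c_def)
  have cis: "cis (2 * pi * of_int k * x) = exp (of_real x * c)" for x
    by (simp add: cis_conv_exp c_def mult_ac)
  have "((\<lambda>x. exp (of_real x * c)) has_integral exp (of_real 1 * c) / c - exp (of_real 0 * c) / c) {0..1}"
  proof (rule fundamental_theorem_of_calculus)
    fix x :: real
    have "((\<lambda>z. exp (z * c) / c) has_field_derivative exp (of_real x * c)) (at (of_real x))"
      using c by (auto intro!: derivative_eq_intros)
    then show "((\<lambda>x. exp (of_real x * c) / c) has_vector_derivative exp (of_real x * c)) (at x within {0..1})"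
      by (intro has_vector_derivative_real_field)
  qed simp
  moreover have "exp (of_real 1 * c) = 1" using cis[of 1] cis_int_1[of k] by simp
  ultimately show ?thesis using False by (simp add: cis integral_unique)
qed simp

lemma fourier_coeff_eq_integral:
  assumes "continuous_on UNIV f"
  shows "fourier_coeff f k = integral {0..1} (\<lambda>x. of_real (f x) * cis (- 2 * pi * of_int k * x))"
  unfolding fourier_coeff_def
  by (intro set_lebesgue_integral_eq_integral absolutely_integrable_continuous_real
        continuous_intros continuous_on_subset[OF assms]) auto

text \<open>The sum over \<open>\<int>\<close> is taken along the filter of finite subsets, for which uniform limits
  still commute with integrals.\<close>

lemma uniform_limit_trig_series:
  assumes "(\<lambda>k. cmod (c k)) summable_on UNIV"
  shows "uniform_limit UNIV (\<lambda>F x. \<Sum>k\<in>F. c k * cis (2 * pi * of_int k * x))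
           (\<lambda>x. \<Sum>\<^sub>\<infinity>k. c k * cis (2 * pi * of_int k * x)) (finite_subsets_at_top (UNIV::int set))"
  by (rule Weierstrass_m_test_general[OF _ assms]) (simp add: norm_mult)

lemma continuous_trig_series:
  assumes "(\<lambda>k. cmod (c k)) summable_on UNIV"
  shows "continuous_on UNIV (\<lambda>x. \<Sum>\<^sub>\<infinity>k::int. c k * cis (2 * pi * of_int k * x))"
  by (rule uniform_limit_theorem[OF _ uniform_limit_trig_series[OF assms]])
     (auto intro!: always_eventually continuous_intros)

text \<open>The factor \<open>h\<close> serves two purposes: an exponential picks out a coefficient
  of the sum, and the constant 1 integrates the series termwise over any interval.\<close>

lemma has_integral_trig_series:
  assumes c: "(\<lambda>k. cmod (c k)) summable_on UNIV" and h: "continuous_on {a..b} h"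
  shows "((\<lambda>F. \<Sum>k\<in>F. c k * integral {a..b} (\<lambda>x. cis (2 * pi * of_int k * x) * h x))
      \<longlongrightarrow> integral {a..b} (\<lambda>x. (\<Sum>\<^sub>\<infinity>k::int. c k * cis (2 * pi * of_int k * x)) * h x))
      (finite_subsets_at_top UNIV)"
proof -
  let ?S = "\<lambda>F x. \<Sum>k\<in>F. c k * cis (2 * pi * of_int k * x)"
  have bh: "bounded (h ` {a..b})"
    by (intro compact_imp_bounded compact_continuous_image h compact_Icc)
  have bg: "bounded ((\<lambda>x. \<Sum>\<^sub>\<infinity>k::int. c k * cis (2 * pi * of_int k * x)) ` {a..b})"
    by (intro compact_imp_bounded compact_continuous_image
          continuous_on_subset[OF continuous_trig_series[OF c]]) auto
  have "uniform_limit {a..b} (\<lambda>F x. ?S F x * h x)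
      (\<lambda>x. (\<Sum>\<^sub>\<infinity>k::int. c k * cis (2 * pi * of_int k * x)) * h x) (finite_subsets_at_top UNIV)"
    using uniform_limit_on_subset[OF uniform_limit_trig_series[OF c], of "{a..b}"] bh bg
    by (intro uniform_lim_mult uniform_limit_const) auto
  then obtain I J where IJ: "\<And>F. ((\<lambda>x. ?S F x * h x) has_integral I F) {a..b}"
     "((\<lambda>x. (\<Sum>\<^sub>\<infinity>k::int. c k * cis (2 * pi * of_int k * x)) * h x) has_integral J) {a..b}"
     "(I \<longlongrightarrow> J) (finite_subsets_at_top UNIV)"
    by (rule uniform_limit_integral) (auto intro!: continuous_intros h)
  have "I = (\<lambda>F. \<Sum>k\<in>F. c k * integral {a..b} (\<lambda>x. cis (2 * pi * of_int k * x) * h x))"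
  proof
    fix F
    have "I F = integral {a..b} (\<lambda>x. ?S F x * h x)" using IJ(1)[of F] by (simp add: integral_unique)
    also have "\<dots> = integral {a..b} (\<lambda>x. \<Sum>k\<in>F. c k * (cis (2 * pi * of_int k * x) * h x))"
      by (simp add: sum_distrib_right mult.assoc)
    also have "\<dots> = (\<Sum>k\<in>F. integral {a..b} (\<lambda>x. c k * (cis (2 * pi * of_int k * x) * h x)))"
    proof (cases "finite F")
      case True
      then show ?thesis
        by (rule integral_sum) (intro integrable_continuous_interval continuous_intros h)
    qed simp
    finally show "I F = (\<Sum>k\<in>F. c k * integral {a..b} (\<lambda>x. cis (2 * pi * of_int k * x) * h x))" by simp
  qed
  with IJ(2,3) show ?thesis by (simp add: integral_unique)
qed

text \<open>Uniqueness replaces a theorem on pointwise convergence: the absolutely summable series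
  is a continuous periodic function with the coefficients of \<open>f\<close>, so the difference
  satisfies \<open>fourier_null\<close> and vanishes at \<open>frac x\<close>.\<close>

lemma fourier_inversion:
  assumes f: "periodic1 f" "continuous_on UNIV f"
    and s: "(\<lambda>k. cmod (fourier_coeff f k)) summable_on UNIV"
  shows "complex_of_real (f x) = (\<Sum>\<^sub>\<infinity>k. fourier_coeff f k * cis (2 * pi * of_int k * x))"
proof -
  define g where "g = (\<lambda>x. \<Sum>\<^sub>\<infinity>k. fourier_coeff f k * cis (2 * pi * of_int k * x))"
  have gc: "continuous_on UNIV g" unfolding g_def by (rule continuous_trig_series[OF s])
  have g1: "g (y + of_int n) = g y" for y n
  proof -
    have "cis (2 * pi * of_int k * (y + of_int n)) = cis (2 * pi * of_int k * y)" for k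
    proof -
      have "cis (2 * pi * of_int k * (y + of_int n)) = cis (2 * pi * of_int k * y) * cis (2 * pi * of_int (k * n))"
        by (simp add: cis_mult algebra_simps)
      then show ?thesis by (simp only: cis_int_1 mult_1_right)
    qed
    then show ?thesis by (simp add: g_def)
  qed
  have f1: "f (y + of_int n) = f y" for y n by (rule periodic1_of_int[OF f(1)])
  define h where "h = (\<lambda>x. complex_of_real (f x) - g x)"
  have hc: "continuous_on UNIV h" unfolding h_def by (intro continuous_intros f gc)
  have "integral {0..1} (\<lambda>x. h x * cis (2 * pi * of_int k * x)) = 0" for k
  proof -
    have "((\<lambda>F. \<Sum>l\<in>F. fourier_coeff f l * integral {0..1} (\<lambda>x. cis (2 * pi * of_int l * x) * cis (2 * pi * of_int k * x)))
        \<longlongrightarrow> integral {0..1} (\<lambda>x. g x * cis (2 * pi * of_int k * x))) (finite_subsets_at_top UNIV)"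
      unfolding g_def by (rule has_integral_trig_series[OF s]) (intro continuous_intros)
    moreover have "integral {0..1} (\<lambda>x. cis (2 * pi * of_int l * x) * cis (2 * pi * of_int k * x)) =
        (if l = - k then 1 else 0)" for l
      using integral_cis_int[of "l + k"] by (simp add: cis_mult algebra_simps eq_neg_iff_add_eq_0)
    \<comment> \<open>Every finite set that contains \<open>- k\<close> gives the same value, so the
      net is eventually constant. The index is \<open>- k\<close> because
      \<open>fourier_null\<close> tests with the positive exponent.\<close>
    moreover have "((\<lambda>F. \<Sum>l\<in>F. fourier_coeff f l * (if l = - k then 1 else 0)) \<longlongrightarrow> fourier_coeff f (- k))
        (finite_subsets_at_top UNIV)"
    proof (rule tendsto_eventually, unfold eventually_finite_subsets_at_top, intro exI conjI allI impI)
      fix F assume F: "finite F \<and> {- k} \<subseteq> F \<and> F \<subseteq> UNIV"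
      have "(\<Sum>l\<in>F. fourier_coeff f l * (if l = - k then 1 else 0)) = (\<Sum>l\<in>F. if l = - k then fourier_coeff f l else 0)"
        by (rule sum.cong) auto
      then show "(\<Sum>l\<in>F. fourier_coeff f l * (if l = - k then 1 else 0)) = fourier_coeff f (- k)"
        using F by (simp add: sum.delta)
    qed auto
    ultimately have "integral {0..1} (\<lambda>x. g x * cis (2 * pi * of_int k * x)) = fourier_coeff f (- k)"
      by (simp only:) (rule tendsto_unique[OF finite_subsets_at_top_neq_bot], assumption, assumption)
    moreover have "integral {0..1} (\<lambda>x. of_real (f x) * cis (2 * pi * of_int k * x)) = fourier_coeff f (- k)"
      using fourier_coeff_eq_integral[OF f(2), of "- k"] by simp
    moreover have "integral {0..1} (\<lambda>x. h x * cis (2 * pi * of_int k * x)) =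
       integral {0..1} (\<lambda>x. of_real (f x) * cis (2 * pi * of_int k * x)) - integral {0..1} (\<lambda>x. g x * cis (2 * pi * of_int k * x))"
      unfolding h_def left_diff_distrib
      by (intro integral_diff integrable_continuous_interval continuous_intros
            continuous_on_subset[OF f(2)] continuous_on_subset[OF gc]) auto
    ultimately show ?thesis by simp
  qed
  then have "fourier_null h"
    unfolding fourier_null_def using continuous_on_subset[OF hc] by auto
  moreover have hp: "h (y + of_int n) = h y" for y n by (simp add: h_def f1 g1)
  ultimately have "h (frac x) = 0"
    using hp[of 0 1] by (intro fourier_null_eq_0) (auto simp: frac_lt_1 less_imp_le)
  then have "h x = 0" using hp[of "frac x" "\<lfloor>x\<rfloor>"] by (simp add: frac_def)
  then show ?thesis by (simp add: h_def g_def)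
qed


section \<open>Sobolev embedding into bounded and into \<open>C^1\<close> functions\<close>

text \<open>The square of the Japanese bracket of the frequency \<open>2 * pi * k\<close>, the
  weight of \<open>sobolev_term\<close>.\<close>

definition japanese_sq :: "int \<Rightarrow> real" where
  "japanese_sq k = 1 + (2 * pi * of_int k)\<^sup>2"

lemma japanese_sq_pos: "japanese_sq k > 0"
  by (simp add: japanese_sq_def add_pos_nonneg)

lemma summable_japanese:
  assumes "\<sigma> > 1 / 2"
  shows "(\<lambda>k. japanese_sq k powr (- \<sigma>)) summable_on UNIV"
proof -
  let ?w = "\<lambda>n. japanese_sq (int n) powr (- \<sigma>)"
  have "summable ?w"
  proof (rule summable_comparison_test_ev)
    show "summable (\<lambda>n. real n powr (- 2 * \<sigma>))"
      using assms by (subst summable_real_powr_iff) simp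
    have "?w n \<le> real n powr (- 2 * \<sigma>)" if "n \<ge> 1" for n
    proof -
      have "(real n)\<^sup>2 \<le> (2 * pi * real n)\<^sup>2"
        using pi_ge_two by (intro power_mono) (auto simp: mult_le_cancel_right1)
      then have "(real n)\<^sup>2 \<le> japanese_sq (int n)"
        unfolding japanese_sq_def of_int_of_nat_eq by linarith
      then have "?w n \<le> ((real n)\<^sup>2) powr (- \<sigma>)"
        using that assms by (intro powr_mono2') auto
      also have "\<dots> = real n powr (2 * - \<sigma>)"
        using that by (simp only: powr_powr[symmetric]) simp
      finally show ?thesis by simp
    qed
    then show "\<forall>\<^sub>F n in sequentially. norm (?w n) \<le> real n powr (- 2 * \<sigma>)"
      by (auto intro!: eventually_sequentiallyI[of 1])
  qed
  then have w: "?w summable_on UNIV"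
    by (subst summable_on_UNIV_nonneg_real_iff) auto
  have 1: "(\<lambda>k. japanese_sq k powr (- \<sigma>)) summable_on range int"
    using w by (subst summable_on_reindex) (auto simp: o_def)
  have 2: "(\<lambda>k. japanese_sq k powr (- \<sigma>)) summable_on range (\<lambda>n. - int n)"
    using w by (subst summable_on_reindex) (auto simp: o_def japanese_sq_def inj_on_def)
  have "UNIV = range int \<union> range (\<lambda>n. - int n)"
    by (auto simp: image_iff) (metis int_cases2)
  then show ?thesis using summable_on_union[OF 1 2] by simp
qed

text \<open>Cauchy-Schwarz after splitting the exponent \<open>\<tau> / 2\<close> into
  \<open>- (\<sigma> - \<tau>) / 2\<close> and \<open>\<sigma> / 2\<close>: the first factor is
  square summable since \<open>\<sigma> - \<tau> > 1 / 2\<close>, the second produces the Sobolev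
  norm. The case \<open>\<tau> = 0\<close> bounds a function, \<open>\<tau> = 1\<close> its
  derivative.\<close>

lemma sobolev_weighted_l1:
  assumes s: "sobolev_term \<sigma> f summable_on UNIV" and \<tau>: "\<sigma> - \<tau> > 1 / 2"
  shows "(\<lambda>k. japanese_sq k powr (\<tau> / 2) * cmod (fourier_coeff f k)) summable_on UNIV" (is "?a summable_on _")
    and "(\<Sum>\<^sub>\<infinity>k. japanese_sq k powr (\<tau> / 2) * cmod (fourier_coeff f k))
       \<le> sqrt (\<Sum>\<^sub>\<infinity>k. japanese_sq k powr (- (\<sigma> - \<tau>))) * sobolev_norm \<sigma> f" (is "_ \<le> ?B")
proof -
  let ?W = "\<Sum>\<^sub>\<infinity>k. japanese_sq k powr (- (\<sigma> - \<tau>))"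
  have W: "(\<lambda>k. japanese_sq k powr (- (\<sigma> - \<tau>))) summable_on UNIV"
    by (rule summable_japanese[OF \<tau>])
  have e: "- (\<sigma> - \<tau>) / 2 + \<sigma> / 2 = \<tau> / 2" by (simp add: field_simps)
  have sq: "(japanese_sq k powr (a / 2))\<^sup>2 = japanese_sq k powr a" for k a
    by (simp only: power2_eq_square powr_add[symmetric] field_sum_of_halves)
  have st: "sobolev_term \<sigma> f k = japanese_sq k powr \<sigma> * (cmod (fourier_coeff f k))\<^sup>2" for k
    by (simp add: sobolev_term_def japanese_sq_def)
  have st0: "0 \<le> sobolev_term \<sigma> f k" for k by (simp add: st)
  have fin: "sum ?a F \<le> ?B" if F: "finite F" for F
  proof -
    have "sum ?a F = (\<Sum>k\<in>F. japanese_sq k powr (- (\<sigma> - \<tau>) / 2) * (japanese_sq k powr (\<sigma> / 2) * cmod (fourier_coeff f k)))"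
      by (simp only: mult.assoc[symmetric] powr_add[symmetric] e)
    then have "(sum ?a F)\<^sup>2 \<le> (\<Sum>k\<in>F. (japanese_sq k powr (- (\<sigma> - \<tau>) / 2))\<^sup>2) *
        (\<Sum>k\<in>F. (japanese_sq k powr (\<sigma> / 2) * cmod (fourier_coeff f k))\<^sup>2)"
      by (simp only: Cauchy_Schwarz_ineq_sum)
    also have "\<dots> = (\<Sum>k\<in>F. japanese_sq k powr (- (\<sigma> - \<tau>))) * (\<Sum>k\<in>F. sobolev_term \<sigma> f k)"
      by (simp only: power_mult_distrib sq st)
    also have "\<dots> \<le> ?W * infsum (sobolev_term \<sigma> f) UNIV"
      using F W s
      by (intro mult_mono finite_sum_le_infsum infsum_nonneg sum_nonneg)
        (simp_all add: st0 del: minus_diff_eq)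
    finally have "sum ?a F \<le> sqrt (?W * infsum (sobolev_term \<sigma> f) UNIV)"
      by (rule real_le_rsqrt)
    then show ?thesis
      by (simp only: real_sqrt_mult sobolev_norm_def)
  qed
  show "?a summable_on UNIV"
    by (rule nonneg_bdd_above_summable_on) (simp, rule bdd_aboveI2[where M = ?B], rule fin, simp)
  then show "infsum ?a UNIV \<le> ?B"
    by (rule infsum_le_finite_sums) (rule fin)
qed

text \<open>The norm dominates the absolutely convergent Fourier series. The bound serves at order
  \<open>s\<close> for differences of \<open>u\<close> in time, and at order
  \<open>s - 1 > 1 / 2\<close> for its time difference quotients.\<close>

lemma sobolev_sup_bound:
  assumes f: "periodic1 f" "continuous_on UNIV f"
    and s: "sobolev_term \<sigma> f summable_on UNIV" and \<sigma>: "\<sigma> > 1 / 2"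
  shows "\<bar>f x\<bar> \<le> sqrt (\<Sum>\<^sub>\<infinity>k. japanese_sq k powr (- \<sigma>)) * sobolev_norm \<sigma> f"
proof -
  have [simp]: "japanese_sq k \<noteq> 0" for k using japanese_sq_pos[of k] by simp
  have c: "(\<lambda>k. cmod (fourier_coeff f k)) summable_on UNIV"
    using sobolev_weighted_l1(1)[OF s, of 0] \<sigma> by simp
  have "\<bar>f x\<bar> = cmod (complex_of_real (f x))" by simp
  also have "\<dots> \<le> (\<Sum>\<^sub>\<infinity>k. cmod (fourier_coeff f k * cis (2 * pi * of_int k * x)))"
    unfolding fourier_inversion[OF f c] using c
    by (intro norm_infsum_bound) (simp add: norm_mult)
  also have "\<dots> \<le> sqrt (\<Sum>\<^sub>\<infinity>k. japanese_sq k powr (- \<sigma>)) * sobolev_norm \<sigma> f"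
    using sobolev_weighted_l1(2)[OF s, of 0] \<sigma> by (simp add: norm_mult)
  finally show ?thesis .
qed

lemma has_integral_deriv_cis:
  assumes "a \<le> b"
  shows "((\<lambda>x. c * \<i> * cis (c * x)) has_integral (cis (c * b) - cis (c * a))) {a..b}"
proof (rule fundamental_theorem_of_calculus[OF assms])
  fix x
  have "((\<lambda>z. exp (z * (\<i> * of_real c))) has_field_derivative (c * \<i> * exp (of_real x * (\<i> * of_real c)))) (at (of_real x))"
    by (auto intro!: derivative_eq_intros simp: mult_ac)
  from has_vector_derivative_real_field[OF this, of "{a..b}"]
  show "((\<lambda>x. cis (c * x)) has_vector_derivative (c * \<i> * cis (c * x))) (at x within {a..b})"
    by (simp add: cis_conv_exp mult_ac)
qed

text \<open>The formally differentiated series converges uniformly; integrating it termwise recovers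
  the increments of \<open>f\<close>, so the fundamental theorem of calculus identifies it as the
  derivative. The quantitative bound is what later makes \<open>u_x\<close> continuous in
  time.\<close>

lemma sobolev_C1_bound:
  assumes f: "periodic1 f" "continuous_on UNIV f"
    and s: "sobolev_term \<sigma> f summable_on UNIV" and \<sigma>: "\<sigma> > 3 / 2"
  obtains f' where "continuous_on UNIV f'" "\<And>x. (f has_real_derivative f' x) (at x)"
    "\<And>x. \<bar>f' x\<bar> \<le> sqrt (\<Sum>\<^sub>\<infinity>k. japanese_sq k powr (- (\<sigma> - 1))) * sobolev_norm \<sigma> f"
proof -
  have [simp]: "japanese_sq k \<noteq> 0" for k using japanese_sq_pos[of k] by simp
  have c: "(\<lambda>k. cmod (fourier_coeff f k)) summable_on UNIV"
    using sobolev_weighted_l1(1)[OF s, of 0] \<sigma> by simp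
  let ?d = "\<lambda>k. complex_of_real (2 * pi * of_int k) * \<i> * fourier_coeff f k"
  have le: "cmod (?d k) \<le> japanese_sq k powr (1 / 2) * cmod (fourier_coeff f k)" for k
  proof -
    have "\<bar>2 * pi * of_int k\<bar> = sqrt ((2 * pi * of_int k)\<^sup>2)" by simp
    also have "\<dots> \<le> sqrt (japanese_sq k)" unfolding japanese_sq_def by (intro real_sqrt_le_mono) simp
    also have "\<dots> = japanese_sq k powr (1 / 2)" using japanese_sq_pos[of k] by (simp add: powr_half_sqrt)
    finally show ?thesis by (simp add: norm_mult mult_right_mono del: real_sqrt_abs)
  qed
  have d: "(\<lambda>k. cmod (?d k)) summable_on UNIV"
  proof (rule summable_on_comparison_test)
    show "(\<lambda>k. japanese_sq k powr (1 / 2) * cmod (fourier_coeff f k)) summable_on UNIV"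
      using \<sigma> by (intro sobolev_weighted_l1(1)[OF s]) simp
  qed (rule le, rule norm_ge_zero)
  define g where "g = (\<lambda>x. \<Sum>\<^sub>\<infinity>k. ?d k * cis (2 * pi * of_int k * x))"
  have gc: "continuous_on UNIV g" unfolding g_def by (rule continuous_trig_series[OF d])
  have int: "complex_of_real (f b) - complex_of_real (f a) = integral {a..b} g" if "a \<le> b" for a b
  proof -
    have sm: "(\<lambda>k. fourier_coeff f k * cis (2 * pi * of_int k * x)) summable_on UNIV" for x
      by (rule abs_summable_summable) (use c in \<open>simp add: norm_mult\<close>)
    have "((\<lambda>F. \<Sum>k\<in>F. ?d k * integral {a..b} (\<lambda>x. cis (2 * pi * of_int k * x) * 1))
      \<longlongrightarrow> integral {a..b} (\<lambda>x. g x * 1)) (finite_subsets_at_top UNIV)"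
      unfolding g_def by (rule has_integral_trig_series[OF d]) simp
    moreover have "?d k * integral {a..b} (\<lambda>x. cis (2 * pi * of_int k * x) * 1) =
        fourier_coeff f k * cis (2 * pi * of_int k * b) - fourier_coeff f k * cis (2 * pi * of_int k * a)" for k
    proof -
      have "?d k * integral {a..b} (\<lambda>x. cis (2 * pi * of_int k * x) * 1) =
         fourier_coeff f k * integral {a..b} (\<lambda>x. (2 * pi * of_int k) * \<i> * cis (2 * pi * of_int k * x))"
        by simp
      also have "\<dots> = fourier_coeff f k * (cis (2 * pi * of_int k * b) - cis (2 * pi * of_int k * a))"
        by (subst integral_unique[OF has_integral_deriv_cis[OF that]]) simp
      finally show ?thesis by (simp add: algebra_simps)
    qed
    moreover have "((\<lambda>F. \<Sum>k\<in>F. fourier_coeff f k * cis (2 * pi * of_int k * b) - fourier_coeff f k * cis (2 * pi * of_int k * a))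
       \<longlongrightarrow> complex_of_real (f b) - complex_of_real (f a)) (finite_subsets_at_top UNIV)"
      unfolding fourier_inversion[OF f c] sum_subtractf
      by (intro tendsto_diff infsum_tendsto sm)
    ultimately show ?thesis
      by (simp only: mult_1_right) (rule tendsto_unique[OF finite_subsets_at_top_neq_bot], assumption, assumption)
  qed
  have der: "(f has_real_derivative Re (g x)) (at x)" for x
  proof -
    \<comment> \<open>Starting at \<open>x - 1\<close> puts \<open>x\<close> in the interior of the
      interval, so the derivative is two-sided.\<close>
    have "((\<lambda>y. integral {x - 1..y} g) has_vector_derivative g x) (at x within {x - 1..x + 1})"
      by (rule integral_has_vector_derivative[OF continuous_on_subset[OF gc]]) auto
    then have "((\<lambda>y. integral {x - 1..y} g) has_vector_derivative g x) (at x)"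
      by (simp add: at_within_Icc_at)
    then have "((\<lambda>y. Re (integral {x - 1..y} g)) has_vector_derivative Re (g x)) (at x)"
      by (rule bounded_linear.has_vector_derivative[OF bounded_linear_Re])
    then have "((\<lambda>y. f y - f (x - 1)) has_vector_derivative Re (g x)) (at x)"
    proof (rule has_vector_derivative_transform_within_open[of _ _ _ "{x - 1<..}"])
      fix y assume "y \<in> {x - 1<..}"
      then show "Re (integral {x - 1..y} g) = f y - f (x - 1)"
        using arg_cong[OF int[of "x - 1" y], of Re] by simp
    qed auto
    then have "((\<lambda>y. (f y - f (x - 1)) + f (x - 1)) has_vector_derivative Re (g x) + 0) (at x)"
      by (intro has_vector_derivative_add has_vector_derivative_const)
    then show ?thesis by (simp add: has_real_derivative_iff_has_vector_derivative)
  qed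
  have bd: "\<bar>Re (g x)\<bar> \<le> sqrt (\<Sum>\<^sub>\<infinity>k. japanese_sq k powr (- (\<sigma> - 1))) * sobolev_norm \<sigma> f" for x
  proof -
    have "\<bar>Re (g x)\<bar> \<le> cmod (g x)" by (rule abs_Re_le_cmod)
    also have "\<dots> \<le> (\<Sum>\<^sub>\<infinity>k. cmod (?d k * cis (2 * pi * of_int k * x)))"
      unfolding g_def using d by (intro norm_infsum_bound) (simp add: norm_mult)
    also have "\<dots> = (\<Sum>\<^sub>\<infinity>k. cmod (?d k))" by (simp add: norm_mult)
    also have "\<dots> \<le> (\<Sum>\<^sub>\<infinity>k. japanese_sq k powr (1 / 2) * cmod (fourier_coeff f k))"
      using \<sigma> by (intro infsum_mono d le sobolev_weighted_l1(1)[OF s]) simp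
    also have "\<dots> \<le> sqrt (\<Sum>\<^sub>\<infinity>k. japanese_sq k powr (- (\<sigma> - 1))) * sobolev_norm \<sigma> f"
      using sobolev_weighted_l1(2)[OF s, of 1] \<sigma> by simp
    finally show ?thesis .
  qed
  show thesis
    by (rule that[OF continuous_on_Re[OF gc] der bd])
qed

section \<open>The convolution kernels\<close>

text \<open>Without the integer part, \<open>cosh_kernel\<close> and \<open>sinh_kernel\<close> are
  smooth on the whole line; they agree with \<open>p\<close> and \<open>p_x\<close> on
  \<open>(0, 1)\<close>. Periodicity is left to the other factor of the convolution.\<close>

definition cosh_kernel :: "real \<Rightarrow> real" where
  "cosh_kernel z = cosh (z - 1 / 2) / (2 * sinh (1 / 2))"

definition sinh_kernel :: "real \<Rightarrow> real" where
  "sinh_kernel z = sinh (z - 1 / 2) / (2 * sinh (1 / 2))"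

definition rod_weight :: "real \<Rightarrow> real" where
  "rod_weight z = sinh z / (2 * (sinh (1 / 2))\<^sup>2)"

lemma sinh_half_pos: "sinh (1 / 2 :: real) > 0"
  by simp

lemma rod_beta_eq: "rod_beta = cosh (1 / 2) / sinh (1 / 2)"
proof -
  have e: "exp (1::real) = exp (1 / 2) * exp (1 / 2)" by (simp flip: exp_add)
  have g: "exp (1 / 2 :: real) > 1" by simp
  then have "exp (1 / 2) * exp (1 / 2) > (1::real)" by (simp add: less_1_mult)
  with g show ?thesis
    by (simp add: rod_beta_def e cosh_def sinh_def exp_minus field_simps)
qed

lemma rod_weight_eq: "cosh_kernel z + rod_beta * sinh_kernel z = rod_weight z"
proof -
  have "sinh z = cosh (z - 1 / 2) * sinh (1 / 2) + cosh (1 / 2) * sinh (z - 1 / 2)"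
    using sinh_add[of "z - 1 / 2" "1 / 2"] by simp
  then show ?thesis using sinh_half_pos
    by (simp add: cosh_kernel_def sinh_kernel_def rod_weight_def rod_beta_eq field_simps power2_eq_square)
qed

lemma cosh_kernel_reflect: "cosh_kernel (1 - z) = cosh_kernel z"
  and sinh_kernel_reflect: "sinh_kernel (1 - z) = - sinh_kernel z"
proof -
  have "1 - z - 1 / 2 = - (z - 1 / 2)" by simp
  then show "cosh_kernel (1 - z) = cosh_kernel z" "sinh_kernel (1 - z) = - sinh_kernel z"
    by (simp_all only: cosh_kernel_def sinh_kernel_def cosh_minus sinh_minus minus_divide_left)
qed

lemma rod_weight_reflect: "cosh_kernel z - rod_beta * sinh_kernel z = rod_weight (1 - z)"
  by (simp flip: rod_weight_eq add: cosh_kernel_reflect sinh_kernel_reflect)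

lemma continuous_on_kernels [continuous_intros]:
  "continuous_on S cosh_kernel" "continuous_on S sinh_kernel" "continuous_on S rod_weight"
  unfolding cosh_kernel_def sinh_kernel_def rod_weight_def
  by (auto intro!: continuous_intros)

lemma frac_in_Ioo:
  fixes x :: real
  assumes "x \<notin> \<int>" shows "frac x \<in> {0<..<1}"
  using assms by (simp add: frac_lt_1)

lemma rod_kernel_eq:
  assumes "0 < z" "z < 1" shows "rod_kernel z = cosh_kernel z"
proof -
  have "\<lfloor>z\<rfloor> = 0" using assms by (simp add: floor_eq_iff)
  then show ?thesis by (simp add: rod_kernel_def cosh_kernel_def)
qed

lemma deriv_rod_kernel_frac:
  assumes "x \<notin> \<int>"
  shows "deriv rod_kernel x = sinh_kernel (frac x)"
proof (rule DERIV_imp_deriv)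
  let ?n = "real_of_int \<lfloor>x\<rfloor>"
  have x: "?n < x" "x < ?n + 1" using frac_in_Ioo[OF assms] by (auto simp: frac_def)
  have "((\<lambda>y. cosh_kernel (y - ?n)) has_real_derivative sinh_kernel (frac x)) (at x)"
    unfolding cosh_kernel_def sinh_kernel_def frac_def
    by (auto intro!: derivative_eq_intros)
  then show "(rod_kernel has_real_derivative sinh_kernel (frac x)) (at x)"
  proof (rule has_field_derivative_transform_within_open[of _ _ _ "{?n<..<?n + 1}"])
    fix y assume y: "y \<in> {?n<..<?n + 1}"
    then have "\<lfloor>y\<rfloor> = \<lfloor>x\<rfloor>" by (intro floor_unique) auto
    then show "cosh_kernel (y - ?n) = rod_kernel y" by (simp add: rod_kernel_def cosh_kernel_def)
  qed (use x in auto)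
qed

lemma deriv_rod_kernel_eq:
  assumes "0 < z" "z < 1" shows "deriv rod_kernel z = sinh_kernel z"
proof -
  have "frac z = z" using assms by (simp add: frac_eq)
  moreover have "z \<notin> \<int>" using assms \<open>frac z = z\<close> by (metis frac_eq_0_iff less_irrefl)
  ultimately show ?thesis using deriv_rod_kernel_frac by simp
qed

lemma integral_reflect_at:
  fixes f :: "real \<Rightarrow> real"
  shows "integral {a..b} (\<lambda>z. f (c - z)) = integral {c - b..c - a} f"
  using Henstock_Kurzweil_Integration.integral_reflect_real[of b a "\<lambda>z. f (c - z)"] integral_shift_real_ivl[of "c - b" c "c - a" f]
  by (simp add: add.commute)

text \<open>The kernel runs over a fixed interval and the function is shifted, so that a smooth
  nonperiodic kernel can stand for a periodic one that has a jump at the integers.\<close>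

definition conv01 :: "(real \<Rightarrow> real) \<Rightarrow> (real \<Rightarrow> real) \<Rightarrow> real \<Rightarrow> real" where
  "conv01 K F x = integral {0..1} (\<lambda>z. K z * F (x - z))"

lemma conv01_shift: "conv01 K F x = integral {x - 1..x} (\<lambda>y. K (x - y) * F y)"
  using integral_reflect_at[of 0 1 "\<lambda>y. K (x - y) * F y" x] by (simp add: conv01_def)

lemma conv01_periodic:
  assumes "periodic1 F"
  shows "conv01 K F (x + of_int n) = conv01 K F x"
  using periodic1_of_int[OF assms, of "x - _" n] by (simp add: conv01_def algebra_simps)

text \<open>Cut at \<open>frac x\<close>, where \<open>x - y\<close> crosses an integer: to the
  right of it the kernel argument gains 1, and moving this part back by a period joins both parts
  into one integral of length 1. The integers, where \<open>deriv rod_kernel\<close> is arbitrary,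
  contribute a null set.\<close>

lemma circle_conv_eq_conv01:
  assumes k: "\<And>x. x \<notin> \<int> \<Longrightarrow> k x = K (frac x)" and K: "continuous_on UNIV K"
    and F: "continuous_on UNIV F" "periodic1 F"
  shows "circle_conv k F x = conv01 K F x"
proof -
  let ?r = "frac x" and ?f = "\<lambda>y. k (x - y) * F y"
  have r: "0 \<le> ?r" "?r < 1" by (simp_all add: frac_lt_1)
  have Kc: "continuous_on S (\<lambda>y. K (g y))" if "continuous_on S g" for S g
    using continuous_on_compose2[OF K that] by simp
  have frac: "k (x - y) = K a" if "0 < a" "a < 1" "x - y - a \<in> \<int>" for y a
  proof -
    have "frac (x - y) = a" using that by (simp add: frac_unique_iff)
    moreover have "x - y \<notin> \<int>" using that \<open>frac (x - y) = a\<close> by (metis frac_eq_0_iff less_irrefl)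
    ultimately show ?thesis using k by simp
  qed
  have xr: "x - ?r \<in> \<int>" by (simp add: frac_def)
  have e1: "?f y = K (?r - y) * F y" if "y \<in> {0..?r} - {0, ?r}" for y
  proof -
    have "x - y - (?r - y) \<in> \<int>" using xr by simp
    then show ?thesis using that r frac[of "?r - y" y] by auto
  qed
  have e2: "?f y = K (?r - y + 1) * F y" if "y \<in> {?r..1} - {?r, 1}" for y
  proof -
    have "x - y - (?r - y + 1) = x - ?r - 1" by simp
    also have "\<dots> \<in> \<int>" by (intro Ints_diff xr Ints_1)
    finally have "k (x - y) = K (?r - y + 1)" using that r(1) by (intro frac; simp; linarith)
    then show ?thesis by simp
  qed
  have c1: "continuous_on {0..?r} (\<lambda>y. K (?r - y) * F y)"
    and c2: "continuous_on {?r..1} (\<lambda>y. K (?r - y + 1) * F y)"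
    by (intro continuous_intros Kc continuous_on_subset[OF F(1)]; simp)+
  have "?f absolutely_integrable_on {0..?r}"
    by (rule absolutely_integrable_spike[where S = "{0, ?r}", OF absolutely_integrable_continuous_real[OF c1] _ e1]) simp_all
  moreover have "?f absolutely_integrable_on {?r..1}"
    by (rule absolutely_integrable_spike[where S = "{?r, 1}", OF absolutely_integrable_continuous_real[OF c2] _ e2]) simp_all
  ultimately have ai: "?f absolutely_integrable_on {0..1}"
    using r by (intro absolutely_integrable_on_combine[where a = 0 and c = ?r and b = 1]) auto
  have i1: "integral {0..?r} ?f = integral {0..?r} (\<lambda>y. K (?r - y) * F y)"
    by (rule integral_spike[where S = "{0, ?r}", OF _ e1[symmetric]]) simp_all
  have i2: "integral {?r..1} ?f = integral {?r - 1..0} (\<lambda>y. K (?r - y) * F y)"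
  proof -
    have "integral {?r..1} ?f = integral {?r..1} (\<lambda>y. K (?r - y + 1) * F y)"
      by (rule integral_spike[where S = "{?r, 1}", OF _ e2[symmetric]]) simp_all
    also have "\<dots> = integral {?r - 1..1 - 1} (\<lambda>y. K (?r - (y + 1) + 1) * F (y + 1))"
      by (rule integral_shift_real_ivl[symmetric])
    finally show ?thesis using F(2) by (simp add: periodic1_def)
  qed
  have "circle_conv k F x = integral {0..1} ?f"
    unfolding circle_conv_def by (rule set_lebesgue_integral_eq_integral[OF ai])
  also have "\<dots> = integral {0..?r} ?f + integral {?r..1} ?f"
    using r set_lebesgue_integral_eq_integral(1)[OF ai] by (intro Henstock_Kurzweil_Integration.integral_combine[symmetric]) auto
  also have "\<dots> = integral {?r - 1..0} (\<lambda>y. K (?r - y) * F y) + integral {0..?r} (\<lambda>y. K (?r - y) * F y)"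
    using i1 i2 by simp
  also have "\<dots> = integral {?r - 1..?r} (\<lambda>y. K (?r - y) * F y)"
    using r by (intro Henstock_Kurzweil_Integration.integral_combine integrable_continuous_interval continuous_intros Kc continuous_on_subset[OF F(1)]) auto
  also have "\<dots> = conv01 K F ?r" by (rule conv01_shift[symmetric])
  also have "\<dots> = conv01 K F x"
    using conv01_periodic[OF F(2), where K = K and x = ?r and n = "\<lfloor>x\<rfloor>"] by (simp add: frac_def)
  finally show ?thesis .
qed

lemma circle_conv_deriv_rod_kernel:
  assumes "continuous_on UNIV F" "periodic1 F"
  shows "circle_conv (deriv rod_kernel) F x = conv01 sinh_kernel F x"
  by (rule circle_conv_eq_conv01) (use assms deriv_rod_kernel_frac in \<open>auto intro: continuous_intros\<close>)

text \<open>\<open>F\<close> is only continuous, so the derivative must fall on the kernel. For an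
  exponential kernel \<open>x\<close> leaves the integrand: what remains is
  \<open>exp (c * x)\<close> times an integral over a moving period, whose two boundary terms merge
  by periodicity.\<close>

lemma conv01_exp_deriv:
  assumes F: "continuous_on UNIV F" "periodic1 F"
  shows "(conv01 (\<lambda>z. exp (c * z)) F has_real_derivative
    c * conv01 (\<lambda>z. exp (c * z)) F x + (1 - exp c) * F x) (at x)"
proof -
  \<comment> \<open>The base point lies far enough to the left that \<open>y\<close> and
    \<open>y - 1\<close> stay inside the interval of integration for \<open>y\<close> near
    \<open>x\<close>.\<close>
  let ?h = "\<lambda>y. exp (- (c * y)) * F y" and ?a = "x - 3"
  define H where "H = (\<lambda>y. integral {?a..y} ?h)"
  have hc: "continuous_on S ?h" for S
    by (intro continuous_intros continuous_on_subset[OF F(1)]) auto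
  have H: "(H has_real_derivative ?h y) (at y)" if "y \<in> {x - 2..x}" for y
  proof -
    have "(H has_real_derivative ?h y) (at y within {?a..x + 1})"
      unfolding H_def using that by (intro integral_has_real_derivative hc) auto
    then show ?thesis using that by (simp add: at_within_Icc_at)
  qed
  have H2: "((\<lambda>y. H (y - 1)) has_real_derivative ?h (x - 1)) (at x)"
    using H[of "x - 1"] DERIV_shift[of H "?h (x - 1)" x "- 1"] by simp
  have "((\<lambda>y. exp (c * y) * (H y - H (y - 1))) has_real_derivative
      c * exp (c * x) * (H x - H (x - 1)) + exp (c * x) * (?h x - ?h (x - 1))) (at x)"
    using H[of x] H2 by (auto intro!: derivative_eq_intros simp: algebra_simps)
  moreover have E: "exp (c * y) * (H y - H (y - 1)) = conv01 (\<lambda>z. exp (c * z)) F y" if "y > x - 1" for y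
  proof -
    have "H (y - 1) + integral {y - 1..y} ?h = H y"
      unfolding H_def using that by (intro Henstock_Kurzweil_Integration.integral_combine integrable_continuous_interval hc) auto
    moreover have "conv01 (\<lambda>z. exp (c * z)) F y = exp (c * y) * integral {y - 1..y} ?h"
      unfolding conv01_shift by (simp add: right_diff_distrib exp_diff exp_minus field_simps flip: integral_mult_right)
    ultimately show ?thesis by simp
  qed
  moreover have "exp (c * x) * (?h x - ?h (x - 1)) = (1 - exp c) * F x"
  proof -
    have "F (x - 1) = F x" using F(2) by (metis periodic1_def diff_add_cancel)
    then show ?thesis by (simp add: algebra_simps flip: exp_add)
  qed
  moreover have "c * exp (c * x) * (H x - H (x - 1)) = c * conv01 (\<lambda>z. exp (c * z)) F x"
    using E[of x] by simp
  ultimately have "((\<lambda>y. exp (c * y) * (H y - H (y - 1))) has_real_derivative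
     c * conv01 (\<lambda>z. exp (c * z)) F x + (1 - exp c) * F x) (at x)" by simp
  then show ?thesis
    by (rule has_field_derivative_transform_within_open[of _ _ _ "{x - 1<..}"]) (use E in auto)
qed

lemma conv01_add:
  assumes "continuous_on UNIV K" "continuous_on UNIV L" "continuous_on UNIV F"
  shows "conv01 (\<lambda>z. a * K z + b * L z) F x = a * conv01 K F x + b * conv01 L F x"
proof -
  have Fc: "continuous_on {0..1} (\<lambda>z. F (x - z))"
    by (rule continuous_on_compose2[OF assms(3)]) (auto intro!: continuous_intros)
  have "conv01 (\<lambda>z. a * K z + b * L z) F x = integral {0..1} (\<lambda>z. a * (K z * F (x - z)) + b * (L z * F (x - z)))"
    by (simp add: conv01_def algebra_simps)
  also have "\<dots> = a * conv01 K F x + b * conv01 L F x"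
    unfolding conv01_def
    by (subst integral_add)
      (auto intro!: integrable_continuous_interval continuous_intros Fc continuous_on_subset[OF assms(1)] continuous_on_subset[OF assms(2)])
  finally show ?thesis .
qed

lemma kernel_exp_eq:
  "cosh_kernel z = (exp (- 1 / 2) / (4 * sinh (1 / 2))) * exp (1 * z) + (exp (1 / 2) / (4 * sinh (1 / 2))) * exp (- 1 * z)"
  "sinh_kernel z = (exp (- 1 / 2) / (4 * sinh (1 / 2))) * exp (1 * z) + (- exp (1 / 2) / (4 * sinh (1 / 2))) * exp (- 1 * z)"
proof -
  have e: "exp (- 1 / 2) * exp (1 * z) = exp (z - 1 / 2)" "exp (1 / 2) * exp (- 1 * z) = exp (- (z - 1 / 2))"
    by (simp_all flip: exp_add)
  show "cosh_kernel z = (exp (- 1 / 2) / (4 * sinh (1 / 2))) * exp (1 * z) + (exp (1 / 2) / (4 * sinh (1 / 2))) * exp (- 1 * z)"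
   "sinh_kernel z = (exp (- 1 / 2) / (4 * sinh (1 / 2))) * exp (1 * z) + (- exp (1 / 2) / (4 * sinh (1 / 2))) * exp (- 1 * z)"
    unfolding times_divide_eq_left mult_minus_left e cosh_kernel_def sinh_kernel_def
      cosh_def[of "z - 1 / 2"] sinh_def[of "z - 1 / 2"]
    by (simp_all add: add_divide_distrib diff_divide_distrib mult_exp_exp)
qed

text \<open>After the splitting into exponentials, a kernel \<open>K\<close> contributes the
  convolution with its derivative plus \<open>(K 0 - K 1) * F x\<close>. The result says that
  \<open>p\<close> is the Green function of \<open>1 - d^2/dx^2\<close>.\<close>

lemma conv01_kernel_deriv:
  assumes F: "continuous_on UNIV F" "periodic1 F"
  shows "(conv01 sinh_kernel F has_real_derivative conv01 cosh_kernel F x - F x) (at x)"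
    and "(conv01 cosh_kernel F has_real_derivative conv01 sinh_kernel F x) (at x)"
proof -
  let ?a = "exp (- 1 / 2) / (4 * sinh (1 / 2 :: real))" and ?b = "exp (1 / 2) / (4 * sinh (1 / 2 :: real))"
  let ?P = "conv01 (\<lambda>z. exp (1 * z)) F" and ?M = "conv01 (\<lambda>z. exp (- 1 * z)) F"
  have C: "conv01 cosh_kernel F = (\<lambda>x. ?a * ?P x + ?b * ?M x)"
    and S: "conv01 sinh_kernel F = (\<lambda>x. ?a * ?P x + (- ?b) * ?M x)"
    unfolding kernel_exp_eq[abs_def] minus_divide_left[symmetric]
    by (intro ext conv01_add F continuous_intros)+
  have dP: "(?P has_real_derivative 1 * ?P x + (1 - exp 1) * F x) (at x)"
    and dM: "(?M has_real_derivative - 1 * ?M x + (1 - exp (- 1)) * F x) (at x)"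
    by (rule conv01_exp_deriv[OF F])+
  have h: "exp (1::real) = exp (1 / 2) * exp (1 / 2)" "exp (- 1 / 2 :: real) = 1 / exp (1 / 2)"
     "exp (- 1 :: real) = 1 / (exp (1 / 2) * exp (1 / 2))"
    by (simp_all add: exp_minus inverse_eq_divide flip: exp_add)
  define d where "d = exp (1 / 2) - 1 / exp (1 / 2 :: real)"
  have s: "4 * sinh (1 / 2 :: real) = 2 * d"
    by (simp add: d_def sinh_def exp_minus inverse_eq_divide)
  have d: "d > 0" using sinh_half_pos s by linarith
  have A: "?a * (1 - exp 1) = - 1 / 2"
  proof -
    have "1 / exp (1 / 2) * (1 - exp (1 / 2) * exp (1 / 2)) = - d"
      by (simp add: d_def right_diff_distrib)
    then show ?thesis unfolding s h times_divide_eq_left[of "1 / _"] using d by simp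
  qed
  have B: "?b * (1 - exp (- 1)) = 1 / 2"
  proof -
    have "exp (1 / 2) * (1 - 1 / (exp (1 / 2) * exp (1 / 2))) = d"
      by (simp add: d_def right_diff_distrib)
    then show ?thesis unfolding s h times_divide_eq_left using d by simp
  qed
  \<comment> \<open>The values of \<open>K 0 - K 1\<close> for \<open>sinh_kernel\<close>, the jump
    of \<open>p_x\<close>, and for \<open>cosh_kernel\<close>, where \<open>p\<close> is
    continuous.\<close>
  have 1: "?a * (1 - exp 1) - ?b * (1 - exp (- 1)) = - 1"
    and 2: "?a * (1 - exp 1) + ?b * (1 - exp (- 1)) = 0" unfolding A B by simp_all
  have "(conv01 sinh_kernel F has_real_derivative
     ?a * (1 * ?P x + (1 - exp 1) * F x) + (- ?b) * (- 1 * ?M x + (1 - exp (- 1)) * F x)) (at x)"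
    unfolding S by (intro DERIV_add DERIV_cmult dP dM)
  moreover have "?a * (1 * ?P x + (1 - exp 1) * F x) + (- ?b) * (- 1 * ?M x + (1 - exp (- 1)) * F x)
     = (?a * ?P x + ?b * ?M x) + (?a * (1 - exp 1) - ?b * (1 - exp (- 1))) * F x"
    by algebra
  ultimately show "(conv01 sinh_kernel F has_real_derivative conv01 cosh_kernel F x - F x) (at x)"
    by (simp only: 1 C) simp
  have "(conv01 cosh_kernel F has_real_derivative
     ?a * (1 * ?P x + (1 - exp 1) * F x) + ?b * (- 1 * ?M x + (1 - exp (- 1)) * F x)) (at x)"
    unfolding C by (intro DERIV_add DERIV_cmult dP dM)
  moreover have "?a * (1 * ?P x + (1 - exp 1) * F x) + ?b * (- 1 * ?M x + (1 - exp (- 1)) * F x)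
     = (?a * ?P x + (- ?b) * ?M x) + (?a * (1 - exp 1) + ?b * (1 - exp (- 1))) * F x"
    by algebra
  ultimately show "(conv01 cosh_kernel F has_real_derivative conv01 sinh_kernel F x) (at x)"
    by (simp only: 2 S) simp
qed

section \<open>The variational constants\<close>

lemma rod_weight_nonneg: "0 \<le> x \<Longrightarrow> 0 \<le> rod_weight x"
  by (simp add: rod_weight_def)

lemma rod_weight_pos: "0 < x \<Longrightarrow> 0 < rod_weight x"
  by (simp add: rod_weight_def)

lemma rod_weight_mono: "x \<le> y \<Longrightarrow> rod_weight x \<le> rod_weight y"
  by (simp add: rod_weight_def divide_right_mono)

text \<open>By the double-angle formula, \<open>cosh 1 - 1 = 2 * (sinh (1 / 2))^2\<close>. The
  normalisation gives the constant function 1 the weighted norm 1, the borderline value in the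
  bounds for \<alpha>.\<close>

lemma integral_rod_weight: "integral {0..1} rod_weight = 1"
proof -
  let ?s = "2 * (sinh (1 / 2))\<^sup>2 :: real"
  have "(rod_weight has_integral (cosh 1 / ?s - cosh 0 / ?s)) {0..1}"
    unfolding rod_weight_def[abs_def]
    by (rule fundamental_theorem_of_calculus, simp,
        unfold has_real_derivative_iff_has_vector_derivative[symmetric], rule DERIV_cdivide)
       (auto intro!: derivative_eq_intros)
  moreover have "cosh 1 = ?s + (1::real)"
    using cosh_double[of "1 / 2 :: real"] by (simp add: cosh_square_eq)
  ultimately show ?thesis by (simp add: integral_unique add_divide_distrib)
qed

section \<open>Weak derivatives and the weighted energy\<close>

lemma set_lebesgue_integral_Ioo:
  fixes f :: "real \<Rightarrow> real"
  assumes "continuous_on {a..b} f"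
  shows "set_integrable lebesgue {a<..<b} f" "(LINT x:{a<..<b}|lebesgue. f x) = integral {a..b} f"
proof -
  show 1: "set_integrable lebesgue {a<..<b} f"
    by (rule set_integrable_subset[OF absolutely_integrable_continuous_real[OF assms]]) auto
  show "(LINT x:{a<..<b}|lebesgue. f x) = integral {a..b} f"
    by (simp add: set_lebesgue_integral_eq_integral(2)[OF 1] integral_open_interval_real)
qed

lemma C1_imp_H1_with_deriv:
  assumes u: "\<And>x. x \<in> {0..1} \<Longrightarrow> (u has_real_derivative g x) (at x within {0..1})"
    and g: "continuous_on {0..1} g"
  shows "H1_with_deriv u g"
proof -
  have uc: "continuous_on {0..1} u"
    using u by (rule DERIV_continuous_on)
  have "set_borel_measurable lebesgue {0<..<1} g"
    using set_lebesgue_integral_Ioo(1)[OF g]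
    unfolding set_integrable_def set_borel_measurable_def by (rule borel_measurable_integrable)
  moreover have "set_integrable lebesgue {0<..<1} (\<lambda>x. (g x)\<^sup>2)"
    by (intro set_lebesgue_integral_Ioo continuous_intros g)
  moreover have "(LINT x:{0<..<1}|lebesgue. u x * deriv \<phi> x) = - (LINT x:{0<..<1}|lebesgue. g x * \<phi> x)"
    if \<phi>: "test_function_01 \<phi>" for \<phi>
  proof -
    have d\<phi>: "(\<phi> has_real_derivative deriv \<phi> x) (at x within S)" for x S
      using \<phi> DERIV_deriv_iff_real_differentiable has_field_derivative_at_within
      unfolding test_function_01_def by blast
    have \<phi>c: "continuous_on S \<phi>" for S by (rule DERIV_continuous_on[OF d\<phi>])
    have \<phi>'c: "continuous_on S (deriv \<phi>)" for S
      using \<phi> continuous_on_subset unfolding test_function_01_def by blast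
    have 0: "\<phi> 0 = 0" "\<phi> 1 = 0" using \<phi> unfolding test_function_01_def by force+
    have "((\<lambda>x. g x * \<phi> x + u x * deriv \<phi> x) has_integral (u 1 * \<phi> 1 - u 0 * \<phi> 0)) {0..1}"
    proof (rule fundamental_theorem_of_calculus)
      fix x :: real assume "x \<in> {0..1}"
      from DERIV_mult[OF u[OF this] d\<phi>]
      show "((\<lambda>x. u x * \<phi> x) has_vector_derivative g x * \<phi> x + u x * deriv \<phi> x) (at x within {0..1})"
        by (simp add: has_real_derivative_iff_has_vector_derivative algebra_simps)
    qed simp
    then have "integral {0..1} (\<lambda>x. g x * \<phi> x + u x * deriv \<phi> x) = 0" by (simp add: 0 integral_unique)
    moreover have "integral {0..1} (\<lambda>x. g x * \<phi> x + u x * deriv \<phi> x) =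
      integral {0..1} (\<lambda>x. g x * \<phi> x) + integral {0..1} (\<lambda>x. u x * deriv \<phi> x)"
      by (intro integral_add integrable_continuous_interval continuous_intros g uc \<phi>c \<phi>'c)
    ultimately show ?thesis
      by (subst (1 2) set_lebesgue_integral_Ioo(2)) (auto intro!: continuous_intros g uc \<phi>c \<phi>'c)
  qed
  ultimately show ?thesis using uc unfolding H1_with_deriv_def by blast
qed

definition wnorm2 :: "(real \<Rightarrow> real) \<Rightarrow> real" where
  "wnorm2 f = (LINT x:{0<..<1}|lebesgue. rod_weight x * (f x)\<^sup>2)"

lemma H1_with_deriv_integrable:
  assumes "H1_with_deriv u g"
  shows "set_integrable lebesgue {0<..<1} (\<lambda>x. rod_weight x * (u x)\<^sup>2)"
    and "set_integrable lebesgue {0<..<1} (\<lambda>x. rod_weight x * (g x)\<^sup>2)"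
proof -
  show "set_integrable lebesgue {0<..<1} (\<lambda>x. rod_weight x * (u x)\<^sup>2)"
    using assms unfolding H1_with_deriv_def
    by (intro set_lebesgue_integral_Ioo continuous_intros) auto
  have "bounded (rod_weight ` {0..1})"
    by (intro compact_imp_bounded compact_continuous_image continuous_intros compact_Icc)
  then have "bounded (rod_weight ` {0<..<1})"
    by (rule bounded_subset) (auto intro!: image_mono)
  then show "set_integrable lebesgue {0<..<1} (\<lambda>x. rod_weight x * (g x)\<^sup>2)"
    using assms unfolding H1_with_deriv_def
    by (intro absolutely_integrable_bounded_measurable_product_real continuous_imp_measurable_on_sets_lebesgue continuous_intros) auto
qed

lemma rod_energy_eq:
  assumes "H1_with_deriv u g"
  shows "(LINT x:{0<..<1}|lebesgue. (rod_kernel x + rod_beta * deriv rod_kernel x) * (\<alpha> * (u x)\<^sup>2 + (g x)\<^sup>2))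
    = \<alpha> * wnorm2 u + wnorm2 g"
proof -
  have "(LINT x:{0<..<1}|lebesgue. (rod_kernel x + rod_beta * deriv rod_kernel x) * (\<alpha> * (u x)\<^sup>2 + (g x)\<^sup>2))
    = (LINT x:{0<..<1}|lebesgue. \<alpha> * (rod_weight x * (u x)\<^sup>2) + rod_weight x * (g x)\<^sup>2)"
    by (rule set_lebesgue_integral_cong)
       (auto simp: rod_kernel_eq deriv_rod_kernel_eq rod_weight_eq algebra_simps)
  also have "\<dots> = \<alpha> * wnorm2 u + wnorm2 g"
    unfolding wnorm2_def using H1_with_deriv_integrable[OF assms]
    by (subst set_integral_add) auto
  finally show ?thesis .
qed

definition admissible :: "(real \<Rightarrow> real) \<Rightarrow> (real \<Rightarrow> real) \<Rightarrow> bool" where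
  "admissible u g \<longleftrightarrow> H1_with_deriv u g \<and> u 0 = 1 \<and> u 1 = 1"

text \<open>The defining inequality of \<open>alpha1\<close> with the infimum unfolded into a bound
  for every competitor, which keeps extended reals out of the later arithmetic.\<close>

definition rod_coercive :: "real \<Rightarrow> bool" where
  "rod_coercive \<alpha> \<longleftrightarrow> (\<forall>u g. admissible u g \<longrightarrow> \<alpha> - rod_beta\<^sup>2 \<le> \<alpha> * wnorm2 u + wnorm2 g)"

lemma rod_coercive_iff:
  "ereal (rod_beta\<^sup>2) + rod_I \<alpha> rod_beta - ereal \<alpha> \<ge> 0 \<longleftrightarrow> rod_coercive \<alpha>"
proof -
  have "ereal (rod_beta\<^sup>2) + rod_I \<alpha> rod_beta - ereal \<alpha> \<ge> 0 \<longleftrightarrow> ereal (\<alpha> - rod_beta\<^sup>2) \<le> rod_I \<alpha> rod_beta"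
    by (cases "rod_I \<alpha> rod_beta") auto
  also have "\<dots> \<longleftrightarrow> rod_coercive \<alpha>"
    unfolding rod_I_def le_INF_iff rod_coercive_def admissible_def
    by (auto simp: rod_energy_eq)
  finally show ?thesis .
qed

lemma wnorm2_nonneg: "0 \<le> wnorm2 f"
  unfolding wnorm2_def set_lebesgue_integral_def
  by (rule Bochner_Integration.integral_nonneg)
     (auto simp: indicator_def rod_weight_nonneg)

lemma wnorm2_continuous:
  assumes "continuous_on {0..1} f"
  shows "wnorm2 f = integral {0..1} (\<lambda>x. rod_weight x * (f x)\<^sup>2)"
  unfolding wnorm2_def by (intro set_lebesgue_integral_Ioo continuous_intros assms)

text \<open>By homogeneity, dividing by \<open>c\<close> makes the boundary values 1. For
  \<open>c = 0\<close> the inequality is the limit of the one for \<open>U + e\<close>, with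
  boundary value \<open>e\<close>, as \<open>e\<close> decreases to 0; this case arises at the zeros
  of a solution.\<close>

lemma rod_coercive_C1:
  assumes \<alpha>: "rod_coercive \<alpha>"
    and U: "\<And>x. x \<in> {0..1} \<Longrightarrow> (U has_real_derivative V x) (at x within {0..1})"
    and V: "continuous_on {0..1} V" and c: "U 0 = c" "U 1 = c"
  shows "(\<alpha> - rod_beta\<^sup>2) * c\<^sup>2 \<le> integral {0..1} (\<lambda>x. rod_weight x * (\<alpha> * (U x)\<^sup>2 + (V x)\<^sup>2))"
proof -
  have main: "(\<alpha> - rod_beta\<^sup>2) * c\<^sup>2 \<le> integral {0..1} (\<lambda>x. rod_weight x * (\<alpha> * (U x)\<^sup>2 + (V x)\<^sup>2))"
    if U: "\<And>x. x \<in> {0..1} \<Longrightarrow> (U has_real_derivative V x) (at x within {0..1})"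
      and c: "U 0 = c" "U 1 = c" "c \<noteq> 0" for U c
  proof -
    have Uc: "continuous_on {0..1} U" using U by (rule DERIV_continuous_on)
    have "admissible (\<lambda>x. U x / c) (\<lambda>x. V x / c)"
      unfolding admissible_def using c
      by (auto intro!: C1_imp_H1_with_deriv DERIV_cdivide U continuous_intros V)
    then have "\<alpha> - rod_beta\<^sup>2 \<le> \<alpha> * wnorm2 (\<lambda>x. U x / c) + wnorm2 (\<lambda>x. V x / c)"
      using \<alpha> unfolding rod_coercive_def by blast
    also have "wnorm2 (\<lambda>x. U x / c) = integral {0..1} (\<lambda>x. rod_weight x * (U x)\<^sup>2) / c\<^sup>2"
      using c by (subst wnorm2_continuous) (auto intro!: continuous_intros Uc simp: power_divide)
    also have "wnorm2 (\<lambda>x. V x / c) = integral {0..1} (\<lambda>x. rod_weight x * (V x)\<^sup>2) / c\<^sup>2"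
      using c by (subst wnorm2_continuous) (auto intro!: continuous_intros V simp: power_divide)
    finally have "(\<alpha> - rod_beta\<^sup>2) * c\<^sup>2 \<le> \<alpha> * integral {0..1} (\<lambda>x. rod_weight x * (U x)\<^sup>2) + integral {0..1} (\<lambda>x. rod_weight x * (V x)\<^sup>2)"
      using c(3) by (simp add: field_simps)
    also have "\<dots> = integral {0..1} (\<lambda>x. \<alpha> * (rod_weight x * (U x)\<^sup>2) + rod_weight x * (V x)\<^sup>2)"
      by (subst integral_add) (auto intro!: integrable_continuous_interval continuous_intros Uc V)
    also have "\<dots> = integral {0..1} (\<lambda>x. rod_weight x * (\<alpha> * (U x)\<^sup>2 + (V x)\<^sup>2))"
      by (simp add: algebra_simps)
    finally show ?thesis .
  qed
  show ?thesis
  proof (cases "c = 0")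
    case True
    have Uc: "continuous_on {0..1} U" using U by (rule DERIV_continuous_on)
    let ?X = "integral {0..1} (\<lambda>x. rod_weight x * (\<alpha> * (U x)\<^sup>2 + (V x)\<^sup>2))"
    let ?Y = "integral {0..1} (\<lambda>x. rod_weight x * U x)"
    have "(\<alpha> - rod_beta\<^sup>2) * e\<^sup>2 \<le> ?X + (2 * \<alpha> * e) * ?Y + \<alpha> * e\<^sup>2" if e: "e > 0" for e
    proof -
      have "(\<alpha> - rod_beta\<^sup>2) * e\<^sup>2 \<le> integral {0..1} (\<lambda>x. rod_weight x * (\<alpha> * (U x + e)\<^sup>2 + (V x)\<^sup>2))"
        using e c True by (intro main) (auto intro!: derivative_eq_intros U)
      also have "\<dots> = integral {0..1} (\<lambda>x. rod_weight x * (\<alpha> * (U x)\<^sup>2 + (V x)\<^sup>2) + ((2 * \<alpha> * e) * (rod_weight x * U x) + \<alpha> * e\<^sup>2 * rod_weight x))"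
        by (intro arg_cong[where f = "integral {0..1}"] ext) (simp add: algebra_simps power2_eq_square)
      also have "\<dots> = ?X + integral {0..1} (\<lambda>x. (2 * \<alpha> * e) * (rod_weight x * U x) + \<alpha> * e\<^sup>2 * rod_weight x)"
        by (intro integral_add integrable_continuous_interval continuous_intros Uc V)
      also have "integral {0..1} (\<lambda>x. (2 * \<alpha> * e) * (rod_weight x * U x) + \<alpha> * e\<^sup>2 * rod_weight x)
          = integral {0..1} (\<lambda>x. (2 * \<alpha> * e) * (rod_weight x * U x)) + integral {0..1} (\<lambda>x. \<alpha> * e\<^sup>2 * rod_weight x)"
        by (intro integral_add integrable_continuous_interval continuous_intros Uc)
      also have "\<dots> = (2 * \<alpha> * e) * ?Y + \<alpha> * e\<^sup>2"
        by (simp only: integral_mult_right integral_rod_weight mult_1_right)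
      finally show ?thesis by (simp add: add.assoc)
    qed
    then have "\<forall>\<^sub>F e in at_right 0. 0 \<le> ?X + (2 * \<alpha> * e) * ?Y + \<alpha> * e\<^sup>2 - (\<alpha> - rod_beta\<^sup>2) * e\<^sup>2"
      by (auto simp: eventually_at_right_less elim!: eventually_mono intro!: eventually_mono[OF eventually_at_right_less])
    moreover have "((\<lambda>e. ?X + (2 * \<alpha> * e) * ?Y + \<alpha> * e\<^sup>2 - (\<alpha> - rod_beta\<^sup>2) * e\<^sup>2) \<longlongrightarrow>
        ?X + (2 * \<alpha> * 0) * ?Y + \<alpha> * 0\<^sup>2 - (\<alpha> - rod_beta\<^sup>2) * 0\<^sup>2) (at_right 0)"
      by (intro tendsto_intros)
    ultimately have "0 \<le> ?X + (2 * \<alpha> * 0) * ?Y + \<alpha> * 0\<^sup>2 - (\<alpha> - rod_beta\<^sup>2) * 0\<^sup>2"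
      by (intro tendsto_lowerbound[where F = "at_right (0::real)"]) auto
    then show ?thesis using True by simp
  qed (use main U c in blast)
qed

section \<open>A \<open>C^1\<close> cut-off function and the weak derivative\<close>

text \<open>The tent on \<open>[0, 1]\<close> with height 2 and integral 1; \<open>step\<close> is
  its primitive. Piecewise quadratics suffice because \<open>test_function_01\<close> asks for
  \<open>C^1\<close>.\<close>

definition hat :: "real \<Rightarrow> real" where
  "hat s = 4 * (max 0 s - 2 * max 0 (s - 1 / 2) + max 0 (s - 1))"

definition step :: "real \<Rightarrow> real" where
  "step s = 2 * ((max 0 s)\<^sup>2 - 2 * (max 0 (s - 1 / 2))\<^sup>2 + (max 0 (s - 1))\<^sup>2)"

text \<open>Squaring removes the corner of the positive part. Besides \<open>step\<close>, this
  serves to differentiate the squared positive and negative parts of \<open>u\<close>.\<close>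

lemma max_0_sq_deriv: "((\<lambda>s. (max 0 s)\<^sup>2) has_real_derivative 2 * max 0 s) (at (s::real))"
proof -
  consider "s > 0" | "s < 0" | "s = 0" by linarith
  then show ?thesis
  proof cases
    case 1
    have "((\<lambda>s. s\<^sup>2) has_real_derivative 2 * max 0 s) (at s)"
      using 1 by (auto intro!: derivative_eq_intros)
    then show ?thesis
      by (rule has_field_derivative_transform_within_open[of _ _ _ "{0<..}"]) (use 1 in auto)
  next
    case 2
    have "((\<lambda>s. 0) has_real_derivative 2 * max 0 s) (at s)" using 2 by simp
    then show ?thesis
      by (rule has_field_derivative_transform_within_open[of _ _ _ "{..<0}"]) (use 2 in auto)
  next
    case 3
    have "((\<lambda>h. (max 0 h)\<^sup>2 / h) \<longlongrightarrow> 0) (at (0::real))"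
    proof (rule Lim_null_comparison[where g = "\<lambda>h. \<bar>h\<bar>"])
      show "\<forall>\<^sub>F h in at (0::real). norm ((max 0 h)\<^sup>2 / h) \<le> \<bar>h\<bar>"
        by (auto simp: max_def power2_eq_square intro!: always_eventually)
      show "((\<lambda>h. \<bar>h\<bar>) \<longlongrightarrow> (0::real)) (at 0)" by (rule tendsto_eq_intros | simp)+
    qed
    then show ?thesis using 3 by (simp add: DERIV_def)
  qed
qed

lemma step_deriv: "(step has_real_derivative hat s) (at s)"
proof -
  have sh: "((\<lambda>s. (max 0 (s - c))\<^sup>2) has_real_derivative 2 * max 0 (s - c)) (at s)" for c
    using DERIV_shift[of "\<lambda>s. (max 0 s)\<^sup>2" "2 * max 0 (s - c)" s "- c"] max_0_sq_deriv[of "s - c"] by simp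
  have "(step has_real_derivative 2 * (2 * max 0 s - 2 * (2 * max 0 (s - 1 / 2)) + 2 * max 0 (s - 1))) (at s)"
    unfolding step_def[abs_def] by (intro DERIV_cmult DERIV_add DERIV_diff max_0_sq_deriv sh)
  then show ?thesis by (simp add: hat_def algebra_simps)
qed

lemma continuous_on_hat: "continuous_on S hat"
  unfolding hat_def[abs_def] by (intro continuous_intros)

lemma hat_nonneg: "0 \<le> hat s"
  by (auto simp: hat_def max_def)

lemma hat_eq_0: "s \<le> 0 \<or> 1 \<le> s \<Longrightarrow> hat s = 0"
  by (auto simp: hat_def max_def)

lemma step_0: "s \<le> 0 \<Longrightarrow> step s = 0"
  by (simp add: step_def max_def)

lemma step_1: "1 \<le> s \<Longrightarrow> step s = 1"
  by (simp add: step_def max_def power2_eq_square algebra_simps)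

lemma step_mono: "s \<le> t \<Longrightarrow> step s \<le> step t"
  by (rule DERIV_nonneg_imp_nondecreasing) (use step_deriv hat_nonneg in blast)+

lemma step_bounds: "0 \<le> step s" "step s \<le> 1"
  using step_mono[of "min s 0" s] step_mono[of s "max s 1"] step_0[of "min s 0"] step_1[of "max s 1"] by auto

lemma hat_scaled_deriv:
  assumes "\<delta> > 0"
  shows "((\<lambda>y. step ((y - a) / \<delta>)) has_real_derivative hat ((y - a) / \<delta>) / \<delta>) (at y)"
proof -
  have "((\<lambda>y. (y - a) / \<delta>) has_real_derivative 1 / \<delta>) (at y)"
    using assms by (auto intro!: derivative_eq_intros)
  from DERIV_chain2[OF step_deriv this] show ?thesis by simp
qed

lemma continuous_on_hat_scaled: "continuous_on S (\<lambda>y. hat ((y - a) / \<delta>) / \<delta>)"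
  unfolding divide_inverse
  by (intro continuous_on_mult continuous_on_const continuous_on_compose2[OF continuous_on_hat[of UNIV]])
     (auto intro!: continuous_intros)

text \<open>The scaled tent is an approximate identity supported on
  \<open>[a, a + \<delta>]\<close>; since its mass is 1, \<open>m\<close> can be moved under the
  integral.\<close>

lemma hat_average:
  assumes u: "continuous_on {0..1} u" and \<delta>: "\<delta> > 0" "0 \<le> a" "a + \<delta> \<le> 1"
    and e: "\<And>y. y \<in> {a..a + \<delta>} \<Longrightarrow> \<bar>u y - m\<bar> \<le> e"
  shows "\<bar>integral {0..1} (\<lambda>y. u y * (hat ((y - a) / \<delta>) / \<delta>)) - m\<bar> \<le> e"
proof -
  let ?h = "\<lambda>y. hat ((y - a) / \<delta>) / \<delta>"
  have hc: "continuous_on S ?h" for S by (rule continuous_on_hat_scaled)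
  have "(?h has_integral (step ((1 - a) / \<delta>) - step ((0 - a) / \<delta>))) {0..1}"
  proof (rule fundamental_theorem_of_calculus)
    show "((\<lambda>y. step ((y - a) / \<delta>)) has_vector_derivative ?h y) (at y within {0..1})" for y
      using has_field_derivative_at_within[OF hat_scaled_deriv[OF \<delta>(1)]]
      by (simp add: has_real_derivative_iff_has_vector_derivative)
  qed simp
  moreover have "step ((1 - a) / \<delta>) = 1" "step ((0 - a) / \<delta>) = 0"
    using \<delta> by (auto intro!: step_1 step_0 simp: field_simps)
  ultimately have "(?h has_integral 1) {0..1}" by simp
  then have 1: "integral {0..1} ?h = 1" by (rule integral_unique)
  have "integral {0..1} (\<lambda>y. u y * ?h y) - m = integral {0..1} (\<lambda>y. u y * ?h y) - integral {0..1} (\<lambda>y. m * ?h y)"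
    by (simp only: integral_mult_right 1 mult_1_right)
  also have "\<dots> = integral {0..1} (\<lambda>y. u y * ?h y - m * ?h y)"
    by (intro integral_diff[symmetric] integrable_continuous_interval continuous_on_mult u hc continuous_on_const)
  finally have eq: "integral {0..1} (\<lambda>y. u y * ?h y) - m = integral {0..1} (\<lambda>y. u y * ?h y - m * ?h y)" .
  have "norm (integral {0..1} (\<lambda>y. u y * ?h y - m * ?h y)) \<le> integral {0..1} (\<lambda>y. e * ?h y)"
  proof (rule integral_norm_bound_integral)
    show "norm (u y * ?h y - m * ?h y) \<le> e * ?h y" if "y \<in> {0..1}" for y
    proof (cases "y \<in> {a..a + \<delta>}")
      case True
      have "norm (u y * ?h y - m * ?h y) = \<bar>u y - m\<bar> * ?h y"
        using hat_nonneg[of "(y - a) / \<delta>"] \<delta>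
        by (simp only: left_diff_distrib[symmetric] real_norm_def abs_mult) simp
      also have "\<dots> \<le> e * ?h y" using e[OF True] hat_nonneg[of "(y - a) / \<delta>"] \<delta> by (intro mult_right_mono) auto
      finally show ?thesis .
    next
      case False
      then have "hat ((y - a) / \<delta>) = 0" using \<delta> by (intro hat_eq_0) (auto simp: field_simps)
      then show ?thesis by simp
    qed
  qed (intro integrable_continuous_interval continuous_on_mult continuous_on_diff u hc continuous_on_const)+
  also have "\<dots> = e" by (simp only: integral_mult_right 1 mult_1_right)
  finally show ?thesis unfolding eq by simp
qed

text \<open>The weak derivative is tested against a smoothed indicator function of \<open>[x, 1]\<close>; this replaces
  the identity \<open>u 1 - u x = \<integral>\<^sub>x\<^sup>1 g\<close> together with the Cauchy-Schwarz inequality.\<close>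

lemma H1_weighted_increment:
  assumes H: "H1_with_deriv u g" and x: "0 < x" "x < 1"
  shows "rod_weight x * (u 1 - u x)\<^sup>2 \<le> (1 - x) * wnorm2 g"
proof -
  have uc: "continuous_on {0..1} u" using H by (simp add: H1_with_deriv_def)
  \<comment> \<open>The claim is a closed condition on the increment, so it suffices to prove it for
    numbers arbitrarily close to \<open>u 1 - u x\<close>: the pairings \<open>D\<close> of
    \<open>g\<close> with cut-off functions.\<close>
  have "u 1 - u x \<in> {d. rod_weight x * d\<^sup>2 \<le> (1 - x) * wnorm2 g}"
  proof (rule closed_approachable[THEN iffD1, rule_format])
    show "closed {d. rod_weight x * d\<^sup>2 \<le> (1 - x) * wnorm2 g}"
      by (intro closed_Collect_le continuous_intros)
    fix e0 :: real assume "e0 > 0"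
    define e where "e = e0 / 3"
    have e: "e > 0" using \<open>e0 > 0\<close> by (simp add: e_def)
    have "\<exists>d>0. \<forall>y\<in>{0..1}. \<bar>y - c\<bar> < d \<longrightarrow> \<bar>u y - u c\<bar> \<le> e" if "c \<in> {0..1}" for c
      using uc that e unfolding continuous_on_iff dist_real_def by (meson less_imp_le)
    then obtain d1 d2 where d: "d1 > 0" "d2 > 0"
      and d1: "\<And>y. y \<in> {0..1} \<Longrightarrow> \<bar>y - x\<bar> < d1 \<Longrightarrow> \<bar>u y - u x\<bar> \<le> e"
      and d2: "\<And>y. y \<in> {0..1} \<Longrightarrow> \<bar>y - 1\<bar> < d2 \<Longrightarrow> \<bar>u y - u 1\<bar> \<le> e"
      using x by (metis atLeastAtMost_iff less_imp_le order_refl zero_le_one)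
    \<comment> \<open>The cut-off rises on \<open>[x, x + \<delta>]\<close> and falls on
      \<open>[1 - 2 * \<delta>, 1 - \<delta>]\<close>, before reaching 1. The bounds keep these
      intervals from overlapping and inside the neighbourhoods of \<open>x\<close> and 1 on which
      \<open>u\<close> varies by at most \<open>e\<close>.\<close>
    define \<delta> where "\<delta> = min (min (d1 / 2) (d2 / 3)) ((1 - x) / 3)"
    have \<delta>: "\<delta> > 0" "\<delta> < d1" "2 * \<delta> < d2" "3 * \<delta> \<le> 1 - x"
      using d x by (auto simp: \<delta>_def min_def)
    let ?b = "1 - 2 * \<delta>"
    define \<phi> where "\<phi> = (\<lambda>y. step ((y - x) / \<delta>) - step ((y - ?b) / \<delta>))"
    define \<phi>' where "\<phi>' = (\<lambda>y. hat ((y - x) / \<delta>) / \<delta> - hat ((y - ?b) / \<delta>) / \<delta>)"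
    have d\<phi>: "(\<phi> has_real_derivative \<phi>' y) (at y)" for y
      unfolding \<phi>_def \<phi>'_def by (intro DERIV_diff hat_scaled_deriv \<delta>)
    have deriv: "deriv \<phi> = \<phi>'" using d\<phi> by (intro ext DERIV_imp_deriv)
    have \<phi>c: "continuous_on S \<phi>" for S
      by (rule DERIV_continuous_on) (rule has_field_derivative_at_within[OF d\<phi>])
    have \<phi>'c: "continuous_on S \<phi>'" for S unfolding \<phi>'_def by (intro continuous_on_diff continuous_on_hat_scaled)
    have \<phi>0: "\<phi> y = 0" if "y < x" for y
      using that \<delta> by (simp add: \<phi>_def step_0 divide_nonpos_pos)
    have \<phi>1: "\<phi> y = 0" if "y > 1 - \<delta>" for y
      using that \<delta> by (simp add: \<phi>_def step_1 field_simps)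
    have \<phi>b: "0 \<le> \<phi> y" "\<phi> y \<le> 1" for y
    proof -
      have "step ((y - ?b) / \<delta>) \<le> step ((y - x) / \<delta>)"
        using \<delta> by (intro step_mono divide_right_mono) auto
      then show "0 \<le> \<phi> y" "\<phi> y \<le> 1"
        using step_bounds[of "(y - x) / \<delta>"] step_bounds[of "(y - ?b) / \<delta>"] by (auto simp: \<phi>_def)
    qed
    have "test_function_01 \<phi>"
      unfolding test_function_01_def deriv
    proof (intro conjI allI exI)
      show "\<phi> differentiable at y" for y using d\<phi> real_differentiable_def by blast
      show "0 < x" by fact
      show "1 - \<delta> < 1" using \<delta> by simp
      show "y \<notin> {x..1 - \<delta>} \<longrightarrow> \<phi> y = 0" for y using \<phi>0[of y] \<phi>1[of y] by auto
    qed (rule \<phi>'c)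
    then have weak: "(LINT y:{0<..<1}|lebesgue. u y * \<phi>' y) = - (LINT y:{0<..<1}|lebesgue. g y * \<phi> y)"
      using H unfolding H1_with_deriv_def deriv[symmetric] by blast
    define D where "D = (LINT y:{0<..<1}|lebesgue. g y * \<phi> y)"
    have "integral {0..1} (\<lambda>y. u y * \<phi>' y) = - D"
      using weak unfolding D_def by (subst (asm) set_lebesgue_integral_Ioo) (auto intro!: continuous_intros uc \<phi>'c)
    moreover have "integral {0..1} (\<lambda>y. u y * \<phi>' y) = integral {0..1} (\<lambda>y. u y * (hat ((y - x) / \<delta>) / \<delta>))
        - integral {0..1} (\<lambda>y. u y * (hat ((y - ?b) / \<delta>) / \<delta>))"
      unfolding \<phi>'_def right_diff_distrib
      by (intro integral_diff integrable_continuous_interval continuous_on_mult uc continuous_on_hat_scaled)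
    moreover have "\<bar>integral {0..1} (\<lambda>y. u y * (hat ((y - x) / \<delta>) / \<delta>)) - u x\<bar> \<le> e"
      using \<delta> x by (intro hat_average uc d1) auto
    moreover have "\<bar>integral {0..1} (\<lambda>y. u y * (hat ((y - ?b) / \<delta>) / \<delta>)) - u 1\<bar> \<le> e"
      using \<delta> x by (intro hat_average uc d2) auto
    ultimately have "\<bar>D - (u 1 - u x)\<bar> \<le> 2 * e" by linarith
    then have D: "dist D (u 1 - u x) < e0" using e by (simp add: dist_real_def e_def)
    have gi: "set_integrable lebesgue {0<..<1} g"
    proof (rule set_integrable_bound)
      show "set_integrable lebesgue {0<..<1} (\<lambda>y. 1 + (g y)\<^sup>2)"
        using H unfolding H1_with_deriv_def
        by (intro set_integral_add set_lebesgue_integral_Ioo(1)[OF continuous_on_const]) auto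
      show "set_borel_measurable lebesgue {0<..<1} g" using H by (simp add: H1_with_deriv_def)
      have "\<bar>s\<bar> \<le> \<bar>1 + s\<^sup>2\<bar>" for s :: real
        using zero_le_power2[of "\<bar>s\<bar> - 1"] zero_le_power2[of s] by (simp add: power2_diff)
      then show "AE y in lebesgue. y \<in> {0<..<1} \<longrightarrow> norm (g y) \<le> norm (1 + (g y)\<^sup>2)" by simp
    qed
    have "bounded (\<phi> ` {0<..<1})"
      unfolding bounded_iff using \<phi>b by (intro exI[of _ 1]) auto
    then have "set_integrable lebesgue {0<..<1} (\<lambda>y. \<phi> y * g y)"
      by (intro absolutely_integrable_bounded_measurable_product_real continuous_imp_measurable_on_sets_lebesgue \<phi>c gi) auto
    then have g\<phi>: "set_integrable lebesgue {0<..<1} (\<lambda>y. g y * \<phi> y)" by (simp add: mult.commute)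
    have \<phi>2: "(LINT y:{0<..<1}|lebesgue. (\<phi> y)\<^sup>2) \<le> 1 - x"
    proof -
      have i: "(\<lambda>y. (\<phi> y)\<^sup>2) integrable_on {a..b}" for a b
        by (intro integrable_continuous_interval continuous_intros \<phi>c)
      have "(LINT y:{0<..<1}|lebesgue. (\<phi> y)\<^sup>2) = integral {0..1} (\<lambda>y. (\<phi> y)\<^sup>2)"
        by (intro set_lebesgue_integral_Ioo continuous_intros \<phi>c)
      also have "\<dots> = integral {0..x} (\<lambda>y. (\<phi> y)\<^sup>2) + integral {x..1} (\<lambda>y. (\<phi> y)\<^sup>2)"
        using x i by (intro Henstock_Kurzweil_Integration.integral_combine[symmetric]) auto
      also have "integral {0..x} (\<lambda>y. (\<phi> y)\<^sup>2) = integral {0..x} (\<lambda>y. 0)"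
        by (rule integral_spike[where S = "{x}"]) (use \<phi>0 in auto)
      also have "integral {x..1} (\<lambda>y. (\<phi> y)\<^sup>2) \<le> integral {x..1} (\<lambda>y. 1)"
        using \<phi>b by (intro integral_le i) (auto simp: power_le_one)
      finally show ?thesis using x by simp
    qed
    have \<phi>2i: "set_integrable lebesgue {0<..<1} (\<lambda>y. (\<phi> y)\<^sup>2)"
      by (intro set_lebesgue_integral_Ioo continuous_intros \<phi>c)
    \<comment> \<open>Cauchy-Schwarz as a completed square:
      \<open>0 \<le> (g - t * \<phi>)^2\<close> for every \<open>t\<close>, with the best choice
      \<open>t = D / (1 - x)\<close>. Passing from \<open>rod_weight x\<close> to
      \<open>rod_weight y\<close> is allowed because the weight increases and \<open>\<phi>\<close>
      vanishes to the left of \<open>x\<close>.\<close>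
    have key: "rod_weight x * (2 * t * D - t\<^sup>2 * (1 - x)) \<le> wnorm2 g" for t
    proof -
      have "rod_weight x * (2 * t * D - t\<^sup>2 * (1 - x)) \<le>
         rod_weight x * (2 * t * D - t\<^sup>2 * (LINT y:{0<..<1}|lebesgue. (\<phi> y)\<^sup>2))"
        using \<phi>2 x by (intro mult_left_mono diff_left_mono rod_weight_nonneg) auto
      also have "\<dots> = (LINT y:{0<..<1}|lebesgue. (rod_weight x * 2 * t) * (g y * \<phi> y) - (rod_weight x * t\<^sup>2) * (\<phi> y)\<^sup>2)"
        unfolding D_def
        by (subst set_integral_diff(2)[OF set_integrable_mult_right[OF g\<phi>] set_integrable_mult_right[OF \<phi>2i]])
           (simp only: set_integral_mult_right, simp add: algebra_simps)
      also have "\<dots> \<le> wnorm2 g"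
        unfolding wnorm2_def
      proof (rule set_integral_mono)
        show "set_integrable lebesgue {0<..<1} (\<lambda>y. (rod_weight x * 2 * t) * (g y * \<phi> y) - (rod_weight x * t\<^sup>2) * (\<phi> y)\<^sup>2)"
          by (intro set_integral_diff set_integrable_mult_right g\<phi> \<phi>2i)
        show "set_integrable lebesgue {0<..<1} (\<lambda>y. rod_weight y * (g y)\<^sup>2)"
          by (rule H1_with_deriv_integrable[OF H])
        fix y :: real assume y: "y \<in> {0<..<1}"
        show "(rod_weight x * 2 * t) * (g y * \<phi> y) - (rod_weight x * t\<^sup>2) * (\<phi> y)\<^sup>2 \<le> rod_weight y * (g y)\<^sup>2"
        proof (cases "y < x")
          case True
          then show ?thesis using y \<phi>0[OF True] rod_weight_nonneg[of y] by simp
        next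
          case False
          have "rod_weight x * (2 * t * (g y * \<phi> y) - t\<^sup>2 * (\<phi> y)\<^sup>2) \<le> rod_weight x * (g y)\<^sup>2"
            using zero_le_power2[of "g y - t * \<phi> y"] x
            by (intro mult_left_mono rod_weight_nonneg) (auto simp: power2_diff power_mult_distrib algebra_simps)
          also have "\<dots> \<le> rod_weight y * (g y)\<^sup>2"
            using False by (intro mult_right_mono rod_weight_mono) auto
          finally show ?thesis by (simp add: algebra_simps)
        qed
      qed
      finally show ?thesis .
    qed
    have "2 * (D / (1 - x)) * D - (D / (1 - x))\<^sup>2 * (1 - x) = D\<^sup>2 / (1 - x)"
      using x by (simp add: power2_eq_square)
    with key[of "D / (1 - x)"] have "rod_weight x * (D\<^sup>2 / (1 - x)) \<le> wnorm2 g" by simp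
    then have "D \<in> {d. rod_weight x * d\<^sup>2 \<le> (1 - x) * wnorm2 g}" using x by (simp add: field_simps)
    with D show "\<exists>y\<in>{d. rod_weight x * d\<^sup>2 \<le> (1 - x) * wnorm2 g}. dist y (u 1 - u x) < e0" by blast
  qed
  then show ?thesis by simp
qed


text \<open>Equivalent to \<open>exp 1 \<le> 3\<close>.\<close>

lemma rod_beta_ge_2: "rod_beta \<ge> 2"
  using exp_le by (simp add: rod_beta_def pos_le_divide_eq)

text \<open>What matters is \<open>- 5 / 4 < - 1\<close>: this makes \<open>1 + \<alpha>\<^sub>1\<^sup>-\<close>, hence \<open>\<gamma>\<^sub>1\<^sup>-\<close>, negative.\<close>

lemma rod_coercive_minus: "rod_coercive (- 5 / 4)"
  unfolding rod_coercive_def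
proof (intro allI impI)
  fix u g assume "admissible u g"
  then have H: "H1_with_deriv u g" and u: "u 0 = 1" "u 1 = 1" by (auto simp: admissible_def)
  have uc: "continuous_on {0..1} u" using H by (simp add: H1_with_deriv_def)
  let ?B = "wnorm2 g"
  have "wnorm2 u = integral {0..1} (\<lambda>x. rod_weight x * (u x)\<^sup>2)"
    by (rule wnorm2_continuous[OF uc])
  also have "\<dots> \<le> integral {0..1} (\<lambda>x. 3 * rod_weight x + (3 / 2 * ?B) * (1 - x))"
  proof (rule integral_le)
    fix x :: real assume x: "x \<in> {0..1}"
    consider "x = 0" | "x = 1" | "0 < x" "x < 1" using x by fastforce
    then show "rod_weight x * (u x)\<^sup>2 \<le> 3 * rod_weight x + (3 / 2 * ?B) * (1 - x)"
    proof cases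
      case 1
      then show ?thesis using u wnorm2_nonneg[of g] by (simp add: rod_weight_def)
    next
      case 2
      then show ?thesis using u rod_weight_nonneg[of 1] by simp
    next
      case 3
      \<comment> \<open>This is \<open>(1 + d)^2 \<le> (1 + \<eta>) + (1 + 1 / \<eta>) * d^2\<close>
        at \<open>\<eta> = 2\<close>. After integration \<open>5 / 4 * wnorm2 u\<close> is at most
        \<open>15 / 4 + 15 / 16 * wnorm2 g\<close>; the factor 15/16 is below 1, and
        \<open>15 / 4 \<le> 5 / 4 + 4\<close>.\<close>
      have "s\<^sup>2 \<le> 3 + 3 / 2 * (1 - s)\<^sup>2" for s :: real
        using zero_le_power2[of "s - 3"] by (simp add: power2_eq_square field_simps)
      then have "rod_weight x * (u x)\<^sup>2 \<le> rod_weight x * (3 + 3 / 2 * (u 1 - u x)\<^sup>2)"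
        using u x by (intro mult_left_mono rod_weight_nonneg) auto
      also have "\<dots> = 3 * rod_weight x + 3 / 2 * (rod_weight x * (u 1 - u x)\<^sup>2)"
        by (simp add: algebra_simps)
      also have "\<dots> \<le> 3 * rod_weight x + 3 / 2 * ((1 - x) * ?B)"
        using H1_weighted_increment[OF H 3] by simp
      finally show ?thesis by (simp add: algebra_simps)
    qed
  qed (intro integrable_continuous_interval continuous_intros uc)+
  also have "\<dots> = integral {0..1} (\<lambda>x. 3 * rod_weight x) + integral {0..1} (\<lambda>x. (3 / 2 * ?B) * (1 - x))"
    by (intro integral_add integrable_continuous_interval continuous_intros)
  also have "integral {0..1} (\<lambda>x. 3 * rod_weight x) = 3"
    by (simp only: integral_mult_right integral_rod_weight mult_1_right)
  also have "integral {0..1} (\<lambda>x. (3 / 2 * ?B) * (1 - x)) = (3 / 2 * ?B) * (1 / 2)"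
  proof -
    have "((\<lambda>x. 1 - x) has_integral ((1 - 1\<^sup>2 / 2) - (0 - 0\<^sup>2 / 2))) {0..1::real}"
      by (rule fundamental_theorem_of_calculus)
         (auto intro!: derivative_eq_intros simp flip: has_real_derivative_iff_has_vector_derivative)
    then have "integral {0..1} (\<lambda>x. 1 - x) = (1 / 2 :: real)" by (simp add: integral_unique)
    then show ?thesis by (simp only: integral_mult_right)
  qed
  finally have A: "wnorm2 u \<le> 3 + 3 / 4 * ?B" by simp
  have "rod_beta\<^sup>2 \<ge> 2\<^sup>2" using rod_beta_ge_2 by (intro power_mono) auto
  with A wnorm2_nonneg[of g] show "- 5 / 4 - rod_beta\<^sup>2 \<le> - 5 / 4 * wnorm2 u + wnorm2 g"
    by simp
qed

section \<open>The interval of coercive parameters\<close>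

text \<open>Here the left-hand side of the inequality is 0 and the right-hand side a sum of
  nonnegative terms. This supplies a positive element of the interval.\<close>

lemma rod_coercive_plus: "rod_coercive (rod_beta\<^sup>2)"
  unfolding rod_coercive_def by (auto intro!: add_nonneg_nonneg mult_nonneg_nonneg wnorm2_nonneg)

lemma integral_pos:
  fixes f :: "real \<Rightarrow> real"
  assumes "continuous_on {0..1} f" "\<And>x. x \<in> {0..1} \<Longrightarrow> 0 \<le> f x" "f (1 / 2) > 0"
  shows "integral {0..1} f > 0"
proof (rule ccontr)
  assume "\<not> ?thesis"
  moreover have "0 \<le> integral {0..1} f"
    using assms by (intro integral_nonneg integrable_continuous_interval) auto
  ultimately have "(f has_integral 0) (cbox 0 1)"
    using assms(1) by (intro has_integral_integrable_integral[THEN iffD2]) (auto intro: integrable_continuous_interval)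
  then have "f (1 / 2) = 0"
    using assms by (intro has_integral_0_cbox_imp_0[of 0 1 f]) auto
  with assms(3) show False by simp
qed

text \<open>The inequality in \<open>rod_coercive\<close> reads
  \<open>\<alpha> * (1 - wnorm2 u) \<le> rod_beta^2 + wnorm2 g\<close>, so a competitor with
  \<open>wnorm2 u > 1\<close> bounds \<alpha> from below and one with \<open>wnorm2 u < 1\<close>
  from above. Raising or lowering the constant 1 inside the interval gives both.\<close>

lemma admissible_bump:
  defines "u \<equiv> \<lambda>(c::real) x. 1 + c * (x * (1 - x))"
  shows "admissible (u c) (\<lambda>x. c * (1 - 2 * x))"
    and "wnorm2 (u 1) > 1" and "wnorm2 (u (- 1)) < 1"
proof -
  show "admissible (u c) (\<lambda>x. c * (1 - 2 * x))"
    unfolding admissible_def u_def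
    by (auto intro!: C1_imp_H1_with_deriv derivative_eq_intros continuous_intros simp: algebra_simps)
  have w: "wnorm2 (u c) = integral {0..1} (\<lambda>x. rod_weight x * (u c x)\<^sup>2)" for c
    by (rule wnorm2_continuous) (auto simp: u_def intro!: continuous_intros)
  have d: "wnorm2 (u c) - 1 = integral {0..1} (\<lambda>x. rod_weight x * ((u c x)\<^sup>2 - 1))" for c
  proof -
    have "integral {0..1} (\<lambda>x. rod_weight x * (u c x)\<^sup>2) - integral {0..1} rod_weight
      = integral {0..1} (\<lambda>x. rod_weight x * (u c x)\<^sup>2 - rod_weight x)"
      unfolding u_def by (intro integral_diff[symmetric] integrable_continuous_interval continuous_intros)
    then show ?thesis by (simp add: w integral_rod_weight algebra_simps)
  qed
  have q: "0 \<le> x * (1 - x)" "x * (1 - x) \<le> 1" if "x \<in> {0..1}" for x :: real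
    using that by (auto intro: mult_le_one)
  have "integral {0..1} (\<lambda>x. rod_weight x * ((u 1 x)\<^sup>2 - 1)) > 0"
  proof (rule integral_pos)
    show "0 \<le> rod_weight x * ((u 1 x)\<^sup>2 - 1)" if "x \<in> {0..1}" for x
      using that q[OF that] by (auto intro!: mult_nonneg_nonneg rod_weight_nonneg simp: u_def)
    show "0 < rod_weight (1 / 2) * ((u 1 (1 / 2))\<^sup>2 - 1)"
      by (auto intro!: mult_pos_pos rod_weight_pos simp: u_def power2_eq_square)
  qed (auto simp: u_def intro!: continuous_intros)
  then show "wnorm2 (u 1) > 1" using d[of 1] by simp
  have "integral {0..1} (\<lambda>x. rod_weight x * (1 - (u (- 1) x)\<^sup>2)) > 0"
  proof (rule integral_pos)
    show "0 \<le> rod_weight x * (1 - (u (- 1) x)\<^sup>2)" if "x \<in> {0..1}" for x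
      using that q[OF that] by (auto intro!: mult_nonneg_nonneg rod_weight_nonneg power_le_one simp: u_def)
    show "0 < rod_weight (1 / 2) * (1 - (u (- 1) (1 / 2))\<^sup>2)"
      by (auto intro!: mult_pos_pos rod_weight_pos simp: u_def power2_eq_square)
  qed (auto simp: u_def intro!: continuous_intros)
  moreover have "integral {0..1} (\<lambda>x. rod_weight x * (1 - (u (- 1) x)\<^sup>2)) = - (wnorm2 (u (- 1)) - 1)"
    unfolding d by (simp flip: integral_neg add: algebra_simps)
  ultimately show "wnorm2 (u (- 1)) < 1" by simp
qed

text \<open>As an infimum of affine functions of \<open>\<alpha>\<close>, the left-hand side of the defining inequality is concave
  and upper semicontinuous, so the admissible parameters form a closed interval.\<close>

lemma rod_coercive_interval:
  obtains am ap where "am \<le> - 5 / 4" "0 < ap" "\<And>\<alpha>. rod_coercive \<alpha> \<longleftrightarrow> am \<le> \<alpha> \<and> \<alpha> \<le> ap"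
proof -
  let ?S = "Collect rod_coercive"
  obtain u1 g1 where 1: "admissible u1 g1" "wnorm2 u1 > 1" using admissible_bump by blast
  obtain u2 g2 where 2: "admissible u2 g2" "wnorm2 u2 < 1" using admissible_bump by blast
  have "?S = (\<Inter>(u, g)\<in>{(u, g). admissible u g}. {\<alpha>. \<alpha> - rod_beta\<^sup>2 \<le> \<alpha> * wnorm2 u + wnorm2 g})"
    by (auto simp: rod_coercive_def)
  moreover have "closed \<dots>"
    by (intro closed_INT ballI) (auto intro!: closed_Collect_le continuous_intros)
  ultimately have cl: "closed ?S" by simp
  have below: "(- rod_beta\<^sup>2 - wnorm2 g1) / (wnorm2 u1 - 1) \<le> \<alpha>" if "rod_coercive \<alpha>" for \<alpha>
  proof -
    have "\<alpha> - rod_beta\<^sup>2 \<le> \<alpha> * wnorm2 u1 + wnorm2 g1" using that 1 unfolding rod_coercive_def by blast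
    then show ?thesis using 1(2) by (simp add: pos_divide_le_eq algebra_simps)
  qed
  have above: "\<alpha> \<le> (rod_beta\<^sup>2 + wnorm2 g2) / (1 - wnorm2 u2)" if "rod_coercive \<alpha>" for \<alpha>
  proof -
    have "\<alpha> - rod_beta\<^sup>2 \<le> \<alpha> * wnorm2 u2 + wnorm2 g2" using that 2 unfolding rod_coercive_def by blast
    then show ?thesis using 2(2) by (simp add: pos_le_divide_eq algebra_simps)
  qed
  have ne: "?S \<noteq> {}" using rod_coercive_minus by blast
  have bb: "bdd_below ?S" by (rule bdd_belowI) (use below in blast)
  have ba: "bdd_above ?S" by (rule bdd_aboveI) (use above in blast)
  have am: "rod_coercive (Inf ?S)" using closed_contains_Inf[OF ne bb cl] by simp
  have ap: "rod_coercive (Sup ?S)" using closed_contains_Sup[OF ne ba cl] by simp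
  have conv: "rod_coercive \<alpha>" if "Inf ?S \<le> \<alpha>" "\<alpha> \<le> Sup ?S" for \<alpha>
    unfolding rod_coercive_def
  proof (intro allI impI)
    fix u g assume ug: "admissible u g"
    let ?m = "1 - wnorm2 u" and ?n = "rod_beta\<^sup>2 + wnorm2 g"
    have "Inf ?S * ?m \<le> ?n" "Sup ?S * ?m \<le> ?n"
      using am ap ug unfolding rod_coercive_def by (auto simp: algebra_simps)
    \<comment> \<open>A linear function of \<alpha> is largest at an endpoint of the interval; the
      sign of \<open>?m\<close> decides which.\<close>
    moreover have "\<alpha> * ?m \<le> Sup ?S * ?m \<or> \<alpha> * ?m \<le> Inf ?S * ?m"
      using that by (cases "?m \<ge> 0") (auto intro: mult_right_mono mult_right_mono_neg)
    ultimately have "\<alpha> * ?m \<le> ?n" by linarith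
    then show "\<alpha> - rod_beta\<^sup>2 \<le> \<alpha> * wnorm2 u + wnorm2 g" by (simp add: algebra_simps)
  qed
  show thesis
  proof (rule that)
    show "Inf ?S \<le> - 5 / 4" using rod_coercive_minus bb by (intro cInf_lower) auto
    have "rod_beta\<^sup>2 \<le> Sup ?S" using rod_coercive_plus ba by (intro cSup_upper) auto
    moreover have "0 < rod_beta\<^sup>2" using rod_beta_ge_2 by simp
    ultimately show "0 < Sup ?S" by linarith
    show "rod_coercive \<alpha> \<longleftrightarrow> Inf ?S \<le> \<alpha> \<and> \<alpha> \<le> Sup ?S" for \<alpha>
      using conv bb ba by (auto intro: cInf_lower cSup_upper)
  qed
qed

text \<open>A nonempty closed interval determines its endpoints, so the definite description
  denotes.\<close>

lemma alpha1_eq: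
  obtains am ap where "alpha1 = (am, ap)" "am \<le> - 5 / 4" "0 < ap"
    "\<And>\<alpha>. rod_coercive \<alpha> \<longleftrightarrow> am \<le> \<alpha> \<and> \<alpha> \<le> ap"
proof -
  obtain am ap where a: "am \<le> - 5 / 4" "0 < ap" and iff: "\<And>\<alpha>. rod_coercive \<alpha> \<longleftrightarrow> am \<le> \<alpha> \<and> \<alpha> \<le> ap"
    by (rule rod_coercive_interval) blast
  have "alpha1 = (am, ap)"
    unfolding alpha1_def rod_coercive_iff
  proof (rule the_equality, goal_cases)
    case 1
    then show ?case using a iff by auto
  next
    case (2 p)
    obtain bm bp where p: "p = (bm, bp)" by (cases p)
    have b: "bm < 0" "0 < bp" "\<And>\<alpha>. rod_coercive \<alpha> \<longleftrightarrow> bm \<le> \<alpha> \<and> \<alpha> \<le> bp" using 2 p by auto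
    have "am \<le> \<alpha> \<and> \<alpha> \<le> ap \<longleftrightarrow> bm \<le> \<alpha> \<and> \<alpha> \<le> bp" for \<alpha> using b(3) iff by blast
    from this[of am] this[of ap] this[of bm] this[of bp] show ?case using a b(1,2) p by auto
  qed
  with a iff show thesis by (intro that)
qed

text \<open>The map \<open>\<gamma> \<mapsto> 3 / \<gamma> - 1\<close> sends the negative range of
  \<gamma> into \<open>[am, -1)\<close> and the positive range into \<open>(-1, ap]\<close>. The two
  ranges have these signs because \<open>am < -1\<close> and \<open>ap > 0\<close>.\<close>

lemma rod_coercive_of_gamma:
  assumes "\<gamma> \<le> gamma1_minus \<or> \<gamma> \<ge> gamma1_plus"
  shows "\<gamma> \<noteq> 0" "rod_coercive (3 / \<gamma> - 1)"
proof -
  obtain am ap where a: "alpha1 = (am, ap)" "am \<le> - 5 / 4" "0 < ap"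
    and iff: "\<And>\<alpha>. rod_coercive \<alpha> \<longleftrightarrow> am \<le> \<alpha> \<and> \<alpha> \<le> ap" by (rule alpha1_eq) blast
  have "\<gamma> \<noteq> 0 \<and> am \<le> 3 / \<gamma> - 1 \<and> 3 / \<gamma> - 1 \<le> ap"
  proof (cases "\<gamma> \<le> gamma1_minus")
    case True
    then have g: "\<gamma> \<le> 3 / (1 + am)" unfolding gamma1_minus_def a(1) by simp
    moreover have "3 / (1 + am) < 0" using a(2) by (intro divide_pos_neg) auto
    ultimately have n: "\<gamma> < 0" by linarith
    from g have "\<gamma> * (1 + am) \<ge> 3" using a(2) by (simp add: neg_le_divide_eq)
    then have "1 + am \<le> 3 / \<gamma>" using n by (simp add: neg_le_divide_eq mult.commute)
    moreover have "3 / \<gamma> < 0" using n by (simp add: divide_pos_neg)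
    ultimately show ?thesis using n a(2,3) by linarith
  next
    case False
    then have g: "3 / (1 + ap) \<le> \<gamma>" using assms unfolding gamma1_plus_def a(1) by simp
    moreover have "3 / (1 + ap) > 0" using a(3) by simp
    ultimately have n: "\<gamma> > 0" by linarith
    from g have "3 \<le> \<gamma> * (1 + ap)" using a(3) by (simp add: pos_divide_le_eq)
    then have "3 / \<gamma> \<le> 1 + ap" using n by (simp add: pos_divide_le_eq mult.commute)
    moreover have "3 / \<gamma> > 0" using n by simp
    ultimately show ?thesis using n a(2,3) by linarith
  qed
  then show "\<gamma> \<noteq> 0" "rod_coercive (3 / \<gamma> - 1)" using iff by auto
qed

section \<open>Characteristics and a Riccati system\<close>

lemma DERIV_within_nonneg_imp_mono:
  fixes f :: "real \<Rightarrow> real"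
  assumes "a \<le> b"
    and d: "\<And>x. x \<in> {a..b} \<Longrightarrow> (f has_real_derivative f' x) (at x within {a..b})"
    and "\<And>x. x \<in> {a..b} \<Longrightarrow> 0 \<le> f' x"
  shows "f a \<le> f b"
proof (rule DERIV_nonneg_imp_increasing_open[OF \<open>a \<le> b\<close>])
  show "continuous_on {a..b} f" using d by (rule DERIV_continuous_on)
  fix x assume x: "a < x" "x < b"
  then show "\<exists>y. (f has_real_derivative y) (at x) \<and> 0 \<le> y"
    using d[of x] assms(3)[of x] by (auto simp: at_within_Icc_at)
qed

text \<open>Picard iteration in Bielecki's weighted norm: the fixed point \<open>z\<close> encodes
  the curve \<open>exp (K * (t - a)) * z t\<close>. The weight gives the contraction factor
  \<open>L / K\<close> whatever the length of the interval, so a single fixed point covers all of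
  \<open>[a, b]\<close>.\<close>

lemma ode_exists:
  fixes f :: "real \<Rightarrow> real \<Rightarrow> real"
  assumes ab: "a \<le> b" and cont: "continuous_on ({a..b} \<times> UNIV) (\<lambda>(t, x). f t x)"
    and lip: "\<And>t x y. t \<in> {a..b} \<Longrightarrow> \<bar>f t x - f t y\<bar> \<le> L * \<bar>x - y\<bar>"
  obtains q where "q a = x0"
    "\<And>t. t \<in> {a..b} \<Longrightarrow> (q has_real_derivative f t (q t)) (at t within {a..b})"
proof -
  have "0 \<le> \<bar>f a 1 - f a 0\<bar>" by simp
  also have "\<dots> \<le> L" using lip[of a 1 0] ab by simp
  finally have L0: "0 \<le> L" .
  \<comment> \<open>\<open>2 * L \<le> K\<close> yields the factor 1/2, and the \<open>+ 1\<close>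
    keeps \<open>K\<close> positive when \<open>L = 0\<close>.\<close>
  define K where "K = 2 * L + 1"
  have K: "K > 0" "2 * L \<le> K" using L0 by (auto simp: K_def)
  \<comment> \<open>The complete space of bounded continuous functions lives on the whole line;
    clamping time to \<open>[a, b]\<close> extends the iterates to it.\<close>
  define cl where "cl = (\<lambda>t. max a (min b t))"
  have cl: "cl t \<in> {a..b}" for t using ab by (auto simp: cl_def)
  have cl_id: "t \<in> {a..b} \<Longrightarrow> cl t = t" for t by (auto simp: cl_def)
  define g where "g = (\<lambda>z::real \<Rightarrow>\<^sub>C real. \<lambda>r. f r (exp (K * (r - a)) * z r))"
  define J where "J = (\<lambda>z t. x0 + integral {a..t} (g z))"
  define T where "T = (\<lambda>z. Bcontfun (\<lambda>t. exp (- (K * (cl t - a))) * J z (cl t)))"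
  have gc: "continuous_on {a..b} (g z)" for z
  proof -
    have "continuous_on {a..b} (\<lambda>r. (\<lambda>(t, x). f t x) (r, exp (K * (r - a)) * z r))"
      by (rule continuous_on_compose2[OF cont]) (auto intro!: continuous_intros)
    then show ?thesis by (simp add: g_def)
  qed
  have dJ: "(J z has_real_derivative g z t) (at t within {a..b})" if "t \<in> {a..b}" for z t
    unfolding J_def using DERIV_add[OF DERIV_const integral_has_real_derivative[OF gc that]] by simp
  have Jc: "continuous_on {a..b} (J z)" for z by (rule DERIV_continuous_on[OF dJ])
  have TB: "(\<lambda>t. exp (- (K * (cl t - a))) * J z (cl t)) \<in> bcontfun" for z
  proof -
    let ?e = "\<lambda>s. exp (- (K * (s - a))) * J z s"
    have ec: "continuous_on {a..b} ?e" by (intro continuous_intros Jc)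
    have "continuous_on UNIV (\<lambda>t. ?e (cl t))"
    proof (rule continuous_on_compose2[OF ec])
      show "continuous_on UNIV cl" unfolding cl_def by (intro continuous_intros)
    qed (use cl in auto)
    moreover have "bounded (range (\<lambda>t. ?e (cl t)))"
      by (rule bounded_subset[OF compact_imp_bounded[OF compact_continuous_image[OF ec compact_Icc]]])
         (use cl in blast)
    ultimately show ?thesis by (simp add: bcontfun_def)
  qed
  have T: "T z t = exp (- (K * (cl t - a))) * J z (cl t)" for z t
    unfolding T_def using Bcontfun_inverse[OF TB[of z]] by simp
  have "dist (T z) (T y) \<le> 1 / 2 * dist z y" for z y
  proof (rule dist_bound)
    fix t
    let ?s = "cl t" and ?D = "dist z y"
    have s: "a \<le> ?s" "?s \<le> b" using cl[of t] by auto
    have gi: "g z integrable_on {a..?s}" for z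
      by (intro integrable_continuous_interval continuous_on_subset[OF gc]) (use s in auto)
    have "\<bar>J z ?s - J y ?s\<bar> = norm (integral {a..?s} (\<lambda>r. g z r - g y r))"
      unfolding J_def by (simp add: integral_diff[OF gi gi])
    also have "\<dots> \<le> integral {a..?s} (\<lambda>r. (L * ?D) * exp (K * (r - a)))"
    proof (rule integral_norm_bound_integral)
      show "(\<lambda>r. g z r - g y r) integrable_on {a..?s}" by (intro integrable_diff gi)
      show "(\<lambda>r. (L * ?D) * exp (K * (r - a))) integrable_on {a..?s}"
        by (intro integrable_continuous_interval continuous_intros)
      fix r assume r: "r \<in> {a..?s}"
      have "norm (g z r - g y r) \<le> L * \<bar>exp (K * (r - a)) * z r - exp (K * (r - a)) * y r\<bar>"
        unfolding g_def real_norm_def using r s by (intro lip) auto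
      also have "\<dots> = L * (exp (K * (r - a)) * dist (z r) (y r))"
        by (simp add: dist_real_def abs_mult flip: right_diff_distrib)
      also have "\<dots> \<le> L * (exp (K * (r - a)) * ?D)"
        using L0 by (intro mult_left_mono dist_bounded) auto
      finally show "norm (g z r - g y r) \<le> (L * ?D) * exp (K * (r - a))" by (simp add: mult_ac)
    qed
    also have "\<dots> = (L * ?D) * ((exp (K * (?s - a)) - 1) / K)"
    proof -
      have "((\<lambda>r. exp (K * (r - a))) has_integral (exp (K * (?s - a)) / K - exp (K * (a - a)) / K)) {a..?s}"
        using s K by (intro fundamental_theorem_of_calculus)
          (auto intro!: derivative_eq_intros simp flip: has_real_derivative_iff_has_vector_derivative)
      then show ?thesis by (simp add: integral_unique diff_divide_distrib)
    qed
    also have "\<dots> \<le> (L * ?D) * (exp (K * (?s - a)) / K)"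
      using L0 K by (intro mult_left_mono divide_right_mono) auto
    also have "\<dots> = (L / K) * ?D * exp (K * (?s - a))" by simp
    also have "\<dots> \<le> 1 / 2 * ?D * exp (K * (?s - a))"
      using K by (intro mult_right_mono) (auto simp: field_simps)
    finally have "\<bar>J z ?s - J y ?s\<bar> \<le> 1 / 2 * ?D * exp (K * (?s - a))" .
    then have "exp (- (K * (?s - a))) * \<bar>J z ?s - J y ?s\<bar> \<le> exp (- (K * (?s - a))) * (1 / 2 * ?D * exp (K * (?s - a)))"
      by (intro mult_left_mono) auto
    also have "\<dots> = 1 / 2 * ?D" by (simp add: exp_minus)
    finally show "dist (T z t) (T y t) \<le> 1 / 2 * ?D"
      unfolding T by (simp add: dist_real_def abs_mult flip: right_diff_distrib)
  qed
  then have "\<exists>!z. T z = z" by (intro banach_fix_type[where c = "1 / 2"]) auto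
  then obtain z where z: "T z = z" by blast
  have Jz: "J z t = exp (K * (t - a)) * z t" if "t \<in> {a..b}" for t
    using T[of z t] z cl_id[OF that] by (simp add: exp_minus)
  show thesis
  proof (rule that)
    show "J z a = x0" by (simp add: J_def)
    show "(J z has_real_derivative f t (J z t)) (at t within {a..b})" if "t \<in> {a..b}" for t
      using dJ[OF that, of z] Jz[OF that] by (simp add: g_def)
  qed
qed

text \<open>While both functions are positive, \<open>1 / a + 1 / b\<close> has derivative at most
  \<open>- k * (b / a + a / b) \<le> - 2 * k\<close>. The sum is still positive at \<open>T\<close>,
  which limits \<open>T - r\<close>.\<close>

lemma riccati_blowup:
  fixes a b :: "real \<Rightarrow> real"
  assumes "r \<le> T" and k: "k > 0"
    and da: "\<And>t. t \<in> {r..T} \<Longrightarrow> (a has_real_derivative a' t) (at t within {r..T})"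
    and db: "\<And>t. t \<in> {r..T} \<Longrightarrow> (b has_real_derivative b' t) (at t within {r..T})"
    and a': "\<And>t. t \<in> {r..T} \<Longrightarrow> k * a t * b t \<le> a' t"
    and b': "\<And>t. t \<in> {r..T} \<Longrightarrow> k * a t * b t \<le> b' t"
    and pos: "a r > 0" "b r > 0"
  shows "2 * k * (T - r) < 1 / a r + 1 / b r"
proof -
  \<comment> \<open>The other function is a given coefficient of any sign: with its primitive
    \<open>B\<close>, the product \<open>exp (- k * B) * f\<close> is nondecreasing. So
    \<open>a\<close> and \<open>b\<close> stay positive without a continuation argument.\<close>
  have pos_propagates: "f t > 0"
    if df: "\<And>t. t \<in> {r..T} \<Longrightarrow> (f has_real_derivative f' t) (at t within {r..T})"
      and gc: "continuous_on {r..T} g" and f': "\<And>t. t \<in> {r..T} \<Longrightarrow> k * f t * g t \<le> f' t"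
      and f0: "f r > 0" and t: "t \<in> {r..T}" for f f' g :: "real \<Rightarrow> real" and t
  proof -
    define B where "B = (\<lambda>t. integral {r..t} g)"
    have dB: "(B has_real_derivative g s) (at s within {r..T})" if "s \<in> {r..T}" for s
      unfolding B_def by (rule integral_has_real_derivative[OF gc that])
    have "exp (- k * B r) * f r \<le> exp (- k * B t) * f t"
    proof (rule DERIV_within_nonneg_imp_mono[where f = "\<lambda>s. exp (- k * B s) * f s"])
      fix s assume s: "s \<in> {r..t}"
      then have sT: "s \<in> {r..T}" using t by auto
      have "((\<lambda>s. exp (- k * B s) * f s) has_real_derivative
          exp (- k * B s) * (f' s - k * f s * g s)) (at s within {r..T})"
        using dB[OF sT] df[OF sT] by (auto intro!: derivative_eq_intros simp: algebra_simps)
      then show "((\<lambda>s. exp (- k * B s) * f s) has_real_derivative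
          exp (- k * B s) * (f' s - k * f s * g s)) (at s within {r..t})"
        by (rule DERIV_subset) (use t in auto)
      show "0 \<le> exp (- k * B s) * (f' s - k * f s * g s)" using f'[OF sT] by simp
    qed (use t in auto)
    moreover have "0 < exp (- k * B r) * f r" using f0 by simp
    ultimately have "0 < exp (- k * B t) * f t" by linarith
    then show ?thesis by (simp add: zero_less_mult_iff)
  qed
  have a0: "a t > 0" if "t \<in> {r..T}" for t
    using pos_propagates[OF da DERIV_continuous_on[OF db] a' pos(1) that] by simp
  have b0: "b t > 0" if "t \<in> {r..T}" for t
    using pos_propagates[OF db DERIV_continuous_on[OF da] _ pos(2) that] b' by (simp add: mult_ac)
  have "- (1 / a r + 1 / b r) - 2 * k * r \<le> - (1 / a T + 1 / b T) - 2 * k * T"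
  proof (rule DERIV_within_nonneg_imp_mono[where f = "\<lambda>t. - (1 / a t + 1 / b t) - 2 * k * t", OF \<open>r \<le> T\<close>])
    fix t assume t: "t \<in> {r..T}"
    show "((\<lambda>t. - (1 / a t + 1 / b t) - 2 * k * t) has_real_derivative
        a' t / (a t)\<^sup>2 + b' t / (b t)\<^sup>2 - 2 * k) (at t within {r..T})"
      using da[OF t] db[OF t] a0[OF t] b0[OF t]
      by (auto intro!: derivative_eq_intros simp: power2_eq_square)
    have "k * (b t / a t) \<le> a' t / (a t)\<^sup>2"
      using a'[OF t] a0[OF t] by (simp add: field_simps power2_eq_square)
    moreover have "k * (a t / b t) \<le> b' t / (b t)\<^sup>2"
      using b'[OF t] b0[OF t] by (simp add: field_simps power2_eq_square)
    moreover have "2 \<le> b t / a t + a t / b t"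
      using zero_le_power2[of "a t - b t"] a0[OF t] b0[OF t]
      by (simp add: field_simps power2_eq_square)
    then have "k * 2 \<le> k * (b t / a t + a t / b t)"
      using k by (intro mult_left_mono) auto
    ultimately show "0 \<le> a' t / (a t)\<^sup>2 + b' t / (b t)\<^sup>2 - 2 * k"
      by (simp add: distrib_left)
  qed
  moreover have "0 < 1 / a T + 1 / b T"
    using a0[of T] b0[of T] \<open>r \<le> T\<close> by (intro add_pos_pos) auto
  ultimately show ?thesis by (simp add: right_diff_distrib)
qed

text \<open>\<open>exp (2 * c * x)\<close> times the squared positive part is nondecreasing,
  \<open>exp (- 2 * c * x)\<close> times the squared negative part is nonincreasing. Hence
  \<open>u \<le> 0\<close> to the left of a zero and \<open>u \<ge> 0\<close> to its right, and
  every point has integer translates on both sides.\<close>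

lemma vanishes_of_one_sided_bound:
  fixes u ux :: "real \<Rightarrow> real"
  assumes per: "periodic1 u" and d: "\<And>x. (u has_real_derivative ux x) (at x)"
    and ge: "\<And>x. ux x \<ge> - c * \<bar>u x\<bar>" and "u x0 = 0"
  shows "u x = 0"
proof -
  let ?p = "\<lambda>x. (max 0 (u x))\<^sup>2" and ?m = "\<lambda>x. (max 0 (- u x))\<^sup>2"
  have dp: "(?p has_real_derivative 2 * max 0 (u x) * ux x) (at x)" for x
    by (rule DERIV_chain2[OF max_0_sq_deriv d])
  have dm: "(?m has_real_derivative 2 * max 0 (- u x) * - ux x) (at x)" for x
    by (rule DERIV_chain2[OF max_0_sq_deriv DERIV_minus[OF d]])
  have dep: "((\<lambda>x. exp (2 * c * x) * ?p x) has_real_derivative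
      exp (2 * c * x) * (2 * max 0 (u x) * ux x + 2 * c * ?p x)) (at x)" for x
  proof -
    have "((\<lambda>x. exp (2 * c * x)) has_real_derivative exp (2 * c * x) * (2 * c)) (at x)"
      by (auto intro!: derivative_eq_intros)
    from DERIV_mult[OF this dp] show ?thesis by (simp add: algebra_simps)
  qed
  have dem: "((\<lambda>x. exp (- 2 * c * x) * ?m x) has_real_derivative
      exp (- 2 * c * x) * (2 * max 0 (- u x) * - ux x - 2 * c * ?m x)) (at x)" for x
  proof -
    have "((\<lambda>x. exp (- 2 * c * x)) has_real_derivative exp (- 2 * c * x) * (- 2 * c)) (at x)"
      by (auto intro!: derivative_eq_intros)
    from DERIV_mult[OF this dm] show ?thesis by (simp add: algebra_simps)
  qed
  have np: "0 \<le> 2 * max 0 (u x) * ux x + 2 * c * ?p x" for x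
  proof -
    have "max 0 (u x) * \<bar>u x\<bar> = ?p x" by (cases "u x \<ge> 0") (simp_all add: power2_eq_square)
    then have "2 * max 0 (u x) * (ux x + c * \<bar>u x\<bar>) = 2 * max 0 (u x) * ux x + 2 * c * ?p x" by algebra
    moreover have "0 \<le> 2 * max 0 (u x) * (ux x + c * \<bar>u x\<bar>)" using ge[of x] by (intro mult_nonneg_nonneg) auto
    ultimately show ?thesis by simp
  qed
  have nm: "2 * max 0 (- u x) * - ux x - 2 * c * ?m x \<le> 0" for x
  proof -
    have "max 0 (- u x) * \<bar>u x\<bar> = ?m x" by (cases "u x \<ge> 0") (simp_all add: power2_eq_square)
    then have "2 * max 0 (- u x) * (ux x + c * \<bar>u x\<bar>) = - (2 * max 0 (- u x) * - ux x - 2 * c * ?m x)" by algebra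
    moreover have "0 \<le> 2 * max 0 (- u x) * (ux x + c * \<bar>u x\<bar>)" using ge[of x] by (intro mult_nonneg_nonneg) auto
    ultimately show ?thesis by linarith
  qed
  have left: "u y \<le> 0" if "y \<le> x0" for y
  proof -
    have "exp (2 * c * y) * ?p y \<le> exp (2 * c * x0) * ?p x0"
      by (rule DERIV_nonneg_imp_nondecreasing[OF that])
         (use dep np in \<open>blast intro: mult_nonneg_nonneg exp_ge_zero\<close>)
    then show ?thesis using \<open>u x0 = 0\<close> by (simp add: mult_le_0_iff max_def split: if_splits)
  qed
  have right: "u y \<ge> 0" if "x0 \<le> y" for y
  proof -
    have "exp (- 2 * c * y) * ?m y \<le> exp (- 2 * c * x0) * ?m x0"
      by (rule DERIV_nonpos_imp_nonincreasing[OF that])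
         (use dem nm in \<open>blast intro: mult_nonneg_nonpos exp_ge_zero\<close>)
    then show ?thesis using \<open>u x0 = 0\<close> by (simp add: mult_le_0_iff max_def split: if_splits)
  qed
  have "u (x + of_int n) = u x" for n by (rule periodic1_of_int[OF per])
  moreover have "x + of_int \<lfloor>x0 - x\<rfloor> \<le> x0" "x0 \<le> x + of_int \<lceil>x0 - x\<rceil>" by linarith+
  ultimately show ?thesis using left right by (metis antisym)
qed

section \<open>Solutions of the rod equation\<close>

text \<open>A compact tube around the curve turns continuity into a modulus uniform in time, as the
  convergence of derivatives in \<open>ux_along\<close> requires.\<close>

lemma uniform_near_curve:
  fixes \<phi> :: "real \<Rightarrow> real \<Rightarrow> real"
  assumes \<phi>: "continuous_on ({a..b} \<times> UNIV) (\<lambda>(t, x). \<phi> t x)"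
    and q: "continuous_on {a..b} q" and e: "e > 0"
  obtains \<eta> where "\<eta> > 0" "\<And>t y. t \<in> {a..b} \<Longrightarrow> \<bar>y - q t\<bar> < \<eta> \<Longrightarrow> \<bar>\<phi> t y - \<phi> t (q t)\<bar> < e"
proof -
  obtain M where M: "\<And>t. t \<in> {a..b} \<Longrightarrow> \<bar>q t\<bar> \<le> M"
    using compact_imp_bounded[OF compact_continuous_image[OF q compact_Icc]]
    unfolding bounded_iff by (metis imageI real_norm_def)
  let ?K = "{a..b} \<times> {- (M + 1)..M + 1}"
  have "uniformly_continuous_on ?K (\<lambda>(t, x). \<phi> t x)"
    by (intro compact_uniformly_continuous compact_Times compact_Icc continuous_on_subset[OF \<phi>]) auto
  then obtain d where d: "d > 0" and
    D: "\<And>p p'. p \<in> ?K \<Longrightarrow> p' \<in> ?K \<Longrightarrow> dist p' p < d \<Longrightarrow> dist ((\<lambda>(t, x). \<phi> t x) p') ((\<lambda>(t, x). \<phi> t x) p) < e"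
    using e unfolding uniformly_continuous_on_def by metis
  show thesis
  proof (rule that[of "min 1 d"])
    fix t y assume t: "t \<in> {a..b}" and y: "\<bar>y - q t\<bar> < min 1 d"
    have "(t, q t) \<in> ?K" "(t, y) \<in> ?K" using t y M[OF t] by auto
    moreover have "dist (t, y) (t, q t) < d" using y by (simp add: dist_Pair_Pair dist_real_def)
    ultimately show "\<bar>\<phi> t y - \<phi> t (q t)\<bar> < e" using D[of "(t, q t)" "(t, y)"] by (simp add: dist_real_def)
  qed (use d in auto)
qed

text \<open>Passing to \<open>D^2\<close> avoids the corner of the absolute value. For the gap
  between two characteristics, the first conclusion makes it small and the second allows division by
  it.\<close>

lemma gronwall_abs:
  fixes D :: "real \<Rightarrow> real"
  assumes d: "\<And>s. s \<in> {a..b} \<Longrightarrow> (D has_real_derivative D' s) (at s within {a..b})"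
    and le: "\<And>s. s \<in> {a..b} \<Longrightarrow> \<bar>D' s\<bar> \<le> C * \<bar>D s\<bar>" and t: "t \<in> {a..b}"
  shows "\<bar>D t\<bar> \<le> \<bar>D a\<bar> * exp (C * (t - a))" and "D a \<noteq> 0 \<Longrightarrow> D t \<noteq> 0"
proof -
  have sub: "{a..t} \<subseteq> {a..b}" using t by auto
  have DD': "\<bar>D s * D' s\<bar> \<le> C * (D s)\<^sup>2" if "s \<in> {a..b}" for s
  proof -
    have "\<bar>D s\<bar> * \<bar>D' s\<bar> \<le> \<bar>D s\<bar> * (C * \<bar>D s\<bar>)" by (intro mult_left_mono le that) simp
    also have "\<dots> = C * (\<bar>D s\<bar>)\<^sup>2" by (simp add: power2_eq_square)
    finally show ?thesis by (simp add: abs_mult)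
  qed
  have de: "((\<lambda>s. exp (k * (s - a)) * (D s)\<^sup>2) has_real_derivative
      exp (k * (s - a)) * (k * (D s)\<^sup>2 + 2 * (D s * D' s))) (at s within {a..t})" if "s \<in> {a..t}" for k s
  proof -
    have "((\<lambda>s. exp (k * (s - a))) has_real_derivative exp (k * (s - a)) * k) (at s within {a..t})"
      by (auto intro!: derivative_eq_intros)
    moreover have "((\<lambda>s. (D s)\<^sup>2) has_real_derivative 2 * (D s * D' s)) (at s within {a..t})"
      using DERIV_subset[OF d[of s] sub] that sub by (auto intro!: derivative_eq_intros)
    ultimately show ?thesis by (auto dest: DERIV_mult simp: algebra_simps)
  qed
  have "- (exp (- (2 * C) * (a - a)) * (D a)\<^sup>2) \<le> - (exp (- (2 * C) * (t - a)) * (D t)\<^sup>2)"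
  proof (rule DERIV_within_nonneg_imp_mono[where f = "\<lambda>s. - (exp (- (2 * C) * (s - a)) * (D s)\<^sup>2)"])
    fix s assume s: "s \<in> {a..t}"
    show "((\<lambda>s. - (exp (- (2 * C) * (s - a)) * (D s)\<^sup>2)) has_real_derivative
      - (exp (- (2 * C) * (s - a)) * (- (2 * C) * (D s)\<^sup>2 + 2 * (D s * D' s)))) (at s within {a..t})"
      by (rule DERIV_minus[OF de[OF s]])
    have "- (2 * C) * (D s)\<^sup>2 + 2 * (D s * D' s) \<le> 0" using DD'[of s] s sub by auto
    then show "0 \<le> - (exp (- (2 * C) * (s - a)) * (- (2 * C) * (D s)\<^sup>2 + 2 * (D s * D' s)))"
      by (simp add: mult_nonneg_nonpos del: mult_minus_left)
  qed (use t in auto)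
  then have "exp (- (2 * C) * (t - a)) * (D t)\<^sup>2 \<le> (D a)\<^sup>2" by simp
  then have "exp (2 * C * (t - a)) * (exp (- (2 * C) * (t - a)) * (D t)\<^sup>2) \<le> exp (2 * C * (t - a)) * (D a)\<^sup>2"
    by (rule mult_left_mono) simp
  moreover have "exp (2 * C * (t - a)) * (exp (- (2 * C) * (t - a)) * (D t)\<^sup>2) = (D t)\<^sup>2"
  proof -
    have "exp (2 * C * (t - a)) * exp (- (2 * C) * (t - a)) = 1" by (simp add: exp_minus)
    then show ?thesis by (metis mult.assoc mult_1)
  qed
  moreover have "exp (2 * C * (t - a)) * (D a)\<^sup>2 = (\<bar>D a\<bar> * exp (C * (t - a)))\<^sup>2"
    by (simp add: power_mult_distrib power2_eq_square[of "exp _"] mult_exp_exp algebra_simps)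
  ultimately have "\<bar>D t\<bar>\<^sup>2 \<le> (\<bar>D a\<bar> * exp (C * (t - a)))\<^sup>2" by (simp only: power2_abs)
  then show "\<bar>D t\<bar> \<le> \<bar>D a\<bar> * exp (C * (t - a))" by (rule power2_le_imp_le) simp
  have "exp (2 * C * (a - a)) * (D a)\<^sup>2 \<le> exp (2 * C * (t - a)) * (D t)\<^sup>2"
  proof (rule DERIV_within_nonneg_imp_mono[where f = "\<lambda>s. exp (2 * C * (s - a)) * (D s)\<^sup>2"])
    fix s assume s: "s \<in> {a..t}"
    show "((\<lambda>s. exp (2 * C * (s - a)) * (D s)\<^sup>2) has_real_derivative
      exp (2 * C * (s - a)) * (2 * C * (D s)\<^sup>2 + 2 * (D s * D' s))) (at s within {a..t})"
      by (rule de[OF s])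
    have "0 \<le> 2 * C * (D s)\<^sup>2 + 2 * (D s * D' s)" using DD'[of s] s sub by auto
    then show "0 \<le> exp (2 * C * (s - a)) * (2 * C * (D s)\<^sup>2 + 2 * (D s * D' s))" by simp
  qed (use t in auto)
  then show "D a \<noteq> 0 \<Longrightarrow> D t \<noteq> 0" by auto
qed

lemma mvt_quotient:
  fixes f :: "real \<Rightarrow> real"
  assumes d: "\<And>x. (f has_real_derivative f' x) (at x)" and "x \<noteq> y"
  obtains \<xi> where "\<bar>\<xi> - x\<bar> \<le> \<bar>y - x\<bar>" "(f y - f x) / (y - x) = f' \<xi>"
proof (cases "x < y")
  case True
  then obtain z where "x < z" "z < y" "f y - f x = (y - x) * f' z" using MVT2[of x y f f'] d by blast
  then show ?thesis using True by (intro that[of z]) auto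
next
  case False
  then have "y < x" using assms by simp
  then obtain z where "y < z" "z < x" "f x - f y = (x - y) * f' z" using MVT2[of y x f f'] d by blast
  then show ?thesis using \<open>y < x\<close> by (intro that[of z]) (auto simp: field_simps)
qed

lemma conv01_continuous:
  fixes F :: "real \<Rightarrow> real \<Rightarrow> real"
  assumes F: "continuous_on (S \<times> UNIV) (\<lambda>(t, x). F t x)" and K: "continuous_on UNIV K"
  shows "continuous_on (S \<times> UNIV) (\<lambda>(t, x). conv01 K (F t) x)"
proof -
  have "continuous_on ((S \<times> UNIV) \<times> cbox 0 1) (\<lambda>r. K (snd r) * (\<lambda>(t, x). F t x) (fst (fst r), snd (fst r) - snd r))"
    by (intro continuous_on_mult continuous_on_compose2[OF F] continuous_on_compose2[OF K])
       (auto intro!: continuous_intros)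
  then have "continuous_on ((S \<times> UNIV) \<times> cbox 0 1) (\<lambda>(p, z). K z * F (fst p) (snd p - z))"
    by (simp add: case_prod_unfold)
  from integral_continuous_on_param[OF this] show ?thesis
    by (simp add: conv01_def case_prod_unfold)
qed

text \<open>With \<open>\<alpha> = 3 / \<gamma> - 1\<close> this is the function under the
  convolution, as \<open>(3 - \<gamma>) / 2 = \<gamma> / 2 * \<alpha>\<close>; the factorisation
  exposes the integrand of \<open>rod_I\<close>.\<close>

definition rod_flux :: "real \<Rightarrow> real \<Rightarrow> (real \<Rightarrow> real) \<Rightarrow> (real \<Rightarrow> real) \<Rightarrow> real \<Rightarrow> real" where
  "rod_flux \<gamma> \<alpha> w w' y = \<gamma> / 2 * (\<alpha> * (w y)\<^sup>2 + (w' y)\<^sup>2)"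

section \<open>Classical solutions and their slope along characteristics\<close>

text \<open>The classical content of a Sobolev solution. \<alpha> is an independent parameter, since
  after the reflection \<open>(- u, - \<gamma>)\<close> the flux keeps the old \<alpha>, which is no
  longer \<open>3 / \<gamma> - 1\<close> for the new \<gamma>.\<close>

locale rod_solution =
  fixes \<gamma> \<alpha> :: real and u ux v :: "real \<Rightarrow> real \<Rightarrow> real"
  assumes per: "t \<ge> 0 \<Longrightarrow> periodic1 (u t)"
    and dx: "t \<ge> 0 \<Longrightarrow> (u t has_real_derivative ux t x) (at x)"
    and cu: "continuous_on ({0..} \<times> UNIV) (\<lambda>(t, x). u t x)"
    and cux: "continuous_on ({0..} \<times> UNIV) (\<lambda>(t, x). ux t x)"
    and dt: "t \<ge> 0 \<Longrightarrow> uniform_limit UNIV (\<lambda>\<tau> x. (u \<tau> x - u t x) / (\<tau> - t)) (v t) (at t within {0..})"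
    and eq: "t \<ge> 0 \<Longrightarrow> v t x = - \<gamma> * u t x * ux t x - conv01 sinh_kernel (rod_flux \<gamma> \<alpha> (u t) (ux t)) x"
begin

abbreviation F :: "real \<Rightarrow> real \<Rightarrow> real" where "F t \<equiv> rod_flux \<gamma> \<alpha> (u t) (ux t)"

lemma per_ux: "t \<ge> 0 \<Longrightarrow> periodic1 (ux t)"
  by (rule periodic1_derivative[OF per dx])

lemma continuous_on_slice:
  assumes "continuous_on ({0..} \<times> UNIV) (\<lambda>(t, x). f t x)" "0 \<le> (t::real)"
  shows "continuous_on S (f t :: real \<Rightarrow> real)"
proof -
  have "continuous_on S (\<lambda>x. (\<lambda>(t, x). f t x) (t, x))"
    by (rule continuous_on_compose2[OF assms(1)]) (use assms in \<open>auto intro!: continuous_intros\<close>)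
  then show ?thesis by simp
qed

lemmas cut = continuous_on_slice[OF cu] and cuxt = continuous_on_slice[OF cux]

lemma cF: "continuous_on ({0..} \<times> UNIV) (\<lambda>(t, x). F t x)"
proof -
  have "continuous_on ({0..} \<times> UNIV) (\<lambda>p. u (fst p) (snd p))"
    "continuous_on ({0..} \<times> UNIV) (\<lambda>p. ux (fst p) (snd p))"
    using cu cux by (simp_all add: case_prod_unfold)
  then show ?thesis unfolding rod_flux_def case_prod_unfold by (intro continuous_intros)
qed

lemmas cFt = continuous_on_slice[OF cF]

lemma perF: "t \<ge> 0 \<Longrightarrow> periodic1 (F t)"
  using per per_ux by (simp add: periodic1_def rod_flux_def)

lemma conv_deriv:
  assumes "t \<ge> 0"
  shows "(conv01 sinh_kernel (F t) has_real_derivative conv01 cosh_kernel (F t) x - F t x) (at x)"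
    and "(conv01 cosh_kernel (F t) has_real_derivative conv01 sinh_kernel (F t) x) (at x)"
  by (rule conv01_kernel_deriv[OF cFt[OF assms] perF[OF assms]])+

lemma cvt:
  assumes "t \<ge> 0" shows "continuous_on UNIV (v t)"
proof -
  have "continuous_on UNIV (conv01 sinh_kernel (F t))"
    by (rule DERIV_continuous_on) (rule conv_deriv(1)[OF assms])
  then have "continuous_on UNIV (\<lambda>x. - \<gamma> * u t x * ux t x - conv01 sinh_kernel (F t) x)"
    by (intro continuous_intros cut cuxt assms)
  then show ?thesis using eq[OF assms] by (simp cong: continuous_on_cong)
qed

text \<open>The time quotient is taken at the moving point \<open>q s\<close>, where a pointwise
  limit would not control it; hence the uniform limit in \<open>dt\<close>, combined with continuity
  of \<open>v t\<close>.\<close>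

lemma deriv_along:
  assumes t: "t \<in> S" "S \<subseteq> {0..}" and q: "(q has_real_derivative q') (at t within S)"
  shows "((\<lambda>s. u s (q s)) has_real_derivative v t (q t) + ux t (q t) * q') (at t within S)"
proof -
  let ?W = "at t within S"
  have t0: "t \<ge> 0" using t by auto
  have qc: "(q \<longlongrightarrow> q t) ?W" using has_field_derivative_imp_has_derivative[OF q]
    by (auto dest: has_derivative_continuous simp: continuous_within)
  have "((\<lambda>s. u t (q s)) has_real_derivative ux t (q t) * q') ?W"
    by (rule DERIV_chain2[OF dx[OF t0] q])
  then have 2: "((\<lambda>s. (u t (q s) - u t (q t)) / (s - t)) \<longlongrightarrow> ux t (q t) * q') ?W"
    by (simp add: has_field_derivative_iff)
  have "isCont (v t) (q t)" using cvt[OF t0] by (simp add: continuous_on_eq_continuous_at)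
  then have vc: "((\<lambda>s. v t (q s)) \<longlongrightarrow> v t (q t)) ?W" using qc by (rule isCont_tendsto_compose)
  have "((\<lambda>s. (u s (q s) - u t (q s)) / (s - t) - v t (q s)) \<longlongrightarrow> 0) ?W"
  proof (rule tendstoI)
    fix e :: real assume "e > 0"
    from uniform_limitD[OF dt[OF t0] this]
    have "\<forall>\<^sub>F s in ?W. \<forall>x\<in>UNIV. dist ((u s x - u t x) / (s - t)) (v t x) < e"
      by (rule filter_leD[OF at_le[OF t(2)]])
    then show "\<forall>\<^sub>F s in ?W. dist ((u s (q s) - u t (q s)) / (s - t) - v t (q s)) 0 < e"
      by eventually_elim (auto simp: dist_real_def)
  qed
  from tendsto_add[OF tendsto_add[OF this vc] 2]
  have "((\<lambda>s. (u s (q s) - u t (q s)) / (s - t) + (u t (q s) - u t (q t)) / (s - t)) \<longlongrightarrow> v t (q t) + ux t (q t) * q') ?W"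
    by simp
  then show ?thesis
    by (simp add: has_field_derivative_iff flip: add_divide_distrib)
qed

lemma ux_bound:
  assumes "0 \<le> a"
  obtains B where "B \<ge> 0" "\<And>t x. t \<in> {a..b} \<Longrightarrow> \<bar>ux t x\<bar> \<le> B"
proof -
  have "compact ((\<lambda>(t, x). ux t x) ` ({a..b} \<times> {0..1}))"
    by (intro compact_continuous_image compact_Times compact_Icc continuous_on_subset[OF cux])
       (use assms in auto)
  from compact_imp_bounded[OF this]
  obtain B where "\<forall>y \<in> (\<lambda>(t, x). ux t x) ` ({a..b} \<times> {0..1}). norm y \<le> B"
    unfolding bounded_iff by blast
  then have B: "\<bar>ux t x\<bar> \<le> B" if "t \<in> {a..b}" "x \<in> {0..1}" for t x
    using that by force
  show thesis
  proof (rule that[of "max B 0"])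
    fix t x assume t: "t \<in> {a..b}"
    have "ux t x = ux t (frac x)"
      using periodic1_of_int[OF per_ux, of t "frac x" "\<lfloor>x\<rfloor>"] t assms by (simp add: frac_def)
    moreover have "\<bar>ux t (frac x)\<bar> \<le> B" using B[of t "frac x"] t by (simp add: frac_lt_1 less_imp_le)
    ultimately show "\<bar>ux t x\<bar> \<le> max B 0" by simp
  qed simp
qed

lemma u_lipschitz:
  assumes "0 \<le> a"
  obtains B where "B \<ge> 0" "\<And>t x y. t \<in> {a..b} \<Longrightarrow> \<bar>u t x - u t y\<bar> \<le> B * \<bar>x - y\<bar>"
proof -
  obtain B where B: "B \<ge> 0" "\<And>t x. t \<in> {a..b} \<Longrightarrow> \<bar>ux t x\<bar> \<le> B" using ux_bound[OF assms] by blast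
  show thesis
  proof (rule that[OF B(1)])
    fix t x y assume t: "t \<in> {a..b}"
    show "\<bar>u t x - u t y\<bar> \<le> B * \<bar>x - y\<bar>"
      using field_differentiable_bound[of UNIV "u t" "ux t" B x y] dx[of t] B(2)[OF t] t assms by simp
  qed
qed

lemma characteristic_exists:
  assumes "0 \<le> a" "a \<le> b"
  obtains q where "q a = x0" "\<And>t. t \<in> {a..b} \<Longrightarrow> (q has_real_derivative \<gamma> * u t (q t)) (at t within {a..b})"
proof -
  obtain B where B: "B \<ge> 0" "\<And>t x y. t \<in> {a..b} \<Longrightarrow> \<bar>u t x - u t y\<bar> \<le> B * \<bar>x - y\<bar>"
    using u_lipschitz[OF assms(1)] by blast
  have "continuous_on ({a..b} \<times> UNIV) (\<lambda>(t, x). \<gamma> * u t x)"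
  proof -
    have "{a..b} \<times> UNIV \<subseteq> {0..} \<times> (UNIV :: real set)" using assms by auto
    from continuous_on_subset[OF cu this] show ?thesis
      unfolding case_prod_unfold by (intro continuous_intros)
  qed
  moreover have "\<bar>\<gamma> * u t x - \<gamma> * u t y\<bar> \<le> (\<bar>\<gamma>\<bar> * B) * \<bar>x - y\<bar>" if "t \<in> {a..b}" for t x y
    using mult_left_mono[OF B(2)[OF that, of x y], of "\<bar>\<gamma>\<bar>"]
    by (simp add: abs_mult mult.assoc flip: right_diff_distrib)
  ultimately show thesis using ode_exists[OF assms(2), of "\<lambda>t x. \<gamma> * u t x"] that by blast
qed

text \<open>\<open>u\<^sub>x\<close> need not be differentiable, neither in time nor in space.  Along a characteristic it is
  the uniform limit of difference quotients of \<open>u\<close> between two neighbouring characteristics, and the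
  time derivatives of these quotients converge uniformly because \<open>conv01 sinh_kernel (F t)\<close> is
  \<open>C\<^sup>1\<close> in space.\<close>

lemma ux_along:
  assumes a: "0 \<le> a" "a \<le> b"
    and q: "\<And>t. t \<in> {a..b} \<Longrightarrow> (q has_real_derivative \<gamma> * u t (q t)) (at t within {a..b})"
    and t: "t \<in> {a..b}"
  shows "((\<lambda>t. ux t (q t)) has_real_derivative
    F t (q t) - conv01 cosh_kernel (F t) (q t) - \<gamma> * (ux t (q t))\<^sup>2) (at t within {a..b})"
proof -
  let ?I = "{a..b}"
  let ?H = "\<lambda>t x. conv01 cosh_kernel (F t) x - F t x"
  have I0: "t \<ge> 0" if "t \<in> ?I" for t using that a by simp
  have qc: "continuous_on ?I q" by (rule DERIV_continuous_on[OF q])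
  obtain B where B: "B \<ge> 0" "\<And>t x y. t \<in> ?I \<Longrightarrow> \<bar>u t x - u t y\<bar> \<le> B * \<bar>x - y\<bar>"
    using u_lipschitz[OF a(1)] by blast
  define h where "h = (\<lambda>n. inverse (real (Suc n)))"
  have "\<exists>p. p a = q a + h n \<and> (\<forall>t\<in>?I. (p has_real_derivative \<gamma> * u t (p t)) (at t within ?I))" for n
    using characteristic_exists[OF a, of "q a + h n"] by metis
  then obtain p where p0: "\<And>n. p n a = q a + h n"
    and p: "\<And>n t. t \<in> ?I \<Longrightarrow> (p n has_real_derivative \<gamma> * u t (p n t)) (at t within ?I)"
    by metis
  define D where "D = (\<lambda>n t. p n t - q t)"
  have dD: "(D n has_real_derivative \<gamma> * (u t (p n t) - u t (q t))) (at t within ?I)" if "t \<in> ?I" for n t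
    unfolding D_def using DERIV_diff[OF p[OF that] q[OF that]] by (simp add: right_diff_distrib)
  have leD: "\<bar>\<gamma> * (u t (p n t) - u t (q t))\<bar> \<le> (\<bar>\<gamma>\<bar> * B) * \<bar>D n t\<bar>" if "t \<in> ?I" for n t
    using mult_left_mono[OF B(2)[OF that, of "p n t" "q t"], of "\<bar>\<gamma>\<bar>"] by (simp add: abs_mult D_def mult.assoc)
  have Da: "D n a = h n" for n by (simp add: D_def p0)
  have hpos: "h n > 0" for n by (simp add: h_def)
  have D0: "D n t \<noteq> 0" if "t \<in> ?I" for n t
    by (rule gronwall_abs(2)[OF dD leD that]) (use Da hpos[of n] in auto)
  define c where "c = exp (\<bar>\<gamma>\<bar> * B * (b - a))"
  have Dle: "\<bar>D n t\<bar> \<le> h n * c" if "t \<in> ?I" for n t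
  proof -
    have "\<bar>D n t\<bar> \<le> \<bar>D n a\<bar> * exp (\<bar>\<gamma>\<bar> * B * (t - a))" by (rule gronwall_abs(1)[OF dD leD that])
    also have "\<dots> \<le> \<bar>D n a\<bar> * c"
      using that B(1) unfolding c_def by (intro mult_left_mono) (auto intro!: mult_left_mono)
    finally show ?thesis using Da hpos[of n] by simp
  qed
  have hc: "(\<lambda>n. h n * c) \<longlonglongrightarrow> 0"
    unfolding h_def using tendsto_mult[OF LIMSEQ_inverse_real_of_nat tendsto_const[of c]] by simp
  define R where "R = (\<lambda>n t. (u t (p n t) - u t (q t)) / D n t)"
  \<comment> \<open>Along a characteristic \<open>u\<close> has minus the sinh convolution as
    derivative, and the gap \<open>D\<close> has derivative \<open>\<gamma> * R * D\<close>. The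
    quotient rule then gives an expression free of derivatives of \<open>ux\<close>.\<close>
  let ?R' = "\<lambda>n t. - ((conv01 sinh_kernel (F t) (p n t) - conv01 sinh_kernel (F t) (q t)) / D n t) - \<gamma> * (R n t)\<^sup>2"
  have dR: "(R n has_real_derivative ?R' n t) (at t within ?I)" if tI: "t \<in> ?I" for n t
  proof -
    have "((\<lambda>s. u s (r s)) has_real_derivative - conv01 sinh_kernel (F t) (r t)) (at t within ?I)"
      if "(r has_real_derivative \<gamma> * u t (r t)) (at t within ?I)" for r
      using deriv_along[OF tI _ that] a eq[OF I0[OF tI], of "r t"] by (auto simp: mult_ac)
    from DERIV_divide[OF DERIV_diff[OF this[OF p[OF tI]] this[OF q[OF tI]]] dD[OF tI] D0[OF tI], of n n]
    show ?thesis
      unfolding R_def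
      by (rule DERIV_cong) (use D0[OF tI, of n] in \<open>simp add: field_simps power2_eq_square\<close>)
  qed
  have Rmvt: "\<exists>\<xi>. \<bar>\<xi> - q t\<bar> \<le> h n * c \<and> R n t = ux t \<xi>" if "t \<in> ?I" for n t
  proof -
    have "q t \<noteq> p n t" using D0[OF that, of n] by (simp add: D_def)
    from mvt_quotient[OF dx[OF I0[OF that]] this]
    obtain \<xi> where "\<bar>\<xi> - q t\<bar> \<le> \<bar>p n t - q t\<bar>" "(u t (p n t) - u t (q t)) / (p n t - q t) = ux t \<xi>" by blast
    moreover from this(1) have "\<bar>\<xi> - q t\<bar> \<le> h n * c" using Dle[OF that, of n] by (simp add: D_def)
    ultimately show ?thesis by (auto simp: R_def D_def)
  qed
  have Gmvt: "\<exists>\<xi>. \<bar>\<xi> - q t\<bar> \<le> h n * c \<and>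
     (conv01 sinh_kernel (F t) (p n t) - conv01 sinh_kernel (F t) (q t)) / D n t = ?H t \<xi>" if "t \<in> ?I" for n t
  proof -
    have "q t \<noteq> p n t" using D0[OF that, of n] by (simp add: D_def)
    from mvt_quotient[OF conv_deriv(1)[OF I0[OF that]] this]
    obtain \<xi> where "\<bar>\<xi> - q t\<bar> \<le> \<bar>p n t - q t\<bar>"
      "(conv01 sinh_kernel (F t) (p n t) - conv01 sinh_kernel (F t) (q t)) / (p n t - q t) = ?H t \<xi>" by blast
    moreover from this(1) have "\<bar>\<xi> - q t\<bar> \<le> h n * c" using Dle[OF that, of n] by (simp add: D_def)
    ultimately show ?thesis by (auto simp: D_def)
  qed
  have sub: "?I \<times> UNIV \<subseteq> {0..} \<times> UNIV" using a by auto
  have Rlim: "(\<lambda>n. R n t) \<longlonglongrightarrow> ux t (q t)" if tI: "t \<in> ?I" for t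
  proof (rule tendstoI)
    fix e :: real assume "e > 0"
    then obtain \<eta> where \<eta>: "\<eta> > 0" "\<And>t y. t \<in> ?I \<Longrightarrow> \<bar>y - q t\<bar> < \<eta> \<Longrightarrow> \<bar>ux t y - ux t (q t)\<bar> < e"
      using uniform_near_curve[OF continuous_on_subset[OF cux sub] qc] by blast
    have "\<forall>\<^sub>F n in sequentially. h n * c < \<eta>" by (rule order_tendstoD(2)[OF hc \<eta>(1)])
    then show "\<forall>\<^sub>F n in sequentially. dist (R n t) (ux t (q t)) < e"
    proof eventually_elim
      case (elim n)
      obtain \<xi> where "\<bar>\<xi> - q t\<bar> \<le> h n * c" "R n t = ux t \<xi>" using Rmvt[OF tI] by blast
      then show ?case using \<eta>(2)[OF tI, of \<xi>] elim by (simp add: dist_real_def)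
    qed
  qed
  let ?g' = "\<lambda>t. F t (q t) - conv01 cosh_kernel (F t) (q t) - \<gamma> * (ux t (q t))\<^sup>2"
  have R'lim: "\<forall>\<^sub>F n in sequentially. \<forall>t\<in>?I. \<forall>k. norm (?R' n t * k - ?g' t * k) \<le> e * norm k"
    if e: "e > 0" for e
  proof -
    have c1: "continuous_on ({0..} \<times> UNIV) (\<lambda>(t, x). ?H t x)"
      using conv01_continuous[OF cF, of cosh_kernel] cF
      by (auto simp: case_prod_unfold intro!: continuous_intros)
    have c2: "continuous_on ({0..} \<times> UNIV) (\<lambda>(t, x). \<gamma> * (ux t x)\<^sup>2)"
      using cux by (auto simp: case_prod_unfold intro!: continuous_intros)
    obtain \<eta>1 where \<eta>1: "\<eta>1 > 0" "\<And>t y. t \<in> ?I \<Longrightarrow> \<bar>y - q t\<bar> < \<eta>1 \<Longrightarrow> \<bar>?H t y - ?H t (q t)\<bar> < e / 2"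
      using uniform_near_curve[OF continuous_on_subset[OF c1 sub] qc, of "e / 2"] e by auto
    obtain \<eta>2 where \<eta>2: "\<eta>2 > 0" "\<And>t y. t \<in> ?I \<Longrightarrow> \<bar>y - q t\<bar> < \<eta>2 \<Longrightarrow> \<bar>\<gamma> * (ux t y)\<^sup>2 - \<gamma> * (ux t (q t))\<^sup>2\<bar> < e / 2"
      using uniform_near_curve[OF continuous_on_subset[OF c2 sub] qc, of "e / 2"] e by auto
    have "\<forall>\<^sub>F n in sequentially. h n * c < min \<eta>1 \<eta>2"
      by (rule order_tendstoD(2)[OF hc]) (use \<eta>1 \<eta>2 in auto)
    then show ?thesis
    proof eventually_elim
      case (elim n)
      show ?case
      proof (intro ballI allI)
        fix t k assume tI: "t \<in> ?I"
        obtain \<xi> where \<xi>: "\<bar>\<xi> - q t\<bar> \<le> h n * c" "R n t = ux t \<xi>" using Rmvt[OF tI] by blast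
        obtain \<zeta> where \<zeta>: "\<bar>\<zeta> - q t\<bar> \<le> h n * c"
          "(conv01 sinh_kernel (F t) (p n t) - conv01 sinh_kernel (F t) (q t)) / D n t = ?H t \<zeta>"
          using Gmvt[OF tI] by blast
        have "\<bar>?H t \<zeta> - ?H t (q t)\<bar> < e / 2" using \<eta>1(2)[OF tI, of \<zeta>] \<zeta>(1) elim by simp
        moreover have "\<bar>\<gamma> * (ux t \<xi>)\<^sup>2 - \<gamma> * (ux t (q t))\<^sup>2\<bar> < e / 2" using \<eta>2(2)[OF tI, of \<xi>] \<xi>(1) elim by simp
        ultimately have "\<bar>?R' n t - ?g' t\<bar> \<le> e" unfolding \<zeta>(2) \<xi>(2) by linarith
        then show "norm (?R' n t * k - ?g' t * k) \<le> e * norm k"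
          by (simp add: abs_mult mult_right_mono flip: left_diff_distrib)
      qed
    qed
  qed
  have "\<exists>g. \<forall>t\<in>?I. (\<lambda>n. R n t) \<longlonglongrightarrow> g t \<and> (g has_derivative (\<lambda>k. ?g' t * k)) (at t within ?I)"
    by (rule has_derivative_sequence[where f = R and f' = "\<lambda>n t k. ?R' n t * k" and S = ?I, OF _ _ _ t Rlim[OF t]])
       (use dR R'lim in \<open>simp_all add: has_field_derivative_def\<close>)
  then obtain g where g: "\<And>t. t \<in> ?I \<Longrightarrow> (\<lambda>n. R n t) \<longlonglongrightarrow> g t"
     "(g has_derivative (\<lambda>k. ?g' t * k)) (at t within ?I)" using t by blast
  have "g s = ux s (q s)" if "s \<in> ?I" for s
    using LIMSEQ_unique[OF g(1)[OF that] Rlim[OF that]] .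
  then show ?thesis
    using has_derivative_transform[OF t _ g(2), of "\<lambda>t. ux t (q t)"] by (simp add: has_field_derivative_def)
qed

text \<open>Both parts apply the variational inequality to one period of \<open>u t\<close> with end
  values \<open>u t x\<close>: to \<open>u t (x - z)\<close> for the weight with plus sign, and to
  the same period traversed in the opposite direction for the weight with minus sign, which is
  \<open>rod_weight (1 - z)\<close>.\<close>

lemma rod_coercive_along:
  assumes \<alpha>: "rod_coercive \<alpha>" and t: "t \<ge> 0" and \<gamma>: "\<gamma> > 0"
  shows "\<gamma> / 2 * ((\<alpha> - rod_beta\<^sup>2) * (u t x)\<^sup>2) \<le> conv01 cosh_kernel (F t) x + rod_beta * conv01 sinh_kernel (F t) x"
    and "\<gamma> / 2 * ((\<alpha> - rod_beta\<^sup>2) * (u t x)\<^sup>2) \<le> conv01 cosh_kernel (F t) x - rod_beta * conv01 sinh_kernel (F t) x"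
proof -
  have lin: "conv01 cosh_kernel (F t) x + c * conv01 sinh_kernel (F t) x =
     conv01 (\<lambda>z. cosh_kernel z + c * sinh_kernel z) (F t) x" for c
    using conv01_add[OF continuous_on_kernels(1,2) cFt[OF t], of 1 c x] by simp
  have per': "u t (x - 1) = u t x" using per[OF t] by (metis periodic1_def diff_add_cancel)
  have "(\<alpha> - rod_beta\<^sup>2) * (u t x)\<^sup>2 \<le>
      integral {0..1} (\<lambda>z. rod_weight z * (\<alpha> * (u t (x - z))\<^sup>2 + (- ux t (x - z))\<^sup>2))"
  proof (rule rod_coercive_C1[OF \<alpha>])
    show "((\<lambda>z. u t (x - z)) has_real_derivative - ux t (x - z)) (at z within {0..1})" for z
    proof -
      have "((\<lambda>z. x - z) has_real_derivative - 1) (at z within {0..1})"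
        by (auto intro!: derivative_eq_intros)
      from DERIV_chain2[OF dx[OF t] this] show ?thesis by simp
    qed
    show "continuous_on {0..1} (\<lambda>z. - ux t (x - z))"
      by (intro continuous_intros continuous_on_compose2[OF cuxt[OF t, of UNIV]]) auto
  qed (use per' in auto)
  then have "\<gamma> / 2 * ((\<alpha> - rod_beta\<^sup>2) * (u t x)\<^sup>2) \<le>
      \<gamma> / 2 * integral {0..1} (\<lambda>z. rod_weight z * (\<alpha> * (u t (x - z))\<^sup>2 + (- ux t (x - z))\<^sup>2))"
    using \<gamma> by (intro mult_left_mono) auto
  also have "\<dots> = conv01 rod_weight (F t) x"
    unfolding conv01_def integral_mult_right[symmetric] by (simp add: rod_flux_def mult_ac)
  also have "\<dots> = conv01 cosh_kernel (F t) x + rod_beta * conv01 sinh_kernel (F t) x"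
    unfolding lin rod_weight_eq by simp
  finally show "\<gamma> / 2 * ((\<alpha> - rod_beta\<^sup>2) * (u t x)\<^sup>2) \<le> conv01 cosh_kernel (F t) x + rod_beta * conv01 sinh_kernel (F t) x" .
  have "(\<alpha> - rod_beta\<^sup>2) * (u t x)\<^sup>2 \<le>
      integral {0..1} (\<lambda>z. rod_weight z * (\<alpha> * (u t (x - 1 + z))\<^sup>2 + (ux t (x - 1 + z))\<^sup>2))"
  proof (rule rod_coercive_C1[OF \<alpha>])
    show "((\<lambda>z. u t (x - 1 + z)) has_real_derivative ux t (x - 1 + z)) (at z within {0..1})" for z
    proof -
      have "((\<lambda>z. x - 1 + z) has_real_derivative 1) (at z within {0..1})"
        by (auto intro!: derivative_eq_intros)
      from DERIV_chain2[OF dx[OF t] this] show ?thesis by simp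
    qed
    show "continuous_on {0..1} (\<lambda>z. ux t (x - 1 + z))"
      by (intro continuous_intros continuous_on_compose2[OF cuxt[OF t, of UNIV]]) auto
  qed (use per' in auto)
  then have "\<gamma> / 2 * ((\<alpha> - rod_beta\<^sup>2) * (u t x)\<^sup>2) \<le>
      \<gamma> / 2 * integral {0..1} (\<lambda>z. rod_weight z * (\<alpha> * (u t (x - 1 + z))\<^sup>2 + (ux t (x - 1 + z))\<^sup>2))"
    using \<gamma> by (intro mult_left_mono) auto
  also have "\<dots> = integral {0..1} (\<lambda>z. rod_weight (1 - (1 - z)) * F t (x - (1 - z)))"
  proof -
    have "x - (1 - z) = x - 1 + z" "1 - (1 - z) = z" for z :: real by simp_all
    then show ?thesis unfolding integral_mult_right[symmetric] rod_flux_def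
      by (simp only: mult.left_commute)
  qed
  also have "\<dots> = integral {1 - 1..1 - 0} (\<lambda>z. rod_weight (1 - z) * F t (x - z))"
    by (rule integral_reflect_at)
  also have "\<dots> = conv01 cosh_kernel (F t) x + (- rod_beta) * conv01 sinh_kernel (F t) x"
    unfolding lin by (simp add: conv01_def flip: rod_weight_reflect)
  finally show "\<gamma> / 2 * ((\<alpha> - rod_beta\<^sup>2) * (u t x)\<^sup>2) \<le> conv01 cosh_kernel (F t) x - rod_beta * conv01 sinh_kernel (F t) x"
    by simp
qed

lemma slope_bound:
  assumes \<alpha>: "rod_coercive \<alpha>" and \<gamma>: "\<gamma> > 0" and t: "t \<ge> 0"
  shows "- rod_beta * \<bar>u t x\<bar> \<le> ux t x"
proof (rule ccontr)
  assume "\<not> ?thesis"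
  moreover have "rod_beta * u t x \<le> rod_beta * \<bar>u t x\<bar>" "rod_beta * - u t x \<le> rod_beta * \<bar>u t x\<bar>"
    using rod_beta_ge_2 by (intro mult_left_mono; simp)+
  ultimately have neg: "rod_beta * u t x - ux t x > 0" "- rod_beta * u t x - ux t x > 0" by auto
  define a0 b0 where "a0 = rod_beta * u t x - ux t x" and "b0 = - rod_beta * u t x - ux t x"
  have ab0: "a0 > 0" "b0 > 0" using neg by (simp_all add: a0_def b0_def)
  \<comment> \<open>This makes \<open>2 * (\<gamma> / 2) * (T - t)\<close> equal to the bound of
    \<open>riccati_blowup\<close>, against its strict inequality. A global solution is available up
    to \<open>T\<close>.\<close>
  define T where "T = t + (1 / a0 + 1 / b0) / \<gamma>"
  have tT: "t \<le> T" using ab0 \<gamma> by (simp add: T_def)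
  obtain q where q0: "q t = x"
    and q: "\<And>s. s \<in> {t..T} \<Longrightarrow> (q has_real_derivative \<gamma> * u s (q s)) (at s within {t..T})"
    using characteristic_exists[OF t tT] by blast
  let ?P = "\<lambda>s. conv01 cosh_kernel (F s) (q s)" and ?G = "\<lambda>s. conv01 sinh_kernel (F s) (q s)"
  let ?U = "\<lambda>s. u s (q s)" and ?L = "\<lambda>s. ux s (q s)"
  have dU: "(?U has_real_derivative - ?G s) (at s within {t..T})" if "s \<in> {t..T}" for s
    using deriv_along[OF that _ q[OF that]] t that eq[of s "q s"] by (auto simp: mult_ac)
  have dL: "(?L has_real_derivative F s (q s) - ?P s - \<gamma> * (?L s)\<^sup>2) (at s within {t..T})" if "s \<in> {t..T}" for s
    by (rule ux_along[OF t tT q that])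
  \<comment> \<open>\<open>c = rod_beta\<close> gives the first Riccati function and
    \<open>c = - rod_beta\<close> the second. The flux cancels half of the term
    \<open>\<gamma> * ux^2\<close>.\<close>
  have db: "((\<lambda>s. c * ?U s - ?L s) has_real_derivative
     ?P s - c * ?G s + \<gamma> / 2 * ((?L s)\<^sup>2 - \<alpha> * (?U s)\<^sup>2)) (at s within {t..T})" if "s \<in> {t..T}" for s c
    using DERIV_diff[OF DERIV_cmult[OF dU[OF that], of c] dL[OF that]]
    by (rule DERIV_cong) (simp add: rod_flux_def field_simps)
  have "2 * (\<gamma> / 2) * (T - t) < 1 / (rod_beta * ?U t - ?L t) + 1 / (- rod_beta * ?U t - ?L t)"
  proof (rule riccati_blowup[OF tT _ db db])
    fix s assume s: "s \<in> {t..T}"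
    then have s0: "s \<ge> 0" using t by simp
    have gen: "k * (b * U - L) * (- b * U - L) = k * ((a - b\<^sup>2) * U\<^sup>2) + k * (L\<^sup>2 - a * U\<^sup>2)" for k b U L a :: real
      by (simp add: algebra_simps power2_eq_square)
    \<comment> \<open>The term \<open>\<alpha> * U^2\<close> is added to and subtracted from
      \<open>L^2 - rod_beta^2 * U^2\<close>: coercivity bounds the first summand by the
      convolutions, and the second already stands in the derivative.\<close>
    have id: "\<gamma> / 2 * (rod_beta * ?U s - ?L s) * (- rod_beta * ?U s - ?L s) =
      \<gamma> / 2 * ((\<alpha> - rod_beta\<^sup>2) * (?U s)\<^sup>2) + \<gamma> / 2 * ((?L s)\<^sup>2 - \<alpha> * (?U s)\<^sup>2)"
      by (rule gen)
    show "\<gamma> / 2 * (rod_beta * ?U s - ?L s) * (- rod_beta * ?U s - ?L s) \<le>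
       ?P s - rod_beta * ?G s + \<gamma> / 2 * ((?L s)\<^sup>2 - \<alpha> * (?U s)\<^sup>2)"
      unfolding id using rod_coercive_along(2)[OF \<alpha> s0 \<gamma>] by simp
    show "\<gamma> / 2 * (rod_beta * ?U s - ?L s) * (- rod_beta * ?U s - ?L s) \<le>
       ?P s - (- rod_beta) * ?G s + \<gamma> / 2 * ((?L s)\<^sup>2 - \<alpha> * (?U s)\<^sup>2)"
      unfolding id using rod_coercive_along(1)[OF \<alpha> s0 \<gamma>] by simp
  qed (use neg q0 \<gamma> in auto)
  then show False using \<gamma> q0 by (simp add: T_def a0_def b0_def)
qed

section \<open>Conservation of the mean and triviality of classical solutions\<close>

text \<open>\<open>v t\<close> is the space derivative of a periodic function,
  \<open>- \<gamma> / 2 * u^2\<close> minus the cosh convolution, so it has mean zero; uniform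
  convergence takes the time derivative through the integral.\<close>

lemma mean_deriv:
  assumes t: "t \<ge> 0"
  shows "((\<lambda>t. integral {0..1} (u t)) has_real_derivative 0) (at t within {0..})"
proof -
  have int_v: "integral {0..1} (v t) = 0"
  proof -
    let ?A = "\<lambda>x. - \<gamma> / 2 * (u t x)\<^sup>2 - conv01 cosh_kernel (F t) x"
    have "(v t has_integral (?A 1 - ?A 0)) {0..1}"
    proof (rule fundamental_theorem_of_calculus)
      fix x
      have "((\<lambda>x. (u t x)\<^sup>2) has_real_derivative 2 * (u t x * ux t x)) (at x)"
        using dx[OF t] by (auto intro!: derivative_eq_intros)
      from DERIV_diff[OF DERIV_cmult[OF this, of "- \<gamma> / 2"] conv_deriv(2)[OF t]]
      have "(?A has_real_derivative v t x) (at x)" by (simp add: eq[OF t] mult_ac)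
      then show "(?A has_vector_derivative v t x) (at x within {0..1})"
        by (simp add: has_real_derivative_iff_has_vector_derivative has_vector_derivative_at_within)
    qed simp
    moreover have "?A 1 = ?A 0"
      using conv01_periodic[OF perF[OF t], of cosh_kernel 0 1] periodic1_of_int[OF per[OF t], of 0 1] by simp
    ultimately show ?thesis by (simp add: integral_unique)
  qed
  have "((\<lambda>s. (integral {0..1} (u s) - integral {0..1} (u t)) / (s - t)) \<longlongrightarrow> 0) (at t within {0..})"
  proof (rule tendstoI)
    fix e :: real assume e: "e > 0"
    have "\<forall>\<^sub>F s in at t within {0..}. \<forall>x\<in>UNIV. dist ((u s x - u t x) / (s - t)) (v t x) < e / 2"
      by (rule uniform_limitD[OF dt[OF t]]) (use e in simp)
    moreover have "\<forall>\<^sub>F s in at t within {0..}. s \<in> {0..}" by (simp add: eventually_at_filter)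
    ultimately show "\<forall>\<^sub>F s in at t within {0..}. dist ((integral {0..1} (u s) - integral {0..1} (u t)) / (s - t)) 0 < e"
    proof eventually_elim
      case (elim s)
      have s: "s \<ge> 0" using elim by simp
      have i: "(\<lambda>x. (u s x - u t x) / (s - t)) integrable_on {0..1}" "v t integrable_on {0..1}"
        using cut[OF s, of "{0..1}"] cut[OF t, of "{0..1}"] continuous_on_subset[OF cvt[OF t]]
        by (auto intro!: integrable_continuous_interval continuous_intros simp: divide_inverse)
      have "integral {0..1} (\<lambda>x. u s x - u t x) = integral {0..1} (u s) - integral {0..1} (u t)"
        by (intro integral_diff integrable_continuous_interval cut s t)
      then have "integral {0..1} (\<lambda>x. (u s x - u t x) / (s - t)) = (integral {0..1} (u s) - integral {0..1} (u t)) / (s - t)"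
        by (simp only: integral_divide)
      then have "\<bar>(integral {0..1} (u s) - integral {0..1} (u t)) / (s - t)\<bar>
          = norm (integral {0..1} (\<lambda>x. (u s x - u t x) / (s - t) - v t x))"
        by (simp only: integral_diff[OF i] int_v diff_0_right real_norm_def)
      also have "\<dots> \<le> integral {0..1} (\<lambda>x::real. e / 2)"
        by (rule integral_norm_bound_integral)
           (use elim i in \<open>auto intro!: integrable_diff simp: dist_real_def less_imp_le\<close>)
      also have "\<dots> = e / 2" by simp
      finally show ?case using e unfolding dist_real_def diff_0_right by linarith
    qed
  qed
  then show ?thesis by (simp add: has_field_derivative_iff)
qed

lemma mean_constant:
  assumes "t \<ge> 0" "s \<ge> 0" shows "integral {0..1} (u t) = integral {0..1} (u s)"
proof -
  obtain c where "\<And>x. x \<in> {0..} \<Longrightarrow> integral {0..1} (u x) = c"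
    using has_field_derivative_zero_constant[of "{0..}" "\<lambda>t. integral {0..1} (u t)"] mean_deriv by auto
  then show ?thesis using assms by simp
qed

text \<open>The change of unknown \<open>(u, \<gamma>) \<mapsto> (- u, - \<gamma>)\<close> leaves \<open>\<alpha>\<close> fixed, so \<open>\<gamma> > 0\<close> may be assumed.\<close>

lemma neg_solution: "rod_solution (- \<gamma>) \<alpha> (\<lambda>t x. - u t x) (\<lambda>t x. - ux t x) (\<lambda>t x. - v t x)"
proof
  fix t :: real and x assume t: "t \<ge> 0"
  show "periodic1 (\<lambda>x. - u t x)" using per[OF t] by (simp add: periodic1_def)
  show "((\<lambda>x. - u t x) has_real_derivative - ux t x) (at x)" by (rule DERIV_minus[OF dx[OF t]])
  show "uniform_limit UNIV (\<lambda>\<tau> x. (- u \<tau> x - - u t x) / (\<tau> - t)) (\<lambda>x. - v t x) (at t within {0..})"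
  proof -
    have "(- u \<tau> x - - u t x) / (\<tau> - t) = - ((u \<tau> x - u t x) / (\<tau> - t))" for \<tau> x
      by (simp add: minus_divide_left)
    then show ?thesis using uniform_limit_uminus[OF dt[OF t]] by simp
  qed
  have "rod_flux (- \<gamma>) \<alpha> (\<lambda>x. - u t x) (\<lambda>x. - ux t x) = (\<lambda>y. - F t y)"
    by (simp add: rod_flux_def fun_eq_iff)
  then show "- v t x = - (- \<gamma>) * - u t x * - ux t x - conv01 sinh_kernel (rod_flux (- \<gamma>) \<alpha> (\<lambda>x. - u t x) (\<lambda>x. - ux t x)) x"
    by (simp add: eq[OF t] conv01_def)
qed (use cu cux in \<open>auto simp: case_prod_unfold intro!: continuous_intros\<close>)

lemma vanishes_of_zero:
  assumes \<alpha>: "rod_coercive \<alpha>" and \<gamma>: "\<gamma> \<noteq> 0" and t: "t \<ge> 0" and z: "u t x0 = 0"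
  shows "u t x = 0"
proof (cases "\<gamma> > 0")
  case True
  show ?thesis by (rule vanishes_of_one_sided_bound[OF per[OF t] dx[OF t] slope_bound[OF \<alpha> True t] z])
next
  case False
  interpret n: rod_solution "- \<gamma>" \<alpha> "\<lambda>t x. - u t x" "\<lambda>t x. - ux t x" "\<lambda>t x. - v t x" by (rule neg_solution)
  have "- \<gamma> > 0" using False \<gamma> by simp
  from vanishes_of_one_sided_bound[OF n.per[OF t] n.dx[OF t] n.slope_bound[OF \<alpha> this t], of x0 x] z
  show ?thesis by simp
qed

lemma trivial_of_zero:
  assumes \<alpha>: "rod_coercive \<alpha>" and \<gamma>: "\<gamma> \<noteq> 0" and t0: "t0 \<ge> 0" and z: "u t0 x0 = 0" and t: "t \<ge> 0"
  shows "u t x = 0"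
proof -
  have "u t0 = (\<lambda>x. 0)" using vanishes_of_zero[OF \<alpha> \<gamma> t0 z] by blast
  then have m: "integral {0..1} (u t) = 0" using mean_constant[OF t t0] by simp
  have "\<exists>y. u t y = 0"
  proof (rule ccontr)
    assume nz: "\<not> ?thesis"
    have c: "continuous_on S (u t)" for S by (rule cut[OF t])
    \<comment> \<open>Without a zero, \<open>u t\<close> keeps the sign of \<open>u t 0\<close>;
      multiplying by this value treats both signs at once.\<close>
    have same: "u t y * u t 0 > 0" if "y \<in> {0..1}" for y
    proof (rule ccontr)
      assume "\<not> ?thesis"
      then have "(u t 0 \<le> 0 \<and> 0 \<le> u t y) \<or> (u t y \<le> 0 \<and> 0 \<le> u t 0)"
        by (auto simp: not_less mult_le_0_iff)
      then show False using IVT'[of "u t" 0 0 y] IVT2'[of "u t" y 0 0] c nz that by auto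
    qed
    have "integral {0..1} (\<lambda>y. u t y * u t 0) > 0"
      by (rule integral_pos) (use same in \<open>auto intro!: continuous_intros c less_imp_le\<close>)
    with m show False by simp
  qed
  then show ?thesis using vanishes_of_zero[OF \<alpha> \<gamma> t] by blast
qed

end

section \<open>From Sobolev solutions to classical ones\<close>

definition sobolev_cont :: "real \<Rightarrow> (real \<Rightarrow> real) \<Rightarrow> bool" where
  "sobolev_cont \<sigma> f \<longleftrightarrow> periodic1 f \<and> continuous_on UNIV f \<and> sobolev_term \<sigma> f summable_on UNIV"

lemma sobolev_contI: "f \<in> sobolev \<sigma> \<Longrightarrow> continuous_on UNIV f \<Longrightarrow> sobolev_cont \<sigma> f"
  by (simp add: sobolev_def sobolev_cont_def)

text \<open>A divergent \<open>infsum\<close> is 0, so a small \<open>sobolev_norm\<close> says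
  something only once summability is known. Differences and difference quotients in time get it from
  here.\<close>

lemma sobolev_cont_lincomb:
  assumes f: "sobolev_cont \<sigma> f" and g: "sobolev_cont \<sigma> g"
  shows "sobolev_cont \<sigma> (\<lambda>x. a * f x + b * g x)"
proof -
  have c: "continuous_on UNIV f" "continuous_on UNIV g" using f g by (auto simp: sobolev_cont_def)
  have c': "continuous_on UNIV (\<lambda>x. a * f x + b * g x)" by (intro continuous_intros c)
  have fc: "fourier_coeff (\<lambda>x. a * f x + b * g x) k = a * fourier_coeff f k + b * fourier_coeff g k" for k
  proof -
    let ?e = "\<lambda>x. cis (- 2 * pi * of_int k * x)"
    have "fourier_coeff (\<lambda>x. a * f x + b * g x) k =
      integral {0..1} (\<lambda>x. of_real a * (of_real (f x) * ?e x) + of_real b * (of_real (g x) * ?e x))"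
      unfolding fourier_coeff_eq_integral[OF c']
      by (intro arg_cong[where f = "integral {0..1}"] ext) (simp add: distrib_right mult.assoc)
    also have "\<dots> = integral {0..1} (\<lambda>x. of_real a * (of_real (f x) * ?e x)) + integral {0..1} (\<lambda>x. of_real b * (of_real (g x) * ?e x))"
      by (intro integral_add integrable_continuous_interval continuous_intros continuous_on_subset[OF c(1)] continuous_on_subset[OF c(2)]) auto
    finally show ?thesis
      unfolding fourier_coeff_eq_integral[OF c(1)] fourier_coeff_eq_integral[OF c(2)] by simp
  qed
  have le: "sobolev_term \<sigma> (\<lambda>x. a * f x + b * g x) k \<le> 2 * a\<^sup>2 * sobolev_term \<sigma> f k + 2 * b\<^sup>2 * sobolev_term \<sigma> g k" for k
  proof -
    let ?F = "cmod (fourier_coeff f k)" and ?G = "cmod (fourier_coeff g k)"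
    have "cmod (a * fourier_coeff f k + b * fourier_coeff g k) \<le> \<bar>a\<bar> * ?F + \<bar>b\<bar> * ?G"
      using norm_triangle_ineq[of "a * fourier_coeff f k" "b * fourier_coeff g k"] by (simp add: norm_mult)
    then have "(cmod (a * fourier_coeff f k + b * fourier_coeff g k))\<^sup>2 \<le> (\<bar>a\<bar> * ?F + \<bar>b\<bar> * ?G)\<^sup>2"
      by (rule power_mono) simp
    also have "\<dots> \<le> 2 * (\<bar>a\<bar> * ?F)\<^sup>2 + 2 * (\<bar>b\<bar> * ?G)\<^sup>2"
      using zero_le_power2[of "\<bar>a\<bar> * ?F - \<bar>b\<bar> * ?G"] unfolding power2_sum power2_diff by linarith
    also have "\<dots> = 2 * a\<^sup>2 * ?F\<^sup>2 + 2 * b\<^sup>2 * ?G\<^sup>2" by (simp add: power_mult_distrib)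
    finally have "(1 + (2 * pi * of_int k)\<^sup>2) powr \<sigma> * (cmod (a * fourier_coeff f k + b * fourier_coeff g k))\<^sup>2
       \<le> (1 + (2 * pi * of_int k)\<^sup>2) powr \<sigma> * (2 * a\<^sup>2 * ?F\<^sup>2 + 2 * b\<^sup>2 * ?G\<^sup>2)"
      by (rule mult_left_mono) simp
    then show ?thesis by (simp add: sobolev_term_def fc algebra_simps)
  qed
  have sm: "(\<lambda>k. 2 * a\<^sup>2 * sobolev_term \<sigma> f k + 2 * b\<^sup>2 * sobolev_term \<sigma> g k) summable_on UNIV"
    using f g by (intro summable_on_add summable_on_cmult_right) (auto simp: sobolev_cont_def)
  have "sobolev_term \<sigma> (\<lambda>x. a * f x + b * g x) summable_on UNIV"
    by (rule summable_on_comparison_test[OF sm le]) (simp add: sobolev_term_def)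
  then show ?thesis using c' f g by (auto simp: sobolev_cont_def periodic1_def)
qed

lemma uniform_limit_of_bound:
  fixes f :: "real \<Rightarrow> real \<Rightarrow> real"
  assumes N: "(N \<longlongrightarrow> 0) (at t within S)"
    and le: "\<And>\<tau> x. \<tau> \<in> S \<Longrightarrow> \<tau> \<noteq> t \<Longrightarrow> \<bar>f \<tau> x - g x\<bar> \<le> C * N \<tau>"
  shows "uniform_limit UNIV f g (at t within S)"
proof (rule uniform_limitI)
  fix e :: real assume e: "e > 0"
  have "((\<lambda>\<tau>. C * N \<tau>) \<longlongrightarrow> C * 0) (at t within S)" by (intro tendsto_intros N)
  then have "\<forall>\<^sub>F \<tau> in at t within S. C * N \<tau> < e" using e by (intro order_tendstoD) auto
  moreover have "\<forall>\<^sub>F \<tau> in at t within S. \<tau> \<in> S \<and> \<tau> \<noteq> t" by (simp add: eventually_at_filter)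
  ultimately show "\<forall>\<^sub>F \<tau> in at t within S. \<forall>x\<in>UNIV. dist (f \<tau> x) (g x) < e"
    by eventually_elim (auto simp: dist_real_def intro: le_less_trans[OF le])
qed

lemma continuous_on_Times_of_uniform_limit:
  fixes f :: "real \<Rightarrow> real \<Rightarrow> real"
  assumes c: "\<And>t. t \<in> S \<Longrightarrow> continuous_on UNIV (f t)"
    and u: "\<And>t. t \<in> S \<Longrightarrow> uniform_limit UNIV f (f t) (at t within S)"
  shows "continuous_on (S \<times> UNIV) (\<lambda>(t, x). f t x)"
  unfolding continuous_on_iff
proof (intro ballI allI impI)
  fix p :: "real \<times> real" and e :: real
  assume p: "p \<in> S \<times> UNIV" and e: "e > 0"
  obtain t x where tx: "p = (t, x)" "t \<in> S" using p by auto
  from uniform_limitD[OF u[OF tx(2)], of "e / 2"] e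
  obtain d1 where d1: "d1 > 0" "\<And>\<tau> y. \<tau> \<in> S \<Longrightarrow> \<tau> \<noteq> t \<Longrightarrow> dist \<tau> t < d1 \<Longrightarrow> dist (f \<tau> y) (f t y) < e / 2"
    unfolding eventually_at by auto
  obtain d2 where d2: "d2 > 0" "\<And>y. dist y x < d2 \<Longrightarrow> dist (f t y) (f t x) < e / 2"
    using c[OF tx(2)] e unfolding continuous_on_iff by (metis UNIV_I half_gt_zero)
  show "\<exists>d>0. \<forall>p'\<in>S \<times> UNIV. dist p' p < d \<longrightarrow> dist (case p' of (t, x) \<Rightarrow> f t x) (case p of (t, x) \<Rightarrow> f t x) < e"
  proof (intro exI conjI ballI impI)
    show "min d1 d2 > 0" using d1 d2 by simp
    fix p' :: "real \<times> real" assume p': "p' \<in> S \<times> UNIV" "dist p' p < min d1 d2"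
    obtain \<tau> y where ty: "p' = (\<tau>, y)" "\<tau> \<in> S" using p' by auto
    have "dist \<tau> t < d1" "dist y x < d2"
      using p'(2) dist_fst_le[of p' p] dist_snd_le[of p' p] by (auto simp: tx ty)
    \<comment> \<open>The limit within \<open>S\<close> leaves out \<open>t\<close> itself, whence
      the separate case \<open>\<tau> = t\<close>.\<close>
    then have "dist (f \<tau> y) (f t y) < e / 2" "dist (f t y) (f t x) < e / 2"
      using d1(2)[OF ty(2), of y] d2(2) e by (cases "\<tau> = t"; simp)+
    then show "dist (case p' of (t, x) \<Rightarrow> f t x) (case p of (t, x) \<Rightarrow> f t x) < e"
      using dist_triangle[of "f \<tau> y" "f t x" "f t y"] by (simp add: tx ty)
  qed
qed

text \<open>\<open>s > 3 / 2\<close> enters twice: convergence of order \<open>s\<close> controls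
  \<open>u\<close> and \<open>u_x\<close> uniformly, and convergence of order
  \<open>s - 1 > 1 / 2\<close> makes the time quotients converge uniformly to
  \<open>v t\<close>.\<close>

lemma global_rod_solution_imp_rod_solution:
  assumes s: "s > 3 / 2" and sol: "global_rod_solution \<gamma> s u" and \<gamma>: "\<gamma> \<noteq> 0"
  obtains v where "rod_solution \<gamma> (3 / \<gamma> - 1) u (\<lambda>t. deriv (u t)) v"
proof -
  from sol obtain v where uc: "\<And>t. t \<ge> 0 \<Longrightarrow> continuous_on UNIV (u t)"
    and C0: "sobolev_C0 s u" and C1: "sobolev_C1 (s - 1) u v"
    and pde: "\<And>t x. t \<ge> 0 \<Longrightarrow> v t x + \<gamma> * u t x * deriv (u t) x =
           - circle_conv (deriv rod_kernel)
               (\<lambda>y. (3 - \<gamma>) / 2 * (u t y)\<^sup>2 + \<gamma> / 2 * (deriv (u t) y)\<^sup>2) x"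
    unfolding global_rod_solution_def by blast
  have su: "sobolev_cont s (u t)" if "t \<ge> 0" for t
    using C0 that by (intro sobolev_contI uc) (auto simp: sobolev_C0_def)
  have sd: "sobolev_cont s (\<lambda>x. u \<tau> x - u t x)" if "t \<ge> 0" "\<tau> \<ge> 0" for t \<tau>
    using sobolev_cont_lincomb[OF su[OF that(2)] su[OF that(1)], of 1 "- 1"] by simp
  have N: "((\<lambda>\<tau>. sobolev_norm s (\<lambda>x. u \<tau> x - u t x)) \<longlongrightarrow> 0) (at t within {0..})" if "t \<ge> 0" for t
    using C0 that by (auto simp: sobolev_C0_def)
  have per: "periodic1 (u t)" if "t \<ge> 0" for t using su[OF that] by (simp add: sobolev_cont_def)
  have C1_bound: "\<exists>f'. continuous_on UNIV f' \<and> (\<forall>x. (f has_real_derivative f' x) (at x)) \<and>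
      (\<forall>x. \<bar>f' x\<bar> \<le> sqrt (\<Sum>\<^sub>\<infinity>k. japanese_sq k powr (- (s - 1))) * sobolev_norm s f)" if "sobolev_cont s f" for f
    using sobolev_C1_bound[of f s] that s unfolding sobolev_cont_def by metis
  have du: "(u t has_real_derivative deriv (u t) x) (at x)" "continuous_on UNIV (deriv (u t))" if t: "t \<ge> 0" for t x
  proof -
    obtain f' where f': "continuous_on UNIV f'" "\<And>x. (u t has_real_derivative f' x) (at x)"
      using C1_bound[OF su[OF t]] by blast
    then have "deriv (u t) = f'" by (intro ext DERIV_imp_deriv)
    then show "(u t has_real_derivative deriv (u t) x) (at x)" "continuous_on UNIV (deriv (u t))" using f' by auto
  qed
  have uu: "uniform_limit UNIV u (u t) (at t within {0..})" if t: "t \<ge> 0" for t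
  proof (rule uniform_limit_of_bound[OF N[OF t]])
    fix \<tau> x :: real assume "\<tau> \<in> {0..}"
    then show "\<bar>u \<tau> x - u t x\<bar> \<le> sqrt (\<Sum>\<^sub>\<infinity>k. japanese_sq k powr (- s)) * sobolev_norm s (\<lambda>x. u \<tau> x - u t x)"
      using sobolev_sup_bound[of "\<lambda>x. u \<tau> x - u t x" s x] sd[OF t, of \<tau>] s by (simp add: sobolev_cont_def)
  qed
  have uux: "uniform_limit UNIV (\<lambda>t. deriv (u t)) (deriv (u t)) (at t within {0..})" if t: "t \<ge> 0" for t
  proof (rule uniform_limit_of_bound[OF N[OF t]])
    fix \<tau> x :: real assume \<tau>: "\<tau> \<in> {0..}"
    then obtain f' where f': "\<And>x. ((\<lambda>x. u \<tau> x - u t x) has_real_derivative f' x) (at x)"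
      "\<And>x. \<bar>f' x\<bar> \<le> sqrt (\<Sum>\<^sub>\<infinity>k. japanese_sq k powr (- (s - 1))) * sobolev_norm s (\<lambda>x. u \<tau> x - u t x)"
      using C1_bound[OF sd[OF t, of \<tau>]] by auto
    have "((\<lambda>x. u \<tau> x - u t x) has_real_derivative deriv (u \<tau>) x - deriv (u t) x) (at x)"
      using \<tau> t by (intro DERIV_diff du) auto
    then have "deriv (u \<tau>) x - deriv (u t) x = f' x" using f'(1) by (rule DERIV_unique)
    then show "\<bar>deriv (u \<tau>) x - deriv (u t) x\<bar> \<le> sqrt (\<Sum>\<^sub>\<infinity>k. japanese_sq k powr (- (s - 1))) * sobolev_norm s (\<lambda>x. u \<tau> x - u t x)"
      using f'(2)[of x] by simp
  qed
  have flux: "(\<lambda>y. (3 - \<gamma>) / 2 * (u t y)\<^sup>2 + \<gamma> / 2 * (deriv (u t) y)\<^sup>2) = rod_flux \<gamma> (3 / \<gamma> - 1) (u t) (deriv (u t))" for t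
    using \<gamma> by (auto simp: rod_flux_def fun_eq_iff field_simps)
  have Fc: "continuous_on UNIV (rod_flux \<gamma> (3 / \<gamma> - 1) (u t) (deriv (u t)))"
    and Fp: "periodic1 (rod_flux \<gamma> (3 / \<gamma> - 1) (u t) (deriv (u t)))" if "t \<ge> 0" for t
    using periodic1_derivative[OF per[OF that] du(1)[OF that]] per[OF that]
    unfolding rod_flux_def[abs_def] periodic1_def by (auto intro!: continuous_intros uc du that)
  have eq: "v t x = - \<gamma> * u t x * deriv (u t) x - conv01 sinh_kernel (rod_flux \<gamma> (3 / \<gamma> - 1) (u t) (deriv (u t))) x"
    if "t \<ge> 0" for t x
    using pde[OF that, of x] unfolding flux circle_conv_deriv_rod_kernel[OF Fc[OF that] Fp[OF that]] by simp
  \<comment> \<open>Membership in \<open>sobolev\<close> leaves \<open>v t\<close> free on null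
    sets. Its continuity comes from the equation, and the sup bound needs it.\<close>
  have vc: "continuous_on UNIV (v t)" if "t \<ge> 0" for t
  proof -
    have "continuous_on UNIV (conv01 sinh_kernel (rod_flux \<gamma> (3 / \<gamma> - 1) (u t) (deriv (u t))))"
      by (rule DERIV_continuous_on) (rule conv01_kernel_deriv(1)[OF Fc[OF that] Fp[OF that]])
    then have "continuous_on UNIV (\<lambda>x. - \<gamma> * u t x * deriv (u t) x - conv01 sinh_kernel (rod_flux \<gamma> (3 / \<gamma> - 1) (u t) (deriv (u t))) x)"
      by (intro continuous_intros uc du that)
    then show ?thesis using eq[OF that] by (simp cong: continuous_on_cong)
  qed
  have dt: "uniform_limit UNIV (\<lambda>\<tau> x. (u \<tau> x - u t x) / (\<tau> - t)) (v t) (at t within {0..})" if t: "t \<ge> 0" for t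
  proof (rule uniform_limit_of_bound)
    show "((\<lambda>\<tau>. sobolev_norm (s - 1) (\<lambda>x. (u \<tau> x - u t x) / (\<tau> - t) - v t x)) \<longlongrightarrow> 0) (at t within {0..})"
      using C1 t by (auto simp: sobolev_C1_def)
    fix \<tau> x :: real assume \<tau>: "\<tau> \<in> {0..}"
    have u1: "sobolev_cont (s - 1) (u r)" if "r \<ge> 0" for r
      using C1 that by (intro sobolev_contI uc) (auto simp: sobolev_C1_def)
    have v1: "sobolev_cont (s - 1) (v t)"
      using C1 t by (intro sobolev_contI vc) (auto simp: sobolev_C1_def sobolev_C0_def)
    \<comment> \<open>The quotient is written as a linear combination of \<open>u \<tau>\<close>,
      \<open>u t\<close> and \<open>v t\<close>, so that summability of its Sobolev terms
      follows.\<close>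
    have "sobolev_cont (s - 1) (\<lambda>x. 1 * (1 / (\<tau> - t) * u \<tau> x + (- 1 / (\<tau> - t)) * u t x) + (- 1) * v t x)"
      using \<tau> t by (intro sobolev_cont_lincomb u1 v1) auto
    then have "sobolev_cont (s - 1) (\<lambda>x. (u \<tau> x - u t x) / (\<tau> - t) - v t x)"
      by (simp add: diff_divide_distrib)
    then show "\<bar>(u \<tau> x - u t x) / (\<tau> - t) - v t x\<bar> \<le> sqrt (\<Sum>\<^sub>\<infinity>k. japanese_sq k powr (- (s - 1))) *
        sobolev_norm (s - 1) (\<lambda>x. (u \<tau> x - u t x) / (\<tau> - t) - v t x)"
      using sobolev_sup_bound[of "\<lambda>x. (u \<tau> x - u t x) / (\<tau> - t) - v t x" "s - 1" x] s
      by (simp add: sobolev_cont_def)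
  qed
  have "rod_solution \<gamma> (3 / \<gamma> - 1) u (\<lambda>t. deriv (u t)) v"
    by (intro rod_solution.intro per du(1) dt eq continuous_on_Times_of_uniform_limit uc uu du(2) uux) auto
  then show thesis by (rule that)
qed

theorem corollary1p2:
  fixes \<gamma> s t\<^sub>0 x\<^sub>0 :: real and u :: "real \<Rightarrow> real \<Rightarrow> real"
  assumes "s > 3 / 2"
    and "global_rod_solution \<gamma> s u"
    and "\<gamma> \<le> gamma1_minus \<or> \<gamma> \<ge> gamma1_plus"
    and "t\<^sub>0 \<ge> 0" and "u t\<^sub>0 x\<^sub>0 = 0"
  shows "\<forall>t\<ge>0. \<forall>x. u t x = 0"
proof -
  note \<gamma> = rod_coercive_of_gamma[OF assms(3)]
  obtain v where "rod_solution \<gamma> (3 / \<gamma> - 1) u (\<lambda>t. deriv (u t)) v"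
    by (rule global_rod_solution_imp_rod_solution[OF assms(1,2) \<gamma>(1)])
  then interpret rod_solution \<gamma> "3 / \<gamma> - 1" u "\<lambda>t. deriv (u t)" v .
  show ?thesis using trivial_of_zero[OF \<gamma>(2,1) assms(4,5)] by blast
qed

end
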